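(* Let $A$ be a reduced Noetherian ring such that $\overline{A}$ is module-finite over $A$, and let $A\subseteq A'\subseteq\overline{A}$ be an intermediate ring. Let $V\in\operatorname{Strata}(A)$, and let $J'=\sqrt{L_V A'}$ be the radical in $A'$ of the extended ideal $L_V A'$. Suppose that $L_V$ contains a non-zerodivisor $g$ of $A$. If $$A'\cong\operatorname{Hom}_{A'}(J',J')$$ via the map which sends $a'\in A'$ to $\varphi_{a'}$, then the localization $S^{-1}A'$ with $S=A\setminus P$ is normal for each $P\in V$.
   Context: Rings are commutative with $1$. For a reduced Noetherian ring $R$, $\operatorname{Q}(R)$ denotes its total ring of fractions, and the normalization $\overline{R}$ is the integral closure of $R$ in $\operatorname{Q}(R)$; $R$ is called normal if $R=\overline{R}$. The singular locus of $A$ is $\operatorname{Sing}(A)=\{P\in\operatorname{Spec}(A)\mid A_P \text{ is not regular}\}$. Stratification: for $P\in\operatorname{Sing}(A)$, set $$L_P=\bigcap_{\widetilde P\in\operatorname{Sing}(A),\ \widetilde P\subseteq P}\widetilde P .$$ Let $\mathcal{L}=\{L_P\mid P\in\operatorname{Sing}(A)\}$. The strata are the sets $V_L=\{P\in\operatorname{Sing}(A)\mid L_P=L\}$, $L\in\mathcal{L}$, and $\operatorname{Strata}(A)=\{V_L\mid L\in\mathcal{L}\}$ is the set of all strata. For $V\in\operatorname{Strata}(A)$, $L_V$ denotes the constant value of $P\mapsto L_P$ on $V$ (an ideal of $A$). For $a'\in A'$, $\varphi_{a'}:J'\to J'$ denotes multiplication by $a'$. For $S=A\setminus P$ with $P$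 a prime ideal of $A$, $S^{-1}A'$ is the localization of $A'$ at the multiplicatively closed set $S$. *)

theory Defs
  imports
    "HOL-Algebra.Embedded_Algebras"
    "HOL-Algebra.Polynomials"
    "HOL-Algebra.Ring_Divisibility"
    "HOL-Library.Extended_Nat"
begin

section \<open>Localization\<close>

text \<open>
  Fractions \<open>a/s\<close> are equivalence classes of pairs \<open>(a, s)\<close>. The extra factor \<open>u\<close> in the
  relation is needed because \<open>S\<close> may contain zero divisors. The definitions are meaningful
  when \<open>R\<close> is a commutative ring and \<open>S\<close> is a multiplicatively closed subset containing \<open>\<one>\<close>.
\<close>

definition fraction_rel :: "('a, 'm) ring_scheme \<Rightarrow> 'a set \<Rightarrow> (('a \<times> 'a) \<times> ('a \<times> 'a)) set" where
  "fraction_rel R S =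
     {((a, s), (b, t)) | a s b t. a \<in> carrier R \<and> b \<in> carrier R \<and> s \<in> S \<and> t \<in> S \<and>
        (\<exists>u\<in>S. u \<otimes>\<^bsub>R\<^esub> (t \<otimes>\<^bsub>R\<^esub> a) = u \<otimes>\<^bsub>R\<^esub> (s \<otimes>\<^bsub>R\<^esub> b))}"

definition fraction :: "('a, 'm) ring_scheme \<Rightarrow> 'a set \<Rightarrow> 'a \<Rightarrow> 'a \<Rightarrow> ('a \<times> 'a) set" where
  "fraction R S a s = fraction_rel R S `` {(a, s)}"

definition localization :: "('a, 'm) ring_scheme \<Rightarrow> 'a set \<Rightarrow> ('a \<times> 'a) set ring" where
  "localization R S =
     \<lparr>carrier = (carrier R \<times> S) // fraction_rel R S,
      monoid.mult = (\<lambda>U W. \<Union>x\<in>U. \<Union>y\<in>W. fraction R S (fst x \<otimes>\<^bsub>R\<^esub> fst y) (snd x \<otimes>\<^bsub>R\<^esub> snd y)),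
      one = fraction R S \<one>\<^bsub>R\<^esub> \<one>\<^bsub>R\<^esub>,
      zero = fraction R S \<zero>\<^bsub>R\<^esub> \<one>\<^bsub>R\<^esub>,
      add = (\<lambda>U W. \<Union>x\<in>U. \<Union>y\<in>W.
               fraction R S ((snd y \<otimes>\<^bsub>R\<^esub> fst x) \<oplus>\<^bsub>R\<^esub> (snd x \<otimes>\<^bsub>R\<^esub> fst y)) (snd x \<otimes>\<^bsub>R\<^esub> snd y))\<rparr>"

definition nonzerodivisors :: "('a, 'm) ring_scheme \<Rightarrow> 'a set" where
  "nonzerodivisors R =
     {a \<in> carrier R. \<forall>b\<in>carrier R. a \<otimes>\<^bsub>R\<^esub> b = \<zero>\<^bsub>R\<^esub> \<longrightarrow> b = \<zero>\<^bsub>R\<^esub>}"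

definition total_fractions :: "('a, 'm) ring_scheme \<Rightarrow> ('a \<times> 'a) set ring" where
  "total_fractions R = localization R (nonzerodivisors R)"

text \<open>The canonical (injective) map \<open>a \<mapsto> a/1\<close>, along which \<open>R\<close> is regarded as a subring of \<open>Q(R)\<close>.\<close>

definition to_fractions :: "('a, 'm) ring_scheme \<Rightarrow> 'a \<Rightarrow> ('a \<times> 'a) set" where
  "to_fractions R a = fraction R (nonzerodivisors R) a \<one>\<^bsub>R\<^esub>"


section \<open>Normalization\<close>

definition integral_over :: "('a, 'm) ring_scheme \<Rightarrow> 'a set \<Rightarrow> 'a \<Rightarrow> bool" where
  "integral_over Q K x \<longleftrightarrow>
     (\<exists>p. set p \<subseteq> K \<and> p \<noteq> [] \<and> lead_coeff p = \<one>\<^bsub>Q\<^esub> \<and> ring.eval Q p x = \<zero>\<^bsub>Q\<^esub>)"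

definition normalization :: "('a, 'm) ring_scheme \<Rightarrow> ('a \<times> 'a) set set" where
  "normalization R =
     {x \<in> carrier (total_fractions R).
        integral_over (total_fractions R) (to_fractions R ` carrier R) x}"

definition module_finite :: "('a, 'm) ring_scheme \<Rightarrow> 'a set \<Rightarrow> 'a set \<Rightarrow> bool" where
  "module_finite Q K M \<longleftrightarrow> (\<exists>us. set us \<subseteq> M \<and> M = ring.Span Q K us)"

definition reduced_ring :: "('a, 'm) ring_scheme \<Rightarrow> bool" where
  "reduced_ring R \<longleftrightarrow>
     cring R \<and> (\<forall>a\<in>carrier R. \<forall>n::nat. a [^]\<^bsub>R\<^esub> n = \<zero>\<^bsub>R\<^esub> \<longrightarrow> a = \<zero>\<^bsub>R\<^esub>)"

text \<open>Normality is a notion for reduced Noetherian rings, so these properties are part of it.\<close>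

definition normal_ring :: "('a, 'm) ring_scheme \<Rightarrow> bool" where
  "normal_ring R \<longleftrightarrow>
     reduced_ring R \<and> noetherian_ring R \<and> to_fractions R ` carrier R = normalization R"


section \<open>Regular local rings and the singular locus\<close>

definition prime_chain :: "('a, 'm) ring_scheme \<Rightarrow> nat \<Rightarrow> (nat \<Rightarrow> 'a set) \<Rightarrow> bool" where
  "prime_chain R n C \<longleftrightarrow> (\<forall>i\<le>n. primeideal (C i) R) \<and> (\<forall>i<n. C i \<subset> C (Suc i))"

definition krull_dim :: "('a, 'm) ring_scheme \<Rightarrow> enat" where
  "krull_dim R = (SUP n\<in>{n. \<exists>C. prime_chain R n C}. enat n)"

definition min_generators :: "('a, 'm) ring_scheme \<Rightarrow> 'a set \<Rightarrow> nat" where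
  "min_generators R I =
     (LEAST n. \<exists>U\<subseteq>carrier R. finite U \<and> card U = n \<and> genideal R U = I)"

definition regular_local_ring :: "('a, 'm) ring_scheme \<Rightarrow> bool" where
  "regular_local_ring R \<longleftrightarrow>
     cring R \<and> noetherian_ring R \<and>
     (\<exists>M. {I. maximalideal I R} = {M} \<and> enat (min_generators R M) = krull_dim R)"

definition Sing :: "('a, 'm) ring_scheme \<Rightarrow> 'a set set" where
  "Sing A = {P. primeideal P A \<and> \<not> regular_local_ring (localization A (carrier A - P))}"


section \<open>The stratification of the singular locus\<close>

definition sing_ideal :: "('a, 'm) ring_scheme \<Rightarrow> 'a set \<Rightarrow> 'a set" where
  "sing_ideal A P = \<Inter>{P' \<in> Sing A. P' \<subseteq> P}"

definition stratum :: "('a, 'm) ring_scheme \<Rightarrow> 'a set \<Rightarrow> 'a set set" where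
  "stratum A L = {P \<in> Sing A. sing_ideal A P = L}"

definition Strata :: "('a, 'm) ring_scheme \<Rightarrow> 'a set set set" where
  "Strata A = stratum A ` (sing_ideal A ` Sing A)"

text \<open>For \<open>V \<in> Strata A\<close> the image of \<open>V\<close> under \<open>sing_ideal A\<close> is a singleton.\<close>

definition stratum_ideal :: "('a, 'm) ring_scheme \<Rightarrow> 'a set set \<Rightarrow> 'a set" where
  "stratum_ideal A V = the_elem (sing_ideal A ` V)"


section \<open>Radicals and endomorphism rings of ideals\<close>

definition radical_ideal :: "('a, 'm) ring_scheme \<Rightarrow> 'a set \<Rightarrow> 'a set" where
  "radical_ideal R I = {a \<in> carrier R. \<exists>n::nat. a [^]\<^bsub>R\<^esub> n \<in> I}"

text \<open>
  \<open>Hom\<^sub>R(J, J)\<close> with pointwise addition and composition; functions are made extensional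
  (\<open>undefined\<close> outside \<open>J\<close>), so that equal homomorphisms are equal as HOL functions.
\<close>

definition End_ring :: "('a, 'm) ring_scheme \<Rightarrow> 'a set \<Rightarrow> ('a \<Rightarrow> 'a) ring" where
  "End_ring R J =
     \<lparr>carrier = {f \<in> J \<rightarrow>\<^sub>E J.
        (\<forall>x\<in>J. \<forall>y\<in>J. f (x \<oplus>\<^bsub>R\<^esub> y) = f x \<oplus>\<^bsub>R\<^esub> f y) \<and>
        (\<forall>r\<in>carrier R. \<forall>x\<in>J. f (r \<otimes>\<^bsub>R\<^esub> x) = r \<otimes>\<^bsub>R\<^esub> f x)},
      monoid.mult = compose J,
      one = (\<lambda>x\<in>J. x),
      zero = (\<lambda>x\<in>J. \<zero>\<^bsub>R\<^esub>),
      add = (\<lambda>f g. \<lambda>x\<in>J. f x \<oplus>\<^bsub>R\<^esub> g x)\<rparr>"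

definition mult_map :: "('a, 'm) ring_scheme \<Rightarrow> 'a set \<Rightarrow> 'a \<Rightarrow> 'a \<Rightarrow> 'a" where
  "mult_map R J a = (\<lambda>x\<in>J. a \<otimes>\<^bsub>R\<^esub> x)"

end

theory Submission
  imports Defs
begin

text \<open>
  Let \<open>D = S\<^sup>-\<^sup>1A'\<close> and let \<open>J = S\<^sup>-\<^sup>1J'\<close>, a radical ideal. Since \<open>A'\<close> lies in a finite \<open>A\<close>-module,
  \<open>D\<close> is Noetherian (\<open>finite_subring_noetherian\<close>), and what has to be shown is that a fraction \<open>a/b\<close>
  that is integral over \<open>D\<close> belongs to \<open>D\<close>. This is the argument of Grauert and Remmert
  (\<open>grauert_remmert\<close>). Among the integral fractions outside \<open>D\<close>, take one for which the ideal
  \<open>q = {r. r a/b \<in> D}\<close> is as large as possible; then \<open>q\<close> is prime.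

  If \<open>J \<subseteq> q\<close>, then \<open>a/b\<close> maps \<open>J\<close> into \<open>D\<close>, and even into \<open>J\<close>, because \<open>J\<close> is radical and \<open>a/b\<close> is
  integral. So \<open>a/b\<close> is an endomorphism of \<open>J\<close>. Endomorphisms of \<open>J\<close> come from endomorphisms of \<open>J'\<close>
  up to denominators, and those are multiplications by elements of \<open>A'\<close>
  (\<open>endomorphisms_extend\<close>); hence \<open>a/b \<in> D\<close>, a contradiction.

  If \<open>J\<close> is not contained in \<open>q\<close>, then the prime \<open>p = q \<inter> A \<subseteq> P\<close> does not contain
  \<open>L\<^sub>P = L\<^sub>V\<close>. As \<open>L\<^sub>P\<close> lies in every singular prime below \<open>P\<close>, the ring \<open>A\<^sub>p\<close> is regular,
  hence normal. So \<open>A'\<close> and \<open>A\<close> have the same localization at \<open>p\<close>, and \<open>a/b\<close> lies in it, again a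
  contradiction (\<open>integral_fraction_descend\<close>).

  The commutative algebra behind this is that a regular local ring is an integrally closed domain
  (\<open>regular_local_normal\<close>). It is proved by induction on the dimension. By Krull's
  principal ideal theorem, one of the \<open>d\<close> generators of the maximal ideal, say \<open>t\<close>, can be added to the
  lowest prime of a chain of length \<open>d\<close> at the cost of shortening the chain by one. So \<open>R/tR\<close> is
  regular of dimension \<open>d - 1\<close>, \<open>t\<close> is prime by induction, and both properties lift from \<open>R/tR\<close> to
  \<open>R\<close> by Nakayama's lemma (\<open>regular_chain\<close>, \<open>normal_mod_lift\<close>). Quotients and localizations change the
  type of the elements, which an induction cannot follow; therefore statements about \<open>R/K\<close> are
  phrased as statements about \<open>R\<close> modulo an ideal \<open>K\<close>, and statements about \<open>R\<^sub>P\<close> as statements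
  about ideals that are saturated with respect to the complement of \<open>P\<close>.

  Integrality of \<open>a/b\<close> is used in two fraction-free forms: as a homogeneous relation
  \<open>a\<^sup>n\<^sup>+\<^sup>1 \<in> b H\<^sub>n\<close>, where \<open>H\<^sub>n\<close> is generated by the monomials of degree \<open>n\<close> in \<open>a\<close> and \<open>b\<close>, and as the
  existence of an ideal \<open>M\<close> with \<open>a M \<subseteq> b M\<close>. The first passes between rings along homomorphisms and
  denominators, the second makes the maximality arguments work; \<open>M = H\<^sub>n\<close> leads from the first to
  the second.
\<close>

section \<open>Ideals, saturation and Nakayama's lemma\<close>

locale noetherian_cring = noetherian_ring R + cring R for R (structure)

context cring
begin

lemma cring_idealI:
  assumes "I \<subseteq> carrier R" and "\<zero> \<in> I"
    and "\<And>a b. a \<in> I \<Longrightarrow> b \<in> I \<Longrightarrow> a \<oplus> b \<in> I"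
    and "\<And>r a. r \<in> carrier R \<Longrightarrow> a \<in> I \<Longrightarrow> r \<otimes> a \<in> I"
  shows "ideal I R"
proof (rule idealI)
  show "ring R" by (rule ring_axioms)
  have "\<ominus> a \<in> I" if "a \<in> I" for a
    using assms(4)[of "\<ominus> \<one>" a] that assms(1) by (auto simp: l_minus)
  then show "subgroup I (add_monoid R)"
    using assms by (auto intro!: subgroup.intro simp flip: a_inv_def)
next
  fix a x assume "a \<in> I" "x \<in> carrier R"
  then show "x \<otimes> a \<in> I" "a \<otimes> x \<in> I"
    using assms(4)[of x a] assms(1) m_comm[of a x] by auto
qed

lemma idealD:
  assumes "ideal I R"
  shows ideal_subset: "I \<subseteq> carrier R"
    and ideal_zero: "\<zero> \<in> I"
    and ideal_add: "\<And>a b. a \<in> I \<Longrightarrow> b \<in> I \<Longrightarrow> a \<oplus> b \<in> I"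
    and ideal_diff: "\<And>a b. a \<in> I \<Longrightarrow> b \<in> I \<Longrightarrow> a \<ominus> b \<in> I"
    and ideal_lmult: "\<And>r a. r \<in> carrier R \<Longrightarrow> a \<in> I \<Longrightarrow> r \<otimes> a \<in> I"
    and ideal_rmult: "\<And>r a. r \<in> carrier R \<Longrightarrow> a \<in> I \<Longrightarrow> a \<otimes> r \<in> I"
    and ideal_uminus: "\<And>a. a \<in> I \<Longrightarrow> \<ominus> a \<in> I"
proof -
  interpret I: ideal I R by fact
  show "I \<subseteq> carrier R" by (rule I.a_subset)
  show "\<zero> \<in> I" by simp
  show "\<And>a b. a \<in> I \<Longrightarrow> b \<in> I \<Longrightarrow> a \<oplus> b \<in> I" by simp
  show "\<And>a b. a \<in> I \<Longrightarrow> b \<in> I \<Longrightarrow> a \<ominus> b \<in> I" by (simp add: a_minus_def)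
  show "\<And>r a. r \<in> carrier R \<Longrightarrow> a \<in> I \<Longrightarrow> r \<otimes> a \<in> I" by (simp add: I.I_l_closed)
  show "\<And>r a. r \<in> carrier R \<Longrightarrow> a \<in> I \<Longrightarrow> a \<otimes> r \<in> I" by (simp add: I.I_r_closed)
  show "\<And>a. a \<in> I \<Longrightarrow> \<ominus> a \<in> I" by simp
qed

lemma ideal_mem: "ideal I R \<Longrightarrow> a \<in> I \<Longrightarrow> a \<in> carrier R"
  using ideal_subset by blast

lemma cancel_simps [simp]:
  assumes "x \<in> carrier R" and "y \<in> carrier R"
  shows add_diff_cancel_right: "(x \<oplus> y) \<ominus> y = x"
    and add_diff_cancel_left: "(y \<oplus> x) \<ominus> y = x"
    and diff_add_cancel: "(x \<ominus> y) \<oplus> y = x"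
  using assms by (simp_all add: a_minus_def a_assoc r_neg l_neg a_comm[of y x])

lemma ring_eqI:
  assumes "a \<ominus> b = \<zero>" and "a \<in> carrier R" and "b \<in> carrier R"
  shows "a = b"
  using assms r_right_minus_eq by blast

lemma ideal_diff_cancel:
  assumes "ideal I R" and "a \<ominus> b \<in> I" and "b \<in> I" and [simp]: "a \<in> carrier R"
  shows "a \<in> I"
proof -
  have [simp]: "b \<in> carrier R" using assms ideal_mem by blast
  show ?thesis using ideal_add[OF assms(1-3)] by simp
qed

lemma ideal_carrier_iff: "ideal I R \<Longrightarrow> I = carrier R \<longleftrightarrow> \<one> \<in> I"
  using ideal.one_imp_carrier by (metis one_closed)

lemma primeD:
  assumes "primeideal P R"
  shows prime_ideal: "ideal P R"
    and prime_one: "\<one> \<notin> P"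
    and prime_mult: "\<And>a b. a \<in> carrier R \<Longrightarrow> b \<in> carrier R \<Longrightarrow> a \<otimes> b \<in> P \<Longrightarrow> a \<in> P \<or> b \<in> P"
    and prime_compl: "\<And>a b. a \<in> carrier R - P \<Longrightarrow> b \<in> carrier R - P \<Longrightarrow> a \<otimes> b \<in> carrier R - P"
proof -
  interpret primeideal P R by fact
  show *: "ideal P R" by (rule is_ideal)
  show "\<one> \<notin> P" using ideal_carrier_iff[OF *] I_notcarr by auto
  show "\<And>a b. a \<in> carrier R \<Longrightarrow> b \<in> carrier R \<Longrightarrow> a \<otimes> b \<in> P \<Longrightarrow> a \<in> P \<or> b \<in> P"
    by (rule I_prime)
  then show "\<And>a b. a \<in> carrier R - P \<Longrightarrow> b \<in> carrier R - P \<Longrightarrow> a \<otimes> b \<in> carrier R - P"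
    by auto
qed

lemma cring_primeI:
  assumes "ideal P R" and "\<one> \<notin> P"
    and "\<And>a b. a \<in> carrier R \<Longrightarrow> b \<in> carrier R \<Longrightarrow> a \<otimes> b \<in> P \<Longrightarrow> a \<in> P \<or> b \<in> P"
  shows "primeideal P R"
  using assms by (intro primeidealI) (auto intro: is_cring)

lemma prime_pow:
  assumes "primeideal P R" and "a \<in> carrier R" and "a [^] (n::nat) \<in> P"
  shows "a \<in> P"
  using assms(3)
proof (induction n)
  case 0
  then show ?case using prime_one[OF assms(1)] by simp
next
  case (Suc n)
  then show ?case using prime_mult[OF assms(1), of "a [^] n" a] assms(2) by auto
qed

definition colon :: "'a set \<Rightarrow> 'a \<Rightarrow> 'a set"
  where "colon I x = {r \<in> carrier R. r \<otimes> x \<in> I}"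

lemma colon_ideal:
  assumes "ideal I R" and "x \<in> carrier R"
  shows "ideal (colon I x) R"
  by (rule cring_idealI)
    (use assms in \<open>auto simp: colon_def l_distr m_assoc intro: idealD[OF assms(1)]\<close>)

definition adjoin :: "'a set \<Rightarrow> 'a \<Rightarrow> 'a set"
  where "adjoin I t = {k \<oplus> t \<otimes> y | k y. k \<in> I \<and> y \<in> carrier R}"

lemma adjoinE:
  assumes "a \<in> adjoin I t"
  obtains k y where "k \<in> I" and "y \<in> carrier R" and "a = k \<oplus> t \<otimes> y"
  using assms by (auto simp: adjoin_def)

lemma adjoinI:
  assumes "k \<in> I" and "y \<in> carrier R" and "a = k \<oplus> t \<otimes> y"
  shows "a \<in> adjoin I t"
  using assms by (auto simp: adjoin_def)

lemma adjoin_ideal: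
  assumes I: "ideal I R" and t [simp]: "t \<in> carrier R"
  shows "ideal (adjoin I t) R"
proof (rule cring_idealI)
  show "adjoin I t \<subseteq> carrier R"
    using ideal_mem[OF I] by (auto simp: adjoin_def)
  show "\<zero> \<in> adjoin I t"
    using ideal_zero[OF I] by (auto intro!: adjoinI[where k = \<zero> and y = \<zero>])
next
  fix a b assume "a \<in> adjoin I t" "b \<in> adjoin I t"
  then obtain k y k' y' where *: "k \<in> I" "y \<in> carrier R" "a = k \<oplus> t \<otimes> y"
    "k' \<in> I" "y' \<in> carrier R" "b = k' \<oplus> t \<otimes> y'"
    by (auto elim!: adjoinE)
  note [simp] = *(2,5) ideal_mem[OF I *(1)] ideal_mem[OF I *(4)]
  have "a \<oplus> b = (k \<oplus> k') \<oplus> t \<otimes> (y \<oplus> y')"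
    unfolding *
      using \<open>k \<in> carrier R\<close> \<open>k' \<in> carrier R\<close> \<open>t \<in> carrier R\<close> \<open>y \<in> carrier R\<close>
        \<open>y' \<in> carrier R\<close>
      by algebra
  then show "a \<oplus> b \<in> adjoin I t"
    using * ideal_add[OF I] by (intro adjoinI) auto
next
  fix r a assume r [simp]: "r \<in> carrier R" and "a \<in> adjoin I t"
  then obtain k y where *: "k \<in> I" "y \<in> carrier R" "a = k \<oplus> t \<otimes> y"
    by (auto elim!: adjoinE)
  note [simp] = *(2) ideal_mem[OF I *(1)]
  have "r \<otimes> a = r \<otimes> k \<oplus> t \<otimes> (r \<otimes> y)"
    unfolding *
      using \<open>r \<in> carrier R\<close> \<open>k \<in> carrier R\<close> \<open>t \<in> carrier R\<close> \<open>y \<in> carrier R\<close>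
      by algebra
  then show "r \<otimes> a \<in> adjoin I t"
    using * ideal_lmult[OF I r] by (intro adjoinI) auto
qed

lemma adjoin_superset:
  assumes "ideal I R" and "t \<in> carrier R"
  shows "I \<subseteq> adjoin I t" and "t \<in> adjoin I t"
  using adjoinI[of _ I \<zero> _ t] adjoinI[of \<zero> I \<one> t t] assms(2) ideal_mem[OF assms(1)]
    ideal_zero[OF assms(1)] by auto

lemma adjoin_minimal:
  assumes "ideal J R" and "I \<subseteq> J" and "t \<in> J"
  shows "adjoin I t \<subseteq> J"
  using assms idealD[OF assms(1)] by (auto simp: adjoin_def)

text \<open>
  The preimage in \<open>R\<close> of the ideal generated by \<open>I\<close> in the localization at \<open>P\<close>. Saturated ideals
  stand for the ideals of that localization.
\<close>

definition saturation :: "'a set \<Rightarrow> 'a set \<Rightarrow> 'a set"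
  where "saturation P I = {a \<in> carrier R. \<exists>s\<in>carrier R - P. s \<otimes> a \<in> I}"

definition saturated :: "'a set \<Rightarrow> 'a set \<Rightarrow> bool"
  where "saturated P I \<longleftrightarrow>
    ideal I R \<and> (\<forall>s\<in>carrier R - P. \<forall>a\<in>carrier R. s \<otimes> a \<in> I \<longrightarrow> a \<in> I)"

lemma saturatedD:
  assumes "saturated P I"
  shows "ideal I R"
    and "\<And>s a. s \<in> carrier R - P \<Longrightarrow> a \<in> carrier R \<Longrightarrow> s \<otimes> a \<in> I \<Longrightarrow> a \<in> I"
  using assms by (auto simp: saturated_def)

lemma saturation_ideal:
  assumes P: "primeideal P R" and I: "ideal I R"
  shows "ideal (saturation P I) R"
proof (rule cring_idealI)
  show "saturation P I \<subseteq> carrier R" by (auto simp: saturation_def)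
  show "\<zero> \<in> saturation P I"
    using prime_one[OF P] ideal_zero[OF I] by (auto simp: saturation_def)
next
  fix a b assume "a \<in> saturation P I" "b \<in> saturation P I"
  then obtain s s' where *: "a \<in> carrier R" "b \<in> carrier R" "s \<in> carrier R - P" "s' \<in> carrier R - P"
    "s \<otimes> a \<in> I" "s' \<otimes> b \<in> I"
    by (auto simp: saturation_def)
  have [simp]: "s \<in> carrier R" "s' \<in> carrier R" using * by auto
  note [simp] = *(1,2)
  have "(s \<otimes> s') \<otimes> (a \<oplus> b) = s' \<otimes> (s \<otimes> a) \<oplus> s \<otimes> (s' \<otimes> b)"
    using \<open>s \<in> carrier R\<close> \<open>s' \<in> carrier R\<close> \<open>a \<in> carrier R\<close> \<open>b \<in> carrier R\<close>
    by algebra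
  also have "\<dots> \<in> I" using * idealD[OF I] by auto
  finally show "a \<oplus> b \<in> saturation P I"
    using prime_compl[OF P *(3,4)] by (auto simp: saturation_def)
next
  fix r a assume r [simp]: "r \<in> carrier R" and "a \<in> saturation P I"
  then obtain s where *: "a \<in> carrier R" "s \<in> carrier R - P" "s \<otimes> a \<in> I"
    by (auto simp: saturation_def)
  have "s \<otimes> (r \<otimes> a) = r \<otimes> (s \<otimes> a)" using * by (simp add: m_lcomm)
  then show "r \<otimes> a \<in> saturation P I"
    using * ideal_lmult[OF I r *(3)] unfolding saturation_def
    by (metis (mono_tags, lifting) mem_Collect_eq m_closed r)
qed

lemma saturation_saturated:
  assumes P: "primeideal P R" and I: "ideal I R"
  shows "saturated P (saturation P I)"
  unfolding saturated_def
proof (intro conjI ballI impI)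
  fix s a assume *: "s \<in> carrier R - P" "a \<in> carrier R" "s \<otimes> a \<in> saturation P I"
  then obtain u where u: "u \<in> carrier R - P" "u \<otimes> (s \<otimes> a) \<in> I"
    by (auto simp: saturation_def)
  then have "(u \<otimes> s) \<otimes> a \<in> I" using * by (simp add: m_assoc)
  then show "a \<in> saturation P I"
    using prime_compl[OF P u(1) *(1)] *(2) by (auto simp: saturation_def)
qed (rule saturation_ideal[OF assms])

lemma saturation_superset:
  assumes P: "primeideal P R" and I: "ideal I R"
  shows "I \<subseteq> saturation P I"
  using prime_one[OF P] ideal_mem[OF I] by (force simp: saturation_def)

lemma saturation_minimal:
  assumes "saturated P J" and "I \<subseteq> J"
  shows "saturation P I \<subseteq> J"
  using assms by (auto simp: saturation_def saturated_def)

lemma saturation_mono: "I \<subseteq> J \<Longrightarrow> saturation P I \<subseteq> saturation P J"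
  by (auto simp: saturation_def)

lemma saturated_antimono:
  assumes "saturated P I" and "P \<subseteq> Q"
  shows "saturated Q I"
  using assms by (auto simp: saturated_def)

lemma saturated_subset_prime:
  assumes "saturated P I" and "I \<noteq> carrier R"
  shows "I \<subseteq> P"
proof
  fix s assume s: "s \<in> I"
  show "s \<in> P"
  proof (rule ccontr)
    assume "s \<notin> P"
    then have "\<one> \<in> I"
      using assms(1) s ideal_mem[OF saturatedD(1)[OF assms(1)] s] saturatedD(2)[OF assms(1), of s \<one>]
      by simp
    then show False using assms ideal_carrier_iff saturatedD by blast
  qed
qed

end

context noetherian_cring
begin

lemma exists_maximal_ideal:
  assumes "I0 \<in> F" and "\<And>I. I \<in> F \<Longrightarrow> ideal I R"
  obtains M where "M \<in> F" and "\<And>I. I \<in> F \<Longrightarrow> M \<subseteq> I \<Longrightarrow> I = M"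
proof -
  have "F \<noteq> {}" using assms(1) by blast
  then have "\<exists>M\<in>F. \<forall>I\<in>F. M \<subseteq> I \<longrightarrow> I = M"
  proof (rule subset_Zorn_nonempty)
    fix C assume C: "C \<noteq> {}" "subset.chain F C"
    then have "subset.chain {I. ideal I R} C"
      using assms(2) by (auto simp: pred_on.chain_def)
    then have "\<Union>C \<in> C" by (rule ideal_chain_is_trivial[OF C(1)])
    then show "\<Union>C \<in> F" using C(2) by (auto simp: pred_on.chain_def)
  qed
  then show thesis using that by blast
qed

text \<open>
  In the localization at \<open>P\<close> the hypothesis reads \<open>K \<subseteq> L + t K\<close>. No generators of \<open>K\<close> are needed:
  let \<open>M \<supseteq> L\<close> be maximal among the saturated ideals that do not contain \<open>K\<close>. If \<open>t x \<notin> M\<close> for some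
  \<open>x \<in> K\<close>, then \<open>M + t x R\<close> contains \<open>x\<close> up to a denominator, so \<open>(s - t z) x \<in> M\<close> with \<open>s - t z\<close> outside
  \<open>P\<close>; then \<open>x \<in> M\<close>, and \<open>t x \<in> M\<close> after all. So \<open>t K \<subseteq> M\<close>, and the hypothesis puts \<open>K\<close> into \<open>M\<close>.
\<close>

lemma nakayama:
  assumes P: "primeideal P R" and t: "t \<in> P" and L: "saturated P L" and K: "K \<subseteq> carrier R"
    and step: "\<And>k. k \<in> K \<Longrightarrow> \<exists>s\<in>carrier R - P. \<exists>l\<in>L. \<exists>k'\<in>K. s \<otimes> k = l \<oplus> t \<otimes> k'"
  shows "K \<subseteq> L"
proof (rule ccontr)
  assume "\<not> K \<subseteq> L"
  define F where "F = {L'. saturated P L' \<and> L \<subseteq> L' \<and> \<not> K \<subseteq> L'}"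
  have "L \<in> F" using L \<open>\<not> K \<subseteq> L\<close> by (simp add: F_def)
  moreover have "ideal I R" if "I \<in> F" for I using that by (auto simp: F_def saturated_def)
  ultimately obtain M where M: "M \<in> F" and max: "\<And>I. I \<in> F \<Longrightarrow> M \<subseteq> I \<Longrightarrow> I = M"
    using exists_maximal_ideal[of L F] by metis
  have sat: "saturated P M" and LM: "L \<subseteq> M" and KM: "\<not> K \<subseteq> M" using M by (auto simp: F_def)
  note id = saturatedD(1)[OF sat]
  have [simp]: "t \<in> carrier R" using t ideal_mem prime_ideal[OF P] by blast
  have tK: "t \<otimes> x \<in> M" if x: "x \<in> K" for x
  proof (rule ccontr)
    assume tx: "t \<otimes> x \<notin> M"
    have [simp]: "x \<in> carrier R" using x K by auto
    let ?M = "saturation P (adjoin M (t \<otimes> x))"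
    have aid: "ideal (adjoin M (t \<otimes> x)) R" by (rule adjoin_ideal[OF id]) simp
    have "M \<subseteq> ?M" "t \<otimes> x \<in> ?M"
      using saturation_superset[OF P aid] adjoin_superset[OF id, of "t \<otimes> x"] by auto
    then have "?M \<notin> F" using max tx by blast
    then have "K \<subseteq> ?M"
      using \<open>M \<subseteq> ?M\<close> LM saturation_saturated[OF P aid] by (auto simp: F_def)
    then obtain s where s: "s \<in> carrier R" "s \<notin> P" "s \<otimes> x \<in> adjoin M (t \<otimes> x)"
      using x by (auto simp: saturation_def)
    then obtain k z where *: "k \<in> M" "z \<in> carrier R" "s \<otimes> x = k \<oplus> (t \<otimes> x) \<otimes> z"
      by (auto elim: adjoinE)
    note [simp] = s(1) *(2) ideal_mem[OF id *(1)]
    have "(s \<ominus> t \<otimes> z) \<otimes> x = s \<otimes> x \<ominus> (t \<otimes> x) \<otimes> z"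
      using \<open>s \<in> carrier R\<close> \<open>t \<in> carrier R\<close> \<open>z \<in> carrier R\<close> \<open>x \<in> carrier R\<close>
      by algebra
    also have "\<dots> = k" unfolding *(3) by simp
    finally have "(s \<ominus> t \<otimes> z) \<otimes> x \<in> M" using *(1) by simp
    moreover have "s \<ominus> t \<otimes> z \<notin> P"
      using ideal_diff_cancel[OF prime_ideal[OF P], of s "t \<otimes> z"] s(2)
        ideal_rmult[OF prime_ideal[OF P] _ t, of z] by auto
    ultimately have "x \<in> M" using saturatedD(2)[OF sat, of "s \<ominus> t \<otimes> z" x] by simp
    then show False using tx ideal_lmult[OF id] by simp
  qed
  have "k \<in> M" if k: "k \<in> K" for k
  proof -
    obtain s l k' where *: "s \<in> carrier R - P" "l \<in> L" "k' \<in> K" "s \<otimes> k = l \<oplus> t \<otimes> k'"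
      using step[OF k] by blast
    then have "s \<otimes> k \<in> M" using LM tK ideal_add[OF id] by auto
    then show ?thesis using saturatedD(2)[OF sat *(1)] k K by blast
  qed
  then show False using KM by blast
qed

end

section \<open>Krull's principal ideal theorem\<close>

context noetherian_cring
begin

text \<open>
  This provides associated primes. If \<open>(I : x)\<close> is maximal among the \<open>(I : y)\<close> with \<open>y \<in> Y\<close>, then it is
  prime: \<open>(I : b x)\<close> contains \<open>(I : x)\<close>, so it is equal to it whenever \<open>b x \<notin> I\<close>.
\<close>

lemma exists_prime_colon:
  assumes I: "ideal I R" and Y: "Y \<subseteq> carrier R" "Y \<inter> I = {}" "Y \<noteq> {}"
    and mult: "\<And>r x. r \<in> carrier R \<Longrightarrow> x \<in> Y \<Longrightarrow> r \<otimes> x \<notin> I \<Longrightarrow> r \<otimes> x \<in> Y"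
  shows "\<exists>x\<in>Y. primeideal (colon I x) R"
proof -
  obtain x0 where "x0 \<in> Y" using Y by blast
  then have "colon I x0 \<in> colon I ` Y" "\<And>J. J \<in> colon I ` Y \<Longrightarrow> ideal J R"
    using Y colon_ideal[OF I] by auto
  from exists_maximal_ideal[OF this] obtain M where M: "M \<in> colon I ` Y"
    "\<And>J. J \<in> colon I ` Y \<Longrightarrow> M \<subseteq> J \<Longrightarrow> J = M" by metis
  then obtain x where x: "x \<in> Y" and "M = colon I x" by blast
  then have max: "\<And>y. y \<in> Y \<Longrightarrow> colon I x \<subseteq> colon I y \<Longrightarrow> colon I y = colon I x"
    using M(2) by blast
  have [simp]: "x \<in> carrier R" using x Y by auto
  have "primeideal (colon I x) R"
  proof (rule cring_primeI)
    show "ideal (colon I x) R" by (rule colon_ideal[OF I]) simp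
    show "\<one> \<notin> colon I x" using x Y by (auto simp: colon_def)
    fix a b assume ab [simp]: "a \<in> carrier R" "b \<in> carrier R" and "a \<otimes> b \<in> colon I x"
    then have abx: "a \<otimes> b \<otimes> x \<in> I" by (simp add: colon_def)
    show "a \<in> colon I x \<or> b \<in> colon I x"
    proof (cases "b \<otimes> x \<in> I")
      case False
      then have "b \<otimes> x \<in> Y" using mult x by simp
      moreover have "colon I x \<subseteq> colon I (b \<otimes> x)"
        using ideal_lmult[OF I ab(2)] by (auto simp: colon_def m_lcomm[of _ b x])
      ultimately have "colon I (b \<otimes> x) = colon I x" by (rule max)
      moreover have "a \<in> colon I (b \<otimes> x)" using abx by (simp add: colon_def m_assoc)
      ultimately show ?thesis by simp
    qed (simp add: colon_def)
  qed
  then show ?thesis using x by blast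
qed

text \<open>
  If \<open>P\<close> is minimal over \<open>I0\<close>, then \<open>I0\<close> defines an Artinian quotient of the localization at \<open>P\<close>.
  Let \<open>M\<close> be maximal among the saturated ideals above which the descending chain condition fails.
  Some \<open>(M : x)\<close> is prime, hence equal to \<open>P\<close> by minimality, so no saturated ideal lies strictly
  between \<open>M\<close> and the saturation \<open>J\<close> of \<open>M + x R\<close>. A descending chain above \<open>M\<close> is determined by its
  intersections with \<open>J\<close>, which take only the values \<open>M\<close> and \<open>J\<close>, and its sums with \<open>J\<close>, which lie above
  \<open>J\<close>; both become constant.
\<close>

lemma saturated_chain_stabilizes:
  assumes P: "primeideal P R" and I0: "ideal I0 R"
    and min: "\<And>Q. primeideal Q R \<Longrightarrow> I0 \<subseteq> Q \<Longrightarrow> Q \<subseteq> P \<Longrightarrow> Q = P"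
    and H: "\<And>n. saturated P (H n)" "\<And>n. H (Suc n) \<subseteq> H n" "\<And>n. I0 \<subseteq> H n"
  shows "\<exists>m. \<forall>n\<ge>m. H n = H m"
proof (rule ccontr)
  assume nostab: "\<not> (\<exists>m. \<forall>n\<ge>m. H n = H m)"
  define good where "good I \<longleftrightarrow> (\<forall>G. (\<forall>n::nat. saturated P (G n) \<and> G (Suc n) \<subseteq> G n \<and> I \<subseteq> G n)
      \<longrightarrow> (\<exists>m. \<forall>n\<ge>m. G n = G m))" for I
  define F where "F = {I. saturated P I \<and> I0 \<subseteq> I \<and> \<not> good I}"
  have "saturation P I0 \<in> F"
  proof -
    have "saturation P I0 \<subseteq> H n" for n by (rule saturation_minimal[OF H(1) H(3)])
    then have "\<not> good (saturation P I0)" using H nostab unfolding good_def by blast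
    then show ?thesis
      using saturation_saturated[OF P I0] saturation_superset[OF P I0] by (simp add: F_def)
  qed
  moreover have "ideal I R" if "I \<in> F" for I using that by (auto simp: F_def saturated_def)
  ultimately obtain M where M: "M \<in> F" and max: "\<And>I. I \<in> F \<Longrightarrow> M \<subseteq> I \<Longrightarrow> I = M"
    using exists_maximal_ideal[of _ F] by metis
  have sat: "saturated P M" and I0M: "I0 \<subseteq> M" and bad: "\<not> good M" using M by (auto simp: F_def)
  note id = saturatedD(1)[OF sat]
  have "M \<noteq> carrier R"
  proof
    assume "M = carrier R"
    then have "good M" unfolding good_def using ideal_subset[OF saturatedD(1)] by (metis subset_antisym)
    then show False using bad by simp
  qed
  then have "\<exists>x\<in>carrier R - M. primeideal (colon M x) R"
    using ideal_subset[OF id] by (intro exists_prime_colon[OF id]) auto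
  then obtain x where x [simp]: "x \<in> carrier R" and xM: "x \<notin> M" and pr: "primeideal (colon M x) R"
    by blast
  have "colon M x \<subseteq> P"
    using saturatedD(2)[OF sat, of _ x] xM by (auto simp: colon_def)
  moreover have "I0 \<subseteq> colon M x"
    using I0M idealD[OF id] ideal_mem[OF id] by (auto simp: colon_def)
  ultimately have colon: "colon M x = P" using min[OF pr] by blast
  define J where "J = saturation P (adjoin M x)"
  have aid: "ideal (adjoin M x) R" by (rule adjoin_ideal[OF id x])
  have satJ: "saturated P J" unfolding J_def by (rule saturation_saturated[OF P aid])
  note idJ = saturatedD(1)[OF satJ]
  have MJ: "M \<subseteq> J" "x \<in> J"
    using saturation_superset[OF P aid] adjoin_superset[OF id x] by (auto simp: J_def)
  have "good J"
  proof (rule ccontr)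
    assume "\<not> good J"
    then have "J \<in> F" using satJ MJ I0M by (auto simp: F_def)
    then show False using max MJ xM by blast
  qed
  have simple: "N = M \<or> N = J" if N: "saturated P N" "M \<subseteq> N" "N \<subseteq> J" for N
  proof (cases "N = M")
    case False
    note idN = saturatedD(1)[OF N(1)]
    obtain y where y: "y \<in> N" "y \<notin> M" using False N(2) by blast
    note [simp] = ideal_mem[OF idN y(1)]
    obtain s k z where s: "s \<in> carrier R - P" "k \<in> M" and z [simp]: "z \<in> carrier R"
      and eq: "s \<otimes> y = k \<oplus> x \<otimes> z"
      using y N(3) by (auto simp: J_def saturation_def elim!: adjoinE)
    have [simp]: "s \<in> carrier R" "k \<in> carrier R" using s ideal_mem[OF id] by auto
    have "s \<otimes> y \<notin> M" using saturatedD(2)[OF sat s(1)] y by auto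
    then have "x \<otimes> z \<notin> M" using eq ideal_add[OF id s(2)] by auto
    then have "z \<notin> P" using colon by (auto simp: colon_def m_comm)
    have "z \<otimes> x = s \<otimes> y \<ominus> k" unfolding eq by (simp add: m_comm)
    also have "\<dots> \<in> N" using y s N(2) idealD[OF idN] by auto
    finally have "x \<in> N" using saturatedD(2)[OF N(1), of z x] \<open>z \<notin> P\<close> by simp
    then have "J \<subseteq> N"
      unfolding J_def by (intro saturation_minimal[OF N(1)] adjoin_minimal[OF idN]) (use N in auto)
    then show ?thesis using N(3) by blast
  qed simp
  have "good M"
    unfolding good_def
  proof (intro allI impI)
    fix G assume "\<forall>n::nat. saturated P (G n) \<and> G (Suc n) \<subseteq> G n \<and> M \<subseteq> G n"
    then have G: "\<And>n. saturated P (G n)" "\<And>n. G (Suc n) \<subseteq> G n" "\<And>n. M \<subseteq> G n" by auto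
    have anti: "G n \<subseteq> G m" if "m \<le> n" for m n
      using lift_Suc_antimono_le[of G, OF G(2) that] .
    note idG = saturatedD(1)[OF G(1)]
    define S where "S n = {a \<in> carrier R. \<exists>s\<in>carrier R - P. \<exists>g\<in>G n. \<exists>j\<in>J. s \<otimes> a = g \<oplus> j}" for n
    have Ssum: "S n = saturation P (G n <+> J)" for n
      by (auto simp: S_def saturation_def set_add_defs)
    have sumid: "ideal (G n <+> J) R" for n by (rule add_ideals[OF idG idJ])
    have "\<exists>m. \<forall>n\<ge>m. S n = S m"
    proof -
      have "saturated P (S n)" for n unfolding Ssum by (rule saturation_saturated[OF P sumid])
      moreover have "S (Suc n) \<subseteq> S n" for n using G(2)[of n] by (auto simp: S_def)
      moreover have "J \<subseteq> S n" for n
      proof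
        fix j assume j: "j \<in> J"
        then have "\<one> \<otimes> j = \<zero> \<oplus> j" "j \<in> carrier R" using ideal_mem[OF idJ] by auto
        then show "j \<in> S n"
          unfolding S_def using j ideal_zero[OF idG] prime_one[OF P] by blast
      qed
      ultimately show ?thesis using \<open>good J\<close> unfolding good_def by blast
    qed
    then obtain m1 where m1: "\<And>n. n \<ge> m1 \<Longrightarrow> S n = S m1" by blast
    have "\<exists>m. \<forall>n\<ge>m. G n \<inter> J = G m \<inter> J"
    proof (cases "\<exists>m. G m \<inter> J = M")
      case True
      then obtain m where "G m \<inter> J = M" by blast
      then have "G n \<inter> J = G m \<inter> J" if "n \<ge> m" for n
        using anti[OF that] G(3)[of n] MJ by blast
      then show ?thesis by blast
    next
      case False
      have "G n \<inter> J = J" for n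
      proof -
        have "saturated P (G n \<inter> J)"
          using G(1)[of n] satJ i_intersect[OF idG idJ] by (auto simp: saturated_def)
        then show ?thesis using simple[of "G n \<inter> J"] G(3) MJ False by blast
      qed
      then show ?thesis by blast
    qed
    then obtain m2 where m2: "\<And>n. n \<ge> m2 \<Longrightarrow> G n \<inter> J = G m2 \<inter> J" by blast
    define m where "m = max m1 m2"
    have "G n = G m" if n: "n \<ge> m" for n
    proof
      show "G n \<subseteq> G m" by (rule anti[OF n])
      show "G m \<subseteq> G n"
      proof
        fix y assume y: "y \<in> G m"
        note [simp] = ideal_mem[OF idG y]
        have "y \<in> S m"
          unfolding S_def using y prime_one[OF P] ideal_zero[OF idJ] by force
        then have "y \<in> S n" using m1[of n] m1[of m] n by (simp add: m_def)
        then obtain s g j where *: "s \<in> carrier R - P" "g \<in> G n" "j \<in> J" "s \<otimes> y = g \<oplus> j"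
          by (auto simp: S_def)
        have [simp]: "s \<in> carrier R" "g \<in> carrier R" "j \<in> carrier R"
          using * ideal_mem[OF idG] ideal_mem[OF idJ] by auto
        have "j = s \<otimes> y \<ominus> g" unfolding *(4) by simp
        also have "\<dots> \<in> G m"
          using y *(2) anti[OF n] idealD[OF idG] by auto
        finally have "j \<in> G n" using m2[of n] m2[of m] n *(3) by (auto simp: m_def)
        then have "s \<otimes> y \<in> G n" using * ideal_add[OF idG] by simp
        then show "y \<in> G n" using saturatedD(2)[OF G(1) *(1)] by simp
      qed
    qed
    then show "\<exists>m. \<forall>n\<ge>m. G n = G m" by blast
  qed
  then show False using bad by simp
qed

text \<open>
  Otherwise \<open>P\<close> is minimal over \<open>p + t R\<close>. For \<open>c\<close> in \<open>q\<close> but not in \<open>p\<close>, let \<open>K n\<close> be the \<open>q\<close>-saturation of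
  \<open>p + c\<^sup>n R\<close>; these ideals take the place of the symbolic powers of \<open>q\<close>. The chain of the \<open>K n + t R\<close>
  stabilizes, and since \<open>t \<notin> q\<close> this gives \<open>K n \<subseteq> K (n + 1) + t K n\<close>, so \<open>K n = K (n + 1)\<close> by Nakayama.
  Now \<open>s c\<^sup>n \<in> c\<^sup>n\<^sup>+\<^sup>1 R + p\<close> for some \<open>s \<notin> q\<close>; cancelling \<open>c\<^sup>n\<close> puts \<open>s\<close> into \<open>q\<close>.
\<close>

lemma krull_principal_ideal:
  assumes p: "primeideal p R" and q: "primeideal q R" and P: "primeideal P R"
    and pq: "p \<subset> q" and qP: "q \<subset> P" and t: "t \<in> P" "t \<notin> q"
  shows "\<exists>Q. primeideal Q R \<and> p \<subset> Q \<and> Q \<subset> P \<and> t \<in> Q"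
proof (rule ccontr)
  assume none: "\<not> ?thesis"
  note idp = prime_ideal[OF p] and idq = prime_ideal[OF q] and idP = prime_ideal[OF P]
  have [simp]: "t \<in> carrier R" using t ideal_mem[OF idP] by simp
  obtain c where c: "c \<in> q" "c \<notin> p" using pq by blast
  have [simp]: "c \<in> carrier R" using c ideal_mem[OF idq] by simp
  have aid: "ideal (adjoin p (c [^] n)) R" for n :: nat
    by (rule adjoin_ideal[OF idp]) simp
  define K where "K n = saturation q (adjoin p (c [^] n))" for n :: nat
  have satK: "saturated q (K n)" for n unfolding K_def by (rule saturation_saturated[OF q aid])
  note idK = saturatedD(1)[OF satK]
  have pK: "p \<subseteq> K n" and cK: "c [^] n \<in> K n" for n
    using saturation_superset[OF q aid[of n]] adjoin_superset[OF idp, of "c [^] n"]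
    unfolding K_def by auto
  have decK: "K (Suc n) \<subseteq> K n" for n
    unfolding K_def[of "Suc n"]
    using pK cK ideal_rmult[OF idK] by (intro saturation_minimal[OF satK] adjoin_minimal[OF idK]) auto
  have tid: "ideal (adjoin (K n) t) R" for n by (rule adjoin_ideal[OF idK]) simp
  define H where "H n = saturation P (adjoin (K n) t)" for n
  have "\<exists>m. \<forall>n\<ge>m. H n = H m"
  proof (rule saturated_chain_stabilizes[OF P adjoin_ideal[OF idp, of t]])
    fix Q assume Q: "primeideal Q R" "adjoin p t \<subseteq> Q" "Q \<subseteq> P"
    then have "p \<subseteq> Q" "t \<in> Q" using adjoin_superset[OF idp, of t] by auto
    then show "Q = P" using none Q t pq by blast
  next
    fix n
    show "saturated P (H n)" unfolding H_def by (rule saturation_saturated[OF P tid])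
    show "H (Suc n) \<subseteq> H n"
      unfolding H_def using decK by (intro saturation_mono) (auto simp: adjoin_def)
    show "adjoin p t \<subseteq> H n"
      using saturation_superset[OF P tid] pK by (fastforce simp: H_def adjoin_def)
  qed simp
  then obtain n where Hn: "H n = H (Suc n)" by (metis le_Suc_eq order_refl)
  have "K n \<subseteq> K (Suc n)"
  proof (rule nakayama[OF P t(1)])
    show "saturated P (K (Suc n))" using saturated_antimono[OF satK] qP by blast
    show "K n \<subseteq> carrier R" by (rule ideal_subset[OF idK])
    fix k assume k: "k \<in> K n"
    then have "k \<in> H (Suc n)"
      using Hn saturation_superset[OF P tid[of n]] adjoin_superset[OF idK[of n], of t]
      unfolding H_def by auto
    then obtain s l y where *: "s \<in> carrier R - P" "l \<in> K (Suc n)" "y \<in> carrier R"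
      "s \<otimes> k = l \<oplus> t \<otimes> y"
      by (auto simp: H_def saturation_def elim!: adjoinE)
    have [simp]: "s \<in> carrier R" "l \<in> carrier R" "k \<in> carrier R" "y \<in> carrier R"
      using * k ideal_mem[OF idK] by auto
    have "t \<otimes> y = s \<otimes> k \<ominus> l" unfolding *(4) by simp
    also have "\<dots> \<in> K n"
      using k *(2) decK[of n] by (intro ideal_diff[OF idK] ideal_lmult[OF idK]) auto
    finally have "y \<in> K n" using saturatedD(2)[OF satK, of t y] t(2) by simp
    then show "\<exists>s\<in>carrier R - P. \<exists>l\<in>K (Suc n). \<exists>k'\<in>K n. s \<otimes> k = l \<oplus> t \<otimes> k'"
      using * by blast
  qed
  then have "c [^] n \<in> K (Suc n)" using cK by blast
  then obtain s k z where *: "s \<in> carrier R - q" "k \<in> p" "z \<in> carrier R"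
    "s \<otimes> c [^] n = k \<oplus> c [^] Suc n \<otimes> z"
    by (auto simp: K_def saturation_def elim!: adjoinE)
  define d where "d = c [^] n"
  have [simp]: "s \<in> carrier R" "k \<in> carrier R" "z \<in> carrier R" "d \<in> carrier R"
    using * ideal_mem[OF idp] by (auto simp: d_def)
  have eq: "s \<otimes> d = k \<oplus> (d \<otimes> c) \<otimes> z" using *(4) by (simp add: d_def)
  have "d \<otimes> (s \<ominus> c \<otimes> z) = s \<otimes> d \<ominus> (d \<otimes> c) \<otimes> z"
    using \<open>d \<in> carrier R\<close> \<open>s \<in> carrier R\<close> \<open>c \<in> carrier R\<close> \<open>z \<in> carrier R\<close>
    by algebra
  also have "\<dots> = k" unfolding eq by simp
  finally have "d \<otimes> (s \<ominus> c \<otimes> z) \<in> p" using *(2) by simp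
  moreover have "d \<notin> p" using prime_pow[OF p, of c n] c by (auto simp: d_def)
  moreover have "s \<ominus> c \<otimes> z \<in> carrier R" by simp
  ultimately have "s \<ominus> c \<otimes> z \<in> q" using \<open>d \<in> carrier R\<close> prime_mult[OF p, of d "s \<ominus> c \<otimes> z"] pq by blast
  then have "s \<in> q" using ideal_diff_cancel[OF idq] ideal_rmult[OF idq _ c(1)] by simp
  then show False using *(1) by simp
qed

lemma prime_chain_extend:
  assumes "prime_chain R n C" and "primeideal Q R" and "C n \<subset> Q"
  shows "prime_chain R (Suc n) (C(Suc n := Q))"
  using assms by (auto simp: prime_chain_def less_Suc_eq le_Suc_eq)

text \<open>
  Starting at the top, \<open>krull_principal_ideal\<close> replaces the second highest prime by one containing \<open>t\<close>.
  Going down, \<open>t\<close> reaches the prime above \<open>C 0\<close>, and only \<open>C 0\<close> is lost.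
\<close>

lemma prime_chain_exchange:
  assumes "prime_chain R (Suc n) C" and "t \<in> C (Suc n)" and "t \<notin> C 0"
  shows "\<exists>D. prime_chain R n D \<and> C 0 \<subseteq> D 0 \<and> t \<in> D 0 \<and> D n = C (Suc n)"
  using assms
proof (induction n arbitrary: C)
  case 0
  then show ?case by (intro exI[of _ "\<lambda>_. C 1"]) (auto simp: prime_chain_def)
next
  case (Suc n)
  have C: "prime_chain R (Suc n) C" "primeideal (C (Suc (Suc n))) R" "C (Suc n) \<subset> C (Suc (Suc n))"
    using Suc.prems(1) by (auto simp: prime_chain_def)
  have "\<exists>C'. prime_chain R (Suc n) C' \<and> C' 0 = C 0 \<and> t \<in> C' (Suc n) \<and> C' (Suc n) \<subset> C (Suc (Suc n))"
  proof (cases "t \<in> C (Suc n)")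
    case True
    then show ?thesis using C by (intro exI[of _ C]) auto
  next
    case False
    have "\<exists>Q. primeideal Q R \<and> C n \<subset> Q \<and> Q \<subset> C (Suc (Suc n)) \<and> t \<in> Q"
      using C False Suc.prems by (intro krull_principal_ideal[of "C n" "C (Suc n)"]) (auto simp: prime_chain_def)
    then obtain Q where "primeideal Q R" "C n \<subset> Q" "Q \<subset> C (Suc (Suc n))" "t \<in> Q" by blast
    then show ?thesis
      using C(1) prime_chain_extend[of n C Q]
      by (intro exI[of _ "C(Suc n := Q)"]) (auto simp: prime_chain_def)
  qed
  then obtain C' where C': "prime_chain R (Suc n) C'" "C' 0 = C 0" "t \<in> C' (Suc n)"
    "C' (Suc n) \<subset> C (Suc (Suc n))" by blast
  then have "t \<notin> C' 0" using Suc.prems(3) by simp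
  then obtain D where D: "prime_chain R n D" "C' 0 \<subseteq> D 0" "t \<in> D 0" "D n = C' (Suc n)"
    using Suc.IH[OF C'(1,3)] by auto
  have "prime_chain R (Suc n) (D(Suc n := C (Suc (Suc n))))"
    using prime_chain_extend[OF D(1) C(2)] C'(4) D(4) by simp
  then show ?case
    using D C'(2) by (intro exI[of _ "D(Suc n := C (Suc (Suc n)))"]) (simp del: fun_upd_apply, simp)
qed

end

section \<open>Regular local rings are normal domains\<close>

context cring
begin

text \<open>
  \<open>R\<close> is a local ring with maximal ideal \<open>P\<close>.
\<close>

definition local_at :: "'a set \<Rightarrow> bool"
  where "local_at P \<longleftrightarrow> primeideal P R \<and> carrier R - P \<subseteq> Units R"

lemma local_saturated:
  assumes "local_at P" and I: "ideal I R"
  shows "saturated P I"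
  unfolding saturated_def
proof (intro conjI ballI impI I)
  fix s a assume *: "s \<in> carrier R - P" "a \<in> carrier R" "s \<otimes> a \<in> I"
  then have s: "s \<in> Units R" using assms(1) by (auto simp: local_at_def)
  then have "inv s \<otimes> (s \<otimes> a) \<in> I" using ideal_lmult[OF I _ *(3)] by simp
  also have "inv s \<otimes> (s \<otimes> a) = a"
    using s *(2) by (simp add: Units_closed m_assoc[symmetric])
  finally show "a \<in> I" .
qed

lemma local_subset:
  assumes "local_at P" and "ideal I R" and "\<one> \<notin> I"
  shows "I \<subseteq> P"
  using saturated_subset_prime[OF local_saturated[OF assms(1,2)]] assms(3) by auto

text \<open>
  For a Noetherian domain \<open>R/K\<close>, this says that \<open>R/K\<close> is integrally closed: a fraction \<open>a/b\<close> is integral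
  if and only if it maps some nonzero ideal \<open>M\<close> into itself, for example \<open>b\<^sup>n (R/K)[a/b]\<close> for large \<open>n\<close>.
\<close>

definition normal_mod :: "'a set \<Rightarrow> bool"
  where "normal_mod K \<longleftrightarrow> (\<forall>a\<in>carrier R. \<forall>b\<in>carrier R - K. \<forall>M. ideal M R \<and> K \<subset> M \<and>
    (\<forall>m\<in>M. \<exists>m'\<in>M. a \<otimes> m \<ominus> b \<otimes> m' \<in> K) \<longrightarrow> a \<in> adjoin K b)"

lemma normal_modD:
  assumes "normal_mod K" and "a \<in> carrier R" and "b \<in> carrier R" and "b \<notin> K"
    and "ideal M R" and "K \<subset> M"
    and "\<And>m. m \<in> M \<Longrightarrow> \<exists>m'\<in>M. a \<otimes> m \<ominus> b \<otimes> m' \<in> K"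
  shows "a \<in> adjoin K b"
  using assms unfolding normal_mod_def by blast

end

context noetherian_cring
begin

lemma nakayama_local:
  assumes P: "local_at P" and t: "t \<in> P" and L: "ideal L R" and K: "K \<subseteq> carrier R"
    and step: "\<And>k. k \<in> K \<Longrightarrow> \<exists>l\<in>L. \<exists>k'\<in>K. k = l \<oplus> t \<otimes> k'"
  shows "K \<subseteq> L"
proof (rule nakayama[OF _ t local_saturated[OF P L] K])
  show pr: "primeideal P R" using P by (simp add: local_at_def)
  fix k assume k: "k \<in> K"
  then have "\<one> \<otimes> k = k" using K by auto
  then show "\<exists>s\<in>carrier R - P. \<exists>l\<in>L. \<exists>k'\<in>K. s \<otimes> k = l \<oplus> t \<otimes> k'"
    using step[OF k] prime_one[OF pr] by (metis DiffI one_closed)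
qed

text \<open>
  Let \<open>T = K + t R\<close>. Take a counterexample \<open>a\<close>, \<open>b\<close>, \<open>M\<close> with \<open>K + b R\<close> as large as possible, and for this
  \<open>a\<close> and \<open>b\<close> with \<open>M\<close> as large as possible. Then \<open>M\<close> is not contained in \<open>T\<close> and \<open>b \<notin> T\<close>, as a factor \<open>t\<close>
  could be removed from \<open>M\<close> or from both \<open>a\<close> and \<open>b\<close>; moreover, \<open>M\<close> is closed under division by \<open>t\<close>.
  Let \<open>I\<close> be the ideal of all \<open>c\<close> with \<open>c M \<subseteq> b M\<close> modulo \<open>K\<close>. Normality modulo \<open>T\<close> yields
  \<open>I \<subseteq> K + b R + t I\<close>, so \<open>a \<in> I \<subseteq> K + b R\<close> by Nakayama.
\<close>

lemma normal_mod_lift: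
  assumes P: "local_at P" and K: "primeideal K R" and t: "t \<in> P" "t \<notin> K"
    and T: "primeideal (adjoin K t) R" and normal: "normal_mod (adjoin K t)"
  shows "normal_mod K"
proof (rule ccontr)
  assume "\<not> normal_mod K"
  note idP = prime_ideal[OF conjunct1[OF P[unfolded local_at_def]]]
  note idK = prime_ideal[OF K] and idT = prime_ideal[OF T]
  have tc [simp]: "t \<in> carrier R" using t ideal_mem[OF idP] by simp
  have KT: "K \<subseteq> adjoin K t" and tT: "t \<in> adjoin K t" using adjoin_superset[OF idK tc] by auto
  have KP: "K \<subseteq> P" by (rule local_subset[OF P idK prime_one[OF K]])
  note carrK = ideal_mem[OF idK] and carrT = ideal_mem[OF idT]
  define bad where "bad a b M \<longleftrightarrow> a \<in> carrier R \<and> b \<in> carrier R \<and> b \<notin> K \<and> ideal M R \<and> K \<subset> M \<and>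
    (\<forall>m\<in>M. \<exists>m'\<in>M. a \<otimes> m \<ominus> b \<otimes> m' \<in> K) \<and> a \<notin> adjoin K b" for a b M
  obtain a0 b0 M0 where bad0: "bad a0 b0 M0"
    using \<open>\<not> normal_mod K\<close> unfolding normal_mod_def bad_def by auto
  define F where "F = {adjoin K b | a b M. bad a b M}"
  have "adjoin K b0 \<in> F" using bad0 unfolding F_def by blast
  moreover have "ideal I R" if "I \<in> F" for I
    using that adjoin_ideal[OF idK] by (auto simp: F_def bad_def)
  ultimately obtain N where "N \<in> F" and N: "\<And>I. I \<in> F \<Longrightarrow> N \<subseteq> I \<Longrightarrow> I = N"
    using exists_maximal_ideal by metis
  then obtain a b M1 where bad1: "bad a b M1" and "N = adjoin K b" by (auto simp: F_def)
  then have maxb: "adjoin K b' = adjoin K b" if "bad a' b' M'" "adjoin K b \<subseteq> adjoin K b'" for a' b' M'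
    using N that by (auto simp: F_def)
  have "M1 \<in> {M. bad a b M}" "\<And>I. I \<in> {M. bad a b M} \<Longrightarrow> ideal I R"
    using bad1 by (auto simp: bad_def)
  then obtain M where "bad a b M" and maxM: "\<And>I. bad a b I \<Longrightarrow> M \<subseteq> I \<Longrightarrow> I = M"
    using exists_maximal_ideal by (metis mem_Collect_eq)
  then have ac [simp]: "a \<in> carrier R" and bc [simp]: "b \<in> carrier R" and bK: "b \<notin> K"
    and idM: "ideal M R" and KM: "K \<subset> M"
    and aM: "\<And>m. m \<in> M \<Longrightarrow> \<exists>m'\<in>M. a \<otimes> m \<ominus> b \<otimes> m' \<in> K"
    and nab: "a \<notin> adjoin K b"
    by (auto simp: bad_def)
  note carrM = ideal_mem[OF idM]
  have cancel_t: "y \<in> K" if "t \<otimes> y \<in> K" "y \<in> carrier R" for y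
    using prime_mult[OF K tc that(2,1)] t(2) by blast
  \<comment> \<open>Dividing by \<open>t\<close> leads into \<open>(M : t)\<close>, which the maximality of \<open>M\<close> will force to be \<open>M\<close>.\<close>
  have divide: "\<exists>k\<in>K. \<exists>y\<in>colon M t. m = k \<oplus> t \<otimes> y" if m: "m \<in> M" "m \<in> adjoin K t" for m
  proof -
    obtain k y where *: "k \<in> K" "y \<in> carrier R" "m = k \<oplus> t \<otimes> y" using m(2) by (rule adjoinE)
    note [simp] = *(2) carrK[OF *(1)]
    have "y \<otimes> t = m \<ominus> k" unfolding *(3) by (simp add: m_comm)
    also have "\<dots> \<in> M" using m(1) *(1) KM by (intro ideal_diff[OF idM]) auto
    finally show ?thesis using * unfolding colon_def by blast
  qed
  have idC: "ideal (colon M t) R" by (rule colon_ideal[OF idM tc])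
  have MC: "M \<subseteq> colon M t"
    using carrM ideal_rmult[OF idM tc] by (auto simp: colon_def)
  have colon: "colon M t = M"
    if hyp: "\<And>x m'. x \<in> adjoin K t \<Longrightarrow> x \<in> M \<Longrightarrow> m' \<in> M \<Longrightarrow> a \<otimes> x \<ominus> b \<otimes> m' \<in> K \<Longrightarrow> m' \<in> adjoin K t"
  proof (rule maxM)
    have "\<exists>y'\<in>colon M t. a \<otimes> y \<ominus> b \<otimes> y' \<in> K" if y: "y \<in> colon M t" for y
    proof -
      have yt: "y \<otimes> t \<in> M" and yc [simp]: "y \<in> carrier R" using y by (auto simp: colon_def)
      obtain m' where m': "m' \<in> M" "a \<otimes> (y \<otimes> t) \<ominus> b \<otimes> m' \<in> K" using aM[OF yt] by blast
      have "m' \<in> adjoin K t" by (rule hyp[OF ideal_lmult[OF idT yc tT] yt m'])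
      then obtain k y' where *: "k \<in> K" "y' \<in> colon M t" "m' = k \<oplus> t \<otimes> y'"
        using divide m' by blast
      have [simp]: "y' \<in> carrier R" "k \<in> carrier R" using * carrK by (auto simp: colon_def)
      have "t \<otimes> (a \<otimes> y \<ominus> b \<otimes> y') = (a \<otimes> (y \<otimes> t) \<ominus> b \<otimes> (k \<oplus> t \<otimes> y')) \<oplus> b \<otimes> k"
        using \<open>t \<in> carrier R\<close> \<open>a \<in> carrier R\<close> \<open>y \<in> carrier R\<close> \<open>b \<in> carrier R\<close>
            \<open>y' \<in> carrier R\<close> \<open>k \<in> carrier R\<close>
        by algebra
      also have "\<dots> \<in> K"
        using m'(2) *(1) unfolding *(3) by (intro ideal_add[OF idK] ideal_lmult[OF idK]) auto
      finally have "a \<otimes> y \<ominus> b \<otimes> y' \<in> K" by (rule cancel_t) simp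
      then show ?thesis using *(2) by blast
    qed
    then show "bad a b (colon M t)"
      using bK KM idC MC nab by (auto simp: bad_def)
  qed (rule MC)
  have MT: "\<not> M \<subseteq> adjoin K t"
  proof
    assume "M \<subseteq> adjoin K t"
    then have "colon M t = M" by (intro colon) auto
    have "M \<subseteq> K"
    proof (rule nakayama_local[OF P t(1) idK ideal_subset[OF idM]])
      fix m assume "m \<in> M"
      then show "\<exists>l\<in>K. \<exists>k'\<in>M. m = l \<oplus> t \<otimes> k'"
        using divide[of m] \<open>colon M t = M\<close> \<open>M \<subseteq> adjoin K t\<close> by auto
    qed
    then show False using KM by blast
  qed
  then obtain m0 where m0: "m0 \<in> M" "m0 \<notin> adjoin K t" by blast
  have bT: "b \<notin> adjoin K t"
  proof
    assume b: "b \<in> adjoin K t"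
    obtain k1 b' where b': "k1 \<in> K" "b' \<in> carrier R" "b = k1 \<oplus> t \<otimes> b'" using b by (rule adjoinE)
    obtain m' where m': "m' \<in> M" "a \<otimes> m0 \<ominus> b \<otimes> m' \<in> K" using aM[OF m0(1)] by blast
    have "a \<otimes> m0 \<ominus> b \<otimes> m' \<in> adjoin K t" using m' KT by blast
    then have "a \<otimes> m0 \<in> adjoin K t"
      using ideal_rmult[OF idT carrM[OF m'(1)] b]
      by (rule ideal_diff_cancel[OF idT]) (simp add: carrM[OF m0(1)])
    then have "a \<in> adjoin K t" using prime_mult[OF T ac carrM[OF m0(1)]] m0(2) by blast
    then obtain k2 a' where a': "k2 \<in> K" "a' \<in> carrier R" "a = k2 \<oplus> t \<otimes> a'" by (rule adjoinE)
    note [simp] = a'(2) b'(2) carrK[OF a'(1)] carrK[OF b'(1)]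
    have b'K: "b' \<notin> K"
      using bK ideal_add[OF idK b'(1) ideal_lmult[OF idK tc]] unfolding b'(3) by blast
    have "bad a' b' M"
      unfolding bad_def
    proof (intro conjI ballI a'(2) b'(2) b'K idM KM notI)
      fix m assume m: "m \<in> M"
      then obtain m' where m': "m' \<in> M" "a \<otimes> m \<ominus> b \<otimes> m' \<in> K" using aM by blast
      note [simp] = carrM[OF m] carrM[OF m'(1)]
      have "t \<otimes> (a' \<otimes> m \<ominus> b' \<otimes> m') =
          ((k2 \<oplus> t \<otimes> a') \<otimes> m \<ominus> (k1 \<oplus> t \<otimes> b') \<otimes> m') \<ominus> (k2 \<otimes> m \<ominus> k1 \<otimes> m')"
        using \<open>t \<in> carrier R\<close> \<open>a' \<in> carrier R\<close> \<open>m \<in> carrier R\<close> \<open>b' \<in> carrier R\<close>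
            \<open>m' \<in> carrier R\<close> \<open>k2 \<in> carrier R\<close> \<open>k1 \<in> carrier R\<close>
        by algebra
      also have "\<dots> \<in> K"
        using ideal_diff[OF idK m'(2) ideal_diff[OF idK ideal_rmult[OF idK _ a'(1), of m]
            ideal_rmult[OF idK _ b'(1), of m']]] by (simp flip: a'(3) b'(3))
      finally have "a' \<otimes> m \<ominus> b' \<otimes> m' \<in> K" by (rule cancel_t) simp
      then show "\<exists>m'\<in>M. a' \<otimes> m \<ominus> b' \<otimes> m' \<in> K" using m'(1) by blast
    next
      assume "a' \<in> adjoin K b'"
      then obtain k3 r where *: "k3 \<in> K" "r \<in> carrier R" "a' = k3 \<oplus> b' \<otimes> r" by (rule adjoinE)
      note [simp] = *(2) carrK[OF *(1)]
      have "a = k2 \<oplus> t \<otimes> (k3 \<oplus> b' \<otimes> r)" using a'(3) *(3) by simp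
      also have "\<dots> = ((k2 \<oplus> t \<otimes> k3) \<ominus> k1 \<otimes> r) \<oplus> (k1 \<oplus> t \<otimes> b') \<otimes> r"
        using \<open>k2 \<in> carrier R\<close> \<open>t \<in> carrier R\<close> \<open>k3 \<in> carrier R\<close> \<open>k1 \<in> carrier R\<close>
            \<open>r \<in> carrier R\<close> \<open>b' \<in> carrier R\<close> \<open>a \<in> carrier R\<close>
        by algebra
      also have "\<dots> = ((k2 \<oplus> t \<otimes> k3) \<ominus> k1 \<otimes> r) \<oplus> b \<otimes> r" using b'(3) by simp
      finally have "a \<in> adjoin K b"
        using * a' b' by (intro adjoinI[of "(k2 \<oplus> t \<otimes> k3) \<ominus> k1 \<otimes> r" K r a b]
            ideal_diff[OF idK] ideal_add[OF idK] ideal_lmult[OF idK] ideal_rmult[OF idK]) auto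
      then show False using nab by simp
    qed
    moreover have "b = k1 \<oplus> b' \<otimes> t" using b'(3) by (simp add: m_comm)
    then have "b \<in> adjoin K b'" using b'(1) by (intro adjoinI) auto
    then have "adjoin K b \<subseteq> adjoin K b'"
      using adjoin_superset[OF idK b'(2)] by (intro adjoin_minimal adjoin_ideal[OF idK]) auto
    ultimately have "adjoin K b' = adjoin K b" by (rule maxb)
    then have "b' \<in> adjoin K b" using adjoin_superset[OF idK b'(2)] by simp
    then obtain k r where *: "k \<in> K" "r \<in> carrier R" "b' = k \<oplus> b \<otimes> r" by (rule adjoinE)
    note [simp] = *(2) carrK[OF *(1)]
    have "(\<one> \<ominus> t \<otimes> r) \<otimes> b' = (b' \<ominus> (k1 \<oplus> t \<otimes> b') \<otimes> r) \<oplus> k1 \<otimes> r"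
      using \<open>t \<in> carrier R\<close> \<open>r \<in> carrier R\<close> \<open>b' \<in> carrier R\<close> \<open>k1 \<in> carrier R\<close>
      by algebra
    also have "b' \<ominus> (k1 \<oplus> t \<otimes> b') \<otimes> r = k"
      using *(3) b'(3) add_diff_cancel_right[of k "b \<otimes> r"] by simp
    also have "k \<oplus> k1 \<otimes> r \<in> K" using * b' ideal_add[OF idK] ideal_rmult[OF idK] by simp
    finally have "(\<one> \<ominus> t \<otimes> r) \<otimes> b' \<in> K" .
    moreover have "\<one> \<ominus> t \<otimes> r \<notin> K"
    proof
      assume "\<one> \<ominus> t \<otimes> r \<in> K"
      then have "\<one> \<ominus> t \<otimes> r \<in> P" using KP by blast
      then have "\<one> \<in> P" using ideal_diff_cancel[OF idP _ ideal_rmult[OF idP *(2) t(1)]] by simp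
      then show False using P prime_one by (auto simp: local_at_def)
    qed
    ultimately have "b' \<in> K" using prime_mult[OF K, of "\<one> \<ominus> t \<otimes> r" b'] by simp
    then show False using b'K by simp
  qed
  have colonM: "colon M t = M"
  proof (rule colon)
    fix x m' assume *: "x \<in> adjoin K t" "x \<in> M" "m' \<in> M" "a \<otimes> x \<ominus> b \<otimes> m' \<in> K"
    note [simp] = carrM[OF *(2)] carrM[OF *(3)]
    have "b \<otimes> m' = a \<otimes> x \<ominus> (a \<otimes> x \<ominus> b \<otimes> m')"
      using \<open>b \<in> carrier R\<close> \<open>m' \<in> carrier R\<close> \<open>a \<in> carrier R\<close> \<open>x \<in> carrier R\<close>
      by algebra
    also have "\<dots> \<in> adjoin K t"
      using ideal_diff[OF idT ideal_lmult[OF idT ac *(1)] subsetD[OF KT *(4)]] .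
    finally show "m' \<in> adjoin K t" using prime_mult[OF T bc] bT by auto
  qed
  define I where "I = {c \<in> carrier R. \<forall>m\<in>M. \<exists>m'\<in>M. c \<otimes> m \<ominus> b \<otimes> m' \<in> K}"
  have "I \<subseteq> adjoin K b"
  proof (rule nakayama_local[OF P t(1) adjoin_ideal[OF idK bc]])
    fix c assume "c \<in> I"
    then have cc [simp]: "c \<in> carrier R" and cM: "\<And>m. m \<in> M \<Longrightarrow> \<exists>m'\<in>M. c \<otimes> m \<ominus> b \<otimes> m' \<in> K"
      by (auto simp: I_def)
    have "c \<in> adjoin (adjoin K t) b"
    proof -
      have "ideal (M <+> adjoin K t) R" by (rule add_ideals[OF idM idT])
      moreover have "adjoin K t \<subset> M <+> adjoin K t"
      proof
        show "adjoin K t \<subseteq> M <+> adjoin K t"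
          using ideal_zero[OF idM] carrT by (force simp: set_add_defs)
        show "adjoin K t \<noteq> M <+> adjoin K t"
          using m0 ideal_zero[OF idT] carrM by (force simp: set_add_defs)
      qed
      moreover have "\<exists>x'\<in>M <+> adjoin K t. c \<otimes> x \<ominus> b \<otimes> x' \<in> adjoin K t"
        if x: "x \<in> M <+>\<^bsub>R\<^esub> adjoin K t" for x
      proof -
        obtain m z where *: "m \<in> M" "z \<in> adjoin K t" "x = m \<oplus> z"
          using x by (auto simp: set_add_defs)
        obtain m' where m': "m' \<in> M" "c \<otimes> m \<ominus> b \<otimes> m' \<in> K" using cM[OF *(1)] by blast
        note [simp] = carrM[OF *(1)] carrT[OF *(2)] carrM[OF m'(1)]
        have "c \<otimes> (m \<oplus> z) \<ominus> b \<otimes> (m' \<oplus> \<zero>) = (c \<otimes> m \<ominus> b \<otimes> m') \<oplus> c \<otimes> z"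
          using \<open>c \<in> carrier R\<close> \<open>m \<in> carrier R\<close> \<open>z \<in> carrier R\<close> \<open>b \<in> carrier R\<close>
              \<open>m' \<in> carrier R\<close>
          by algebra
        also have "\<dots> \<in> adjoin K t"
          using m'(2) *(2) KT by (intro ideal_add[OF idT] ideal_lmult[OF idT]) auto
        finally show ?thesis
          using m'(1) ideal_zero[OF idT] *(3) by (force simp: set_add_defs)
      qed
      ultimately show ?thesis by (rule normal_modD[OF normal cc bc bT])
    qed
    then obtain z r where z: "z \<in> adjoin K t" "r \<in> carrier R" "c = z \<oplus> b \<otimes> r" by (rule adjoinE)
    obtain k y where k: "k \<in> K" "y \<in> carrier R" "z = k \<oplus> t \<otimes> y" using z(1) by (rule adjoinE)
    note [simp] = z(2) k(2) carrK[OF k(1)]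
    have c: "c = (k \<oplus> b \<otimes> r) \<oplus> t \<otimes> y"
      unfolding z(3) k(3)
        using \<open>c \<in> carrier R\<close> \<open>k \<in> carrier R\<close> \<open>b \<in> carrier R\<close> \<open>r \<in> carrier R\<close>
          \<open>t \<in> carrier R\<close> \<open>y \<in> carrier R\<close>
        by algebra
    have "y \<in> I"
      unfolding I_def
    proof (intro CollectI conjI ballI k(2))
      fix m assume m: "m \<in> M"
      obtain m1 where m1: "m1 \<in> M" "c \<otimes> m \<ominus> b \<otimes> m1 \<in> K" using cM[OF m] by blast
      note [simp] = carrM[OF m] carrM[OF m1(1)]
      define m' where "m' = m1 \<ominus> r \<otimes> m"
      have m': "m' \<in> M"
        unfolding m'_def by (intro ideal_diff[OF idM] ideal_lmult[OF idM] m1 m z)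
      note [simp] = carrM[OF m']
      have "t \<otimes> (y \<otimes> m) \<ominus> b \<otimes> (m1 \<ominus> r \<otimes> m) =
          (((k \<oplus> b \<otimes> r) \<oplus> t \<otimes> y) \<otimes> m \<ominus> b \<otimes> m1) \<ominus> k \<otimes> m"
        using \<open>t \<in> carrier R\<close> \<open>y \<in> carrier R\<close> \<open>m \<in> carrier R\<close> \<open>b \<in> carrier R\<close>
            \<open>m1 \<in> carrier R\<close> \<open>r \<in> carrier R\<close> \<open>k \<in> carrier R\<close>
        by algebra
      also have "\<dots> \<in> K"
        using ideal_diff[OF idK m1(2) ideal_rmult[OF idK _ k(1), of m]] unfolding c by simp
      finally have tym: "t \<otimes> (y \<otimes> m) \<ominus> b \<otimes> m' \<in> K" by (simp add: m'_def)
      have "b \<otimes> m' = t \<otimes> (y \<otimes> m) \<ominus> (t \<otimes> (y \<otimes> m) \<ominus> b \<otimes> m')"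
        using \<open>b \<in> carrier R\<close> \<open>m' \<in> carrier R\<close> \<open>t \<in> carrier R\<close> \<open>y \<in> carrier R\<close>
            \<open>m \<in> carrier R\<close>
        by algebra
      also have "\<dots> \<in> adjoin K t"
        using ideal_diff[OF idT ideal_rmult[OF idT _ tT, of "y \<otimes> m"] subsetD[OF KT tym]] by simp
      finally have "m' \<in> adjoin K t" using prime_mult[OF T bc] bT by auto
      then obtain k' y' where *: "k' \<in> K" "y' \<in> M" "m' = k' \<oplus> t \<otimes> y'"
        using divide[OF m'] colonM by blast
      note [simp] = carrK[OF *(1)] carrM[OF *(2)]
      have "t \<otimes> (y \<otimes> m \<ominus> b \<otimes> y') = (t \<otimes> (y \<otimes> m) \<ominus> b \<otimes> (k' \<oplus> t \<otimes> y')) \<oplus> b \<otimes> k'"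
        using \<open>t \<in> carrier R\<close> \<open>y \<in> carrier R\<close> \<open>m \<in> carrier R\<close> \<open>b \<in> carrier R\<close>
            \<open>y' \<in> carrier R\<close> \<open>k' \<in> carrier R\<close>
        by algebra
      also have "\<dots> \<in> K"
        using tym *(1) unfolding *(3) by (intro ideal_add[OF idK] ideal_lmult[OF idK]) auto
      finally have "y \<otimes> m \<ominus> b \<otimes> y' \<in> K" by (rule cancel_t) simp
      then show "\<exists>y'\<in>M. y \<otimes> m \<ominus> b \<otimes> y' \<in> K" using *(2) by blast
    qed
    moreover have "k \<oplus> b \<otimes> r \<in> adjoin K b" using k z by (intro adjoinI) auto
    ultimately show "\<exists>l\<in>adjoin K b. \<exists>k'\<in>I. c = l \<oplus> t \<otimes> k'" using c by blast
  qed (auto simp: I_def)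
  moreover have "a \<in> I" using aM by (simp add: I_def)
  ultimately show False using nab by blast
qed

text \<open>
  The hypotheses say that the maximal ideal of \<open>R/K\<close> is generated by \<open>n\<close> elements and that \<open>R/K\<close> has a chain of
  primes of length \<open>n\<close>. One of the generators, \<open>t\<close>, lies outside \<open>C 0\<close>, and the exchange lemma gives a
  chain \<open>D\<close> of length \<open>n - 1\<close> above \<open>K + t R\<close>. By induction \<open>K + t R = D 0\<close> is prime. It contains \<open>C 0\<close>, so
  \<open>C 0 \<subseteq> K + t C 0\<close>, and \<open>C 0 = K\<close> by Nakayama. That the bottom of the chain is \<open>K\<close> is part of
  the claim because the induction step needs it for \<open>K + t R\<close>.
\<close>

lemma regular_chain:
  assumes P: "local_at P"
    and "ideal K R" and "K \<subseteq> P" and "finite U" and "U \<subseteq> P" and "card U = n"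
    and "\<And>J. ideal J R \<Longrightarrow> K \<subseteq> J \<Longrightarrow> U \<subseteq> J \<Longrightarrow> P \<subseteq> J"
    and "prime_chain R n C" and "K \<subseteq> C 0"
  shows "C 0 = K \<and> normal_mod K"
  using assms(2-)
proof (induction n arbitrary: K U C)
  case 0
  then have "P \<subseteq> K" by auto
  then have KP: "K = P" using 0 by blast
  have "primeideal (C 0) R" using 0 by (simp add: prime_chain_def)
  then have "C 0 \<subseteq> P" using local_subset[OF P] prime_one prime_ideal by blast
  moreover have "normal_mod K"
    unfolding normal_mod_def
  proof (intro ballI allI impI)
    fix a b assume ab: "a \<in> carrier R" "b \<in> carrier R - K"
    then have b: "b \<in> Units R" using P KP by (auto simp: local_at_def)
    then have "a = \<zero> \<oplus> b \<otimes> (inv b \<otimes> a)"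
      using ab by (simp add: m_assoc[symmetric])
    then show "a \<in> adjoin K b"
      using ab b ideal_zero[OF 0(1)] by (intro adjoinI[of \<zero> K "inv b \<otimes> a"]) auto
  qed
  ultimately show ?case using 0 KP by blast
next
  case (Suc n)
  have prC: "primeideal (C i) R" if "i \<le> Suc n" for i
    using Suc.prems that by (simp add: prime_chain_def)
  have CP: "C i \<subseteq> P" if "i \<le> Suc n" for i
    using local_subset[OF P] prime_one prime_ideal prC[OF that] by blast
  have prP: "primeideal P R" using P by (simp add: local_at_def)
  note idC0 = prime_ideal[OF prC[of 0, simplified]]
  have "C 0 \<subset> C 1" using Suc.prems by (auto simp: prime_chain_def)
  then have "\<not> P \<subseteq> C 0" using CP[of 1] by auto
  then have "\<not> U \<subseteq> C 0" using Suc.prems idC0 by blast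
  then obtain t where t: "t \<in> U" "t \<notin> C 0" by blast
  then have tP: "t \<in> P" using Suc.prems by blast
  have tc [simp]: "t \<in> carrier R" using tP ideal_mem prime_ideal[OF prP] by blast
  \<comment> \<open>The chain may end below \<open>P\<close>; its top is replaced by \<open>P\<close>, which contains \<open>t\<close>.\<close>
  have "prime_chain R n C" using Suc.prems(7) by (auto simp: prime_chain_def)
  moreover have "C n \<subset> C (Suc n)" using Suc.prems(7) by (simp add: prime_chain_def)
  then have "C n \<subset> P" using CP[of "Suc n"] by blast
  ultimately have "prime_chain R (Suc n) (C(Suc n := P))" using prime_chain_extend prP by blast
  from prime_chain_exchange[OF this, of t] obtain D where
    D: "prime_chain R n D" "C 0 \<subseteq> D 0" "t \<in> D 0"
    using t tP by (metis fun_upd_apply nat.distinct(1))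
  have idT: "ideal (adjoin K t) R" by (rule adjoin_ideal[OF Suc.prems(1) tc])
  note sup = adjoin_superset[OF Suc.prems(1) tc]
  have "D 0 = adjoin K t \<and> normal_mod (adjoin K t)"
  proof (rule Suc.IH[OF idT, of "U - {t}"])
    show "adjoin K t \<subseteq> P"
      by (rule adjoin_minimal[OF prime_ideal[OF prP] Suc.prems(2) tP])
    show "card (U - {t}) = n" using Suc.prems t by simp
    have "ideal (D 0) R" using D(1) prime_ideal by (auto simp: prime_chain_def)
    then show "adjoin K t \<subseteq> D 0"
      using D Suc.prems by (intro adjoin_minimal) auto
    fix J assume "ideal J R" "adjoin K t \<subseteq> J" "U - {t} \<subseteq> J"
    then show "P \<subseteq> J" using Suc.prems(6)[of J] sup by blast
  qed (use Suc.prems D in auto)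
  then have D0: "D 0 = adjoin K t" and normal: "normal_mod (adjoin K t)" by auto
  have prT: "primeideal (adjoin K t) R" using D(1) D0 by (auto simp: prime_chain_def)
  have "C 0 \<subseteq> K"
  proof (rule nakayama_local[OF P tP Suc.prems(1) ideal_subset[OF idC0]])
    fix p assume p: "p \<in> C 0"
    then have "p \<in> adjoin K t" using D D0 by blast
    then obtain k y where *: "k \<in> K" "y \<in> carrier R" "p = k \<oplus> t \<otimes> y" by (rule adjoinE)
    note [simp] = *(2) ideal_mem[OF Suc.prems(1) *(1)]
    have "t \<otimes> y = p \<ominus> k" unfolding *(3) by simp
    also have "\<dots> \<in> C 0" using p * Suc.prems by (intro ideal_diff[OF idC0]) auto
    finally have "y \<in> C 0" using prime_mult[OF prC[of 0] tc *(2)] t by blast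
    then show "\<exists>l\<in>K. \<exists>k'\<in>C 0. p = l \<oplus> t \<otimes> k'" using * by blast
  qed
  then have "C 0 = K" using Suc.prems by blast
  moreover have "normal_mod K"
    by (rule normal_mod_lift[OF P _ tP _ prT normal])
      (use prC[of 0] t \<open>C 0 = K\<close> in auto)
  ultimately show ?case by blast
qed

lemma unique_maximal_local:
  assumes "{I. maximalideal I R} = {M}"
  shows "local_at M"
proof -
  have M: "maximalideal M R" using assms by blast
  have "a \<in> M" if a: "a \<in> carrier R" "a \<notin> Units R" for a
  proof -
    define F where "F = {I. ideal I R \<and> a \<in> I \<and> \<one> \<notin> I}"
    have "\<one> \<notin> PIdl a"
      using a m_comm by (auto simp: cgenideal_def Units_def)
    then have "PIdl a \<in> F" "\<And>I. I \<in> F \<Longrightarrow> ideal I R"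
      using cgenideal_ideal cgenideal_self a by (auto simp: F_def)
    then obtain N where N: "N \<in> F" and max: "\<And>I. I \<in> F \<Longrightarrow> N \<subseteq> I \<Longrightarrow> I = N"
      using exists_maximal_ideal by metis
    have "maximalideal N R"
    proof (rule maximalidealI)
      show "ideal N R" using N by (simp add: F_def)
      show "carrier R \<noteq> N" using N by (auto simp: F_def)
      fix J assume J: "ideal J R" "N \<subseteq> J" "J \<subseteq> carrier R"
      then show "J = N \<or> J = carrier R"
        using max[of J] N ideal_carrier_iff[OF J(1)] by (auto simp: F_def)
    qed
    then have "N = M" using assms by blast
    then show ?thesis using N by (simp add: F_def)
  qed
  then show ?thesis using maximalideal_prime[OF M] by (auto simp: local_at_def)
qed

text \<open>
  A finite Krull dimension is attained by a chain of primes, so \<open>regular_chain\<close> applies with \<open>K = 0\<close>.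
\<close>

theorem regular_local_normal:
  assumes "regular_local_ring R"
  shows "primeideal {\<zero>} R" and "normal_mod {\<zero>}"
proof -
  obtain M where max: "{I. maximalideal I R} = {M}"
    and dim0: "enat (min_generators R M) = krull_dim R"
    using assms by (auto simp: regular_local_ring_def)
  have M: "local_at M" by (rule unique_maximal_local[OF max])
  then have prM: "primeideal M R" by (simp add: local_at_def)
  note idM = prime_ideal[OF prM]
  define d where "d = min_generators R M"
  have dim: "krull_dim R = enat d" using dim0 by (simp add: d_def)
  have "\<exists>n. \<exists>U\<subseteq>carrier R. finite U \<and> card U = n \<and> genideal R U = M"
    using finetely_gen[OF idM] by metis
  from LeastI_ex[OF this] obtain U where
    U: "U \<subseteq> carrier R" "finite U" "card U = d" "genideal R U = M"
    by (auto simp: d_def min_generators_def)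
  have "\<exists>C. prime_chain R d C"
  proof (rule ccontr)
    assume none: "\<nexists>C. prime_chain R d C"
    have "prime_chain R 0 (\<lambda>_. M)" using prM by (simp add: prime_chain_def)
    then have "d \<noteq> 0" using none by metis
    have "enat n \<le> enat (d - 1)" if "n \<in> {n. \<exists>C. prime_chain R n C}" for n
    proof -
      have "enat n \<le> krull_dim R"
        unfolding krull_dim_def by (rule SUP_upper[OF that])
      then have "n \<le> d" using dim by simp
      moreover have "n \<noteq> d" using that none by auto
      ultimately show ?thesis by simp
    qed
    then have "krull_dim R \<le> enat (d - 1)"
      unfolding krull_dim_def by (rule SUP_least)
    then show False using dim \<open>d \<noteq> 0\<close> by simp
  qed
  then obtain C where C: "prime_chain R d C" by blast
  then have "primeideal (C 0) R" by (simp add: prime_chain_def)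
  have "C 0 = {\<zero>} \<and> normal_mod {\<zero>}"
  proof (rule regular_chain[OF M zeroideal _ U(2) _ U(3) _ C])
    show "{\<zero>} \<subseteq> M" "{\<zero>} \<subseteq> C 0"
      using ideal_zero idM prime_ideal[OF \<open>primeideal (C 0) R\<close>] by auto
    show "U \<subseteq> M" using genideal_self[OF U(1)] U(4) by simp
    show "M \<subseteq> J" if "ideal J R" "U \<subseteq> J" for J
      using genideal_minimal[OF that] U(4) by simp
  qed
  then show "primeideal {\<zero>} R" "normal_mod {\<zero>}"
    using \<open>primeideal (C 0) R\<close> by auto
qed

end

section \<open>Integral fractions\<close>

context cring
begin

text \<open>
  The ideal \<open>H\<^sub>n\<close> generated by the monomials of degree \<open>n\<close> in \<open>a\<close> and \<open>b\<close>.
\<close>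

primrec forms :: "'a \<Rightarrow> 'a \<Rightarrow> nat \<Rightarrow> 'a set"
  where "forms a b 0 = carrier R"
  | "forms a b (Suc n) = {a \<otimes> h \<oplus> b \<otimes> h' | h h'. h \<in> forms a b n \<and> h' \<in> forms a b n}"

declare forms.simps(2) [simp del]

lemma forms_SucI:
  "h \<in> forms a b n \<Longrightarrow> h' \<in> forms a b n \<Longrightarrow> x = a \<otimes> h \<oplus> b \<otimes> h' \<Longrightarrow> x \<in> forms a b (Suc n)"
  by (auto simp: forms.simps(2))

lemma forms_SucE:
  assumes "x \<in> forms a b (Suc n)"
  obtains h h' where "h \<in> forms a b n" and "h' \<in> forms a b n" and "x = a \<otimes> h \<oplus> b \<otimes> h'"
  using assms by (auto simp: forms.simps(2))

lemma forms_ideal: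
  assumes [simp]: "a \<in> carrier R" "b \<in> carrier R"
  shows "ideal (forms a b n) R"
proof (induction n)
  case 0
  show ?case by (simp add: oneideal)
next
  case (Suc n)
  note carr = ideal_mem[OF Suc]
  show ?case
  proof (rule cring_idealI)
    show "forms a b (Suc n) \<subseteq> carrier R" using carr by (auto elim!: forms_SucE)
    show "\<zero> \<in> forms a b (Suc n)" using ideal_zero[OF Suc] by (auto intro: forms_SucI)
  next
    fix x y assume "x \<in> forms a b (Suc n)" "y \<in> forms a b (Suc n)"
    then obtain h h' k k' where *: "h \<in> forms a b n" "h' \<in> forms a b n" "x = a \<otimes> h \<oplus> b \<otimes> h'"
      "k \<in> forms a b n" "k' \<in> forms a b n" "y = a \<otimes> k \<oplus> b \<otimes> k'"
      by (auto elim!: forms_SucE)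
    note [simp] = carr[OF *(1)] carr[OF *(2)] carr[OF *(4)] carr[OF *(5)]
    have "x \<oplus> y = a \<otimes> (h \<oplus> k) \<oplus> b \<otimes> (h' \<oplus> k')"
      unfolding *
        using \<open>a \<in> carrier R\<close> \<open>h \<in> carrier R\<close> \<open>k \<in> carrier R\<close> \<open>b \<in> carrier R\<close>
          \<open>h' \<in> carrier R\<close> \<open>k' \<in> carrier R\<close>
        by algebra
    then show "x \<oplus> y \<in> forms a b (Suc n)" using * ideal_add[OF Suc] by (intro forms_SucI) auto
  next
    fix r x assume r [simp]: "r \<in> carrier R" and "x \<in> forms a b (Suc n)"
    then obtain h h' where *: "h \<in> forms a b n" "h' \<in> forms a b n" "x = a \<otimes> h \<oplus> b \<otimes> h'"
      by (auto elim!: forms_SucE)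
    note [simp] = carr[OF *(1)] carr[OF *(2)]
    have "r \<otimes> x = a \<otimes> (r \<otimes> h) \<oplus> b \<otimes> (r \<otimes> h')"
      unfolding *
        using \<open>r \<in> carrier R\<close> \<open>a \<in> carrier R\<close> \<open>h \<in> carrier R\<close> \<open>b \<in> carrier R\<close>
          \<open>h' \<in> carrier R\<close>
        by algebra
    then show "r \<otimes> x \<in> forms a b (Suc n)" using * ideal_lmult[OF Suc r] by (intro forms_SucI) auto
  qed
qed

lemma forms_mem:
  "a \<in> carrier R \<Longrightarrow> b \<in> carrier R \<Longrightarrow> h \<in> forms a b n \<Longrightarrow> h \<in> carrier R"
  using ideal_mem[OF forms_ideal] .

lemma forms_mult:
  assumes [simp]: "a \<in> carrier R" "b \<in> carrier R" and h: "h \<in> forms a b n"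
  shows "a \<otimes> h \<in> forms a b (Suc n)" and "b \<otimes> h \<in> forms a b (Suc n)"
proof -
  have [simp]: "h \<in> carrier R" using forms_mem[OF _ _ h] by simp
  have "a \<otimes> h = a \<otimes> h \<oplus> b \<otimes> \<zero>" "b \<otimes> h = a \<otimes> \<zero> \<oplus> b \<otimes> h" by simp_all
  then show "a \<otimes> h \<in> forms a b (Suc n)" "b \<otimes> h \<in> forms a b (Suc n)"
    using h ideal_zero[OF forms_ideal[of a b n]] by (auto intro: forms_SucI)
qed

lemma forms_pow:
  assumes "a \<in> carrier R" "b \<in> carrier R"
  shows "a [^] n \<in> forms a b n" and "b [^] n \<in> forms a b n"
proof (induction n)
  case (Suc n)
  { case 1 show ?case using forms_mult(1)[OF assms Suc(1)] assms by (simp add: m_comm) }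
  { case 2 show ?case using forms_mult(2)[OF assms Suc(2)] assms by (simp add: m_comm) }
qed auto

text \<open>
  In \<open>a h\<close>, every monomial except \<open>a\<^sup>n\<^sup>+\<^sup>1\<close> is divisible by \<open>b\<close>. So a relation \<open>a\<^sup>n\<^sup>+\<^sup>1 \<in> b H\<^sub>n\<close> makes
  \<open>H\<^sub>n\<close> stable under multiplication by \<open>a/b\<close>.
\<close>

lemma forms_lead:
  assumes [simp]: "a \<in> carrier R" "b \<in> carrier R" and "h \<in> forms a b n"
  shows "\<exists>r\<in>carrier R. \<exists>h'\<in>forms a b n. a \<otimes> h = a [^] Suc n \<otimes> r \<oplus> b \<otimes> h'"
  using assms(3)
proof (induction n arbitrary: h)
  case 0
  then show ?case by (intro bexI[of _ h] bexI[of _ \<zero>]) auto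
next
  case (Suc n)
  then obtain h1 h2 where h: "h1 \<in> forms a b n" "h2 \<in> forms a b n" "h = a \<otimes> h1 \<oplus> b \<otimes> h2"
    by (auto elim!: forms_SucE)
  from Suc.IH[OF h(1)] obtain r h' where
    r: "r \<in> carrier R" "h' \<in> forms a b n" "a \<otimes> h1 = a [^] Suc n \<otimes> r \<oplus> b \<otimes> h'" by blast
  define d where "d = a [^] Suc n"
  note [simp] = r(1) forms_mem[OF assms(1,2) h(1)] forms_mem[OF assms(1,2) h(2)]
    forms_mem[OF assms(1,2) r(2)]
  have d [simp]: "d \<in> carrier R" by (simp add: d_def)
  have "a \<otimes> h = a \<otimes> ((d \<otimes> r \<oplus> b \<otimes> h') \<oplus> b \<otimes> h2)"
    using r(3) h(3) by (simp add: d_def)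
  also have "\<dots> = (d \<otimes> a) \<otimes> r \<oplus> b \<otimes> (a \<otimes> h' \<oplus> a \<otimes> h2)"
    using \<open>d \<in> carrier R\<close> \<open>a \<in> carrier R\<close> \<open>r \<in> carrier R\<close> \<open>b \<in> carrier R\<close> \<open>h' \<in> carrier R\<close>
        \<open>h2 \<in> carrier R\<close>
    by algebra
  also have "d \<otimes> a = a [^] Suc (Suc n)" by (simp add: d_def)
  finally show ?case
    using r(1) ideal_add[OF forms_ideal[of a b "Suc n"] forms_mult(1)[OF assms(1,2) r(2)]
        forms_mult(1)[OF assms(1,2) h(2)]] assms(1,2) by blast
qed

text \<open>
  An equation of integral dependence of degree \<open>n + 1\<close> for \<open>a/b\<close>, multiplied by \<open>b\<^sup>n\<^sup>+\<^sup>1\<close>.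
\<close>

definition integral_fraction :: "'a \<Rightarrow> 'a \<Rightarrow> bool"
  where "integral_fraction a b \<longleftrightarrow> (\<exists>n. \<exists>h\<in>forms a b n. a [^] Suc n = b \<otimes> h)"

text \<open>
  The ideal \<open>M = H\<^sub>n\<close> satisfies \<open>a M \<subseteq> b M\<close>, and it is nonzero because it contains \<open>b\<^sup>n\<close>.
\<close>

lemma normal_mod_zero_integral:
  assumes pr: "primeideal {\<zero>} R" and normal: "normal_mod {\<zero>}"
    and [simp]: "a \<in> carrier R" "b \<in> carrier R" and b: "b \<noteq> \<zero>" and int: "integral_fraction a b"
  shows "\<exists>r\<in>carrier R. a = b \<otimes> r"
proof -
  obtain n g where g: "g \<in> forms a b n" "a [^] Suc n = b \<otimes> g"
    using int by (auto simp: integral_fraction_def)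
  have id: "ideal (forms a b n) R" by (rule forms_ideal) auto
  have "b [^] n \<noteq> \<zero>" using prime_pow[OF pr, of b n] b by auto
  then have "{\<zero>} \<subset> forms a b n"
    using forms_pow(2)[of a b n] ideal_zero[OF id] by auto
  moreover have "\<exists>m'\<in>forms a b n. a \<otimes> m \<ominus> b \<otimes> m' \<in> {\<zero>}" if m: "m \<in> forms a b n" for m
  proof -
    obtain r h where *: "r \<in> carrier R" "h \<in> forms a b n" "a \<otimes> m = (b \<otimes> g) \<otimes> r \<oplus> b \<otimes> h"
      using forms_lead[OF _ _ m] g(2) by auto
    note [simp] = *(1) ideal_mem[OF id *(2)] ideal_mem[OF id g(1)] ideal_mem[OF id m]
    have "a \<otimes> m = b \<otimes> (g \<otimes> r \<oplus> h)"
      unfolding *(3)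
        using \<open>a \<in> carrier R\<close> \<open>m \<in> carrier R\<close> \<open>b \<in> carrier R\<close> \<open>g \<in> carrier R\<close>
          \<open>r \<in> carrier R\<close> \<open>h \<in> carrier R\<close>
        by algebra
    moreover have "g \<otimes> r \<oplus> h \<in> forms a b n"
      using g * by (intro ideal_add[OF id] ideal_rmult[OF id]) auto
    ultimately show ?thesis by (intro bexI[of _ "g \<otimes> r \<oplus> h"]) auto
  qed
  ultimately have "a \<in> adjoin {\<zero>} b"
    using normal_modD[OF normal, of a b] id b by simp
  then show ?thesis by (auto elim!: adjoinE)
qed

lemma forms_scale_left:
  assumes [simp]: "a \<in> carrier R" "b \<in> carrier R" "z \<in> carrier R" and "h \<in> forms a b n"
  shows "z [^] n \<otimes> h \<in> forms (z \<otimes> a) b n"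
  using assms(4)
proof (induction n arbitrary: h)
  case (Suc n)
  then obtain h1 h2 where h: "h1 \<in> forms a b n" "h2 \<in> forms a b n" "h = a \<otimes> h1 \<oplus> b \<otimes> h2"
    by (auto elim!: forms_SucE)
  define d where "d = z [^] n"
  note [simp] = forms_mem[OF assms(1,2) h(1)] forms_mem[OF assms(1,2) h(2)]
  have [simp]: "d \<in> carrier R" by (simp add: d_def)
  have "z [^] Suc n \<otimes> h = (z \<otimes> a) \<otimes> (d \<otimes> h1) \<oplus> b \<otimes> (z \<otimes> (d \<otimes> h2))"
    unfolding h(3) nat_pow_Suc d_def[symmetric]
      using \<open>z \<in> carrier R\<close> \<open>a \<in> carrier R\<close> \<open>d \<in> carrier R\<close> \<open>h1 \<in> carrier R\<close> \<open>b \<in> carrier R\<close>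
        \<open>h2 \<in> carrier R\<close>
      by algebra
  moreover have "z \<otimes> (d \<otimes> h2) \<in> forms (z \<otimes> a) b n"
    using ideal_lmult[OF forms_ideal _ Suc.IH[OF h(2)]] unfolding d_def by simp
  ultimately show ?case using Suc.IH[OF h(1)] unfolding d_def by (intro forms_SucI)
qed simp

lemma forms_scale_both:
  assumes [simp]: "a \<in> carrier R" "b \<in> carrier R" "z \<in> carrier R" and "h \<in> forms a b n"
  shows "z [^] n \<otimes> h \<in> forms (z \<otimes> a) (z \<otimes> b) n"
  using assms(4)
proof (induction n arbitrary: h)
  case (Suc n)
  then obtain h1 h2 where h: "h1 \<in> forms a b n" "h2 \<in> forms a b n" "h = a \<otimes> h1 \<oplus> b \<otimes> h2"
    by (auto elim!: forms_SucE)
  define d where "d = z [^] n"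
  note [simp] = forms_mem[OF assms(1,2) h(1)] forms_mem[OF assms(1,2) h(2)]
  have [simp]: "d \<in> carrier R" by (simp add: d_def)
  have "z [^] Suc n \<otimes> h = (z \<otimes> a) \<otimes> (d \<otimes> h1) \<oplus> (z \<otimes> b) \<otimes> (d \<otimes> h2)"
    unfolding h(3) nat_pow_Suc d_def[symmetric]
      using \<open>z \<in> carrier R\<close> \<open>a \<in> carrier R\<close> \<open>d \<in> carrier R\<close> \<open>h1 \<in> carrier R\<close> \<open>b \<in> carrier R\<close>
        \<open>h2 \<in> carrier R\<close>
      by algebra
  then show ?case
    using Suc.IH[OF h(1)] Suc.IH[OF h(2)] unfolding d_def by (intro forms_SucI)
qed simp

lemma integral_fraction_scale_left:
  assumes [simp]: "a \<in> carrier R" "b \<in> carrier R" "z \<in> carrier R" and "integral_fraction a b"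
  shows "integral_fraction (z \<otimes> a) b"
proof -
  obtain n h where h: "h \<in> forms a b n" "a [^] Suc n = b \<otimes> h"
    using assms by (auto simp: integral_fraction_def)
  have [simp]: "h \<in> carrier R" using forms_mem[OF _ _ h(1)] by simp
  have "(z \<otimes> a) [^] Suc n = z [^] Suc n \<otimes> (b \<otimes> h)"
    by (subst nat_pow_distrib) (simp_all only: h(2)[symmetric] assms)
  also have "\<dots> = b \<otimes> (z \<otimes> (z [^] n \<otimes> h))" by (simp add: m_ac)
  finally show ?thesis
    unfolding integral_fraction_def
    using forms_scale_left[OF assms(1-3) h(1)] ideal_lmult[OF forms_ideal[of "z \<otimes> a" b n], of z]
    by auto
qed

lemma integral_fraction_scale_both:
  assumes [simp]: "a \<in> carrier R" "b \<in> carrier R" "z \<in> carrier R" and "integral_fraction a b"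
  shows "integral_fraction (z \<otimes> a) (z \<otimes> b)"
proof -
  obtain n h where h: "h \<in> forms a b n" "a [^] Suc n = b \<otimes> h"
    using assms by (auto simp: integral_fraction_def)
  have [simp]: "h \<in> carrier R" using forms_mem[OF _ _ h(1)] by simp
  have "(z \<otimes> a) [^] Suc n = z [^] Suc n \<otimes> (b \<otimes> h)"
    by (subst nat_pow_distrib) (simp_all only: h(2)[symmetric] assms)
  also have "\<dots> = (z \<otimes> b) \<otimes> (z [^] n \<otimes> h)" by (simp add: m_ac)
  finally show ?thesis
    unfolding integral_fraction_def using forms_scale_both[OF assms(1-3) h(1)] by auto
qed

end

context ring_hom_cring
begin

lemma forms_hom:
  assumes "a \<in> carrier R" "b \<in> carrier R" and "g \<in> R.forms a b n"
  shows "h g \<in> S.forms (h a) (h b) n"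
  using assms(3)
proof (induction n arbitrary: g)
  case (Suc n)
  then obtain h1 h2 where g: "h1 \<in> R.forms a b n" "h2 \<in> R.forms a b n" "g = a \<otimes> h1 \<oplus> b \<otimes> h2"
    by (auto elim!: R.forms_SucE)
  have [simp]: "h1 \<in> carrier R" "h2 \<in> carrier R"
    using R.forms_mem[OF assms(1,2)] g by auto
  have "h g = h a \<otimes>\<^bsub>S\<^esub> h h1 \<oplus>\<^bsub>S\<^esub> h b \<otimes>\<^bsub>S\<^esub> h h2"
    using assms(1,2) g(3) by simp
  then show ?case using Suc.IH[OF g(1)] Suc.IH[OF g(2)] by (intro S.forms_SucI)
qed simp

text \<open>
  Multiplying a polynomial in \<open>x = a/b\<close> by the power of \<open>b\<close> given by its degree makes it homogeneous
  in \<open>a\<close> and \<open>b\<close>.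
\<close>

lemma eval_fraction:
  assumes [simp]: "a \<in> carrier R" "b \<in> carrier R" "x \<in> carrier S" and x: "h b \<otimes>\<^bsub>S\<^esub> x = h a"
    and "p \<noteq> []" and "set p \<subseteq> h ` carrier R"
  shows "\<exists>g\<in>R.forms a b (length p - 1). h b [^]\<^bsub>S\<^esub> (length p - 1) \<otimes>\<^bsub>S\<^esub> S.eval p x = h g"
  using assms(5,6)
proof (induction p)
  case (Cons c q)
  then obtain c' where c': "c' \<in> carrier R" "c = h c'" by auto
  show ?case
  proof (cases "q = []")
    case True
    then show ?thesis using c' by (intro bexI[of _ c']) auto
  next
    case False
    then obtain n where n: "length q = Suc n" by (cases q) auto
    obtain g where g: "g \<in> R.forms a b n" "h b [^]\<^bsub>S\<^esub> n \<otimes>\<^bsub>S\<^esub> S.eval q x = h g"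
      using Cons False n by auto
    define e where "e = S.eval q x"
    have "set q \<subseteq> carrier S" using Cons.prems by auto
    then have e [simp]: "e \<in> carrier S" unfolding e_def by (rule S.eval_in_carrier) simp
    have [simp]: "g \<in> carrier R" by (rule R.forms_mem[OF _ _ g(1)]) simp_all
    have pow: "h b [^]\<^bsub>S\<^esub> Suc n \<otimes>\<^bsub>S\<^esub> x [^]\<^bsub>S\<^esub> Suc n = h a [^]\<^bsub>S\<^esub> Suc n"
      using S.nat_pow_distrib[of "h b" x "Suc n"] x by simp
    define A B Y where "A = h a [^]\<^bsub>S\<^esub> Suc n" and "B = h b [^]\<^bsub>S\<^esub> n" and "Y = x [^]\<^bsub>S\<^esub> Suc n"
    have [simp]: "A \<in> carrier S" "B \<in> carrier S" "Y \<in> carrier S" "c \<in> carrier S"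
      using c' by (auto simp: A_def B_def Y_def)
    define b' where "b' = h b"
    have [simp]: "b' \<in> carrier S" by (simp add: b'_def)
    have pow': "B \<otimes>\<^bsub>S\<^esub> b' \<otimes>\<^bsub>S\<^esub> Y = A" using pow by (simp add: A_def B_def Y_def b'_def)
    have "h b [^]\<^bsub>S\<^esub> Suc n \<otimes>\<^bsub>S\<^esub> S.eval (c # q) x = (B \<otimes>\<^bsub>S\<^esub> b') \<otimes>\<^bsub>S\<^esub> (c \<otimes>\<^bsub>S\<^esub> Y \<oplus>\<^bsub>S\<^esub> e)"
      by (simp add: n Y_def B_def e_def b'_def)
    also have "\<dots> = (B \<otimes>\<^bsub>S\<^esub> b' \<otimes>\<^bsub>S\<^esub> Y) \<otimes>\<^bsub>S\<^esub> c \<oplus>\<^bsub>S\<^esub> b' \<otimes>\<^bsub>S\<^esub> (B \<otimes>\<^bsub>S\<^esub> e)"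
      using \<open>B \<in> carrier S\<close> \<open>b' \<in> carrier S\<close> \<open>Y \<in> carrier S\<close> \<open>c \<in> carrier S\<close> \<open>e \<in> carrier S\<close>
      by algebra
    also have "\<dots> = h (a [^] Suc n \<otimes> c' \<oplus> b \<otimes> g)"
      unfolding pow' using g(2) c' by (simp add: A_def B_def e_def b'_def)
    finally have eq: "h b [^]\<^bsub>S\<^esub> Suc n \<otimes>\<^bsub>S\<^esub> S.eval (c # q) x = h (a [^] Suc n \<otimes> c' \<oplus> b \<otimes> g)" .
    have "a [^] Suc n \<otimes> c' \<oplus> b \<otimes> g \<in> R.forms a b (Suc n)"
      using R.ideal_add[OF R.forms_ideal R.ideal_rmult[OF R.forms_ideal c'(1) R.forms_pow(1)]
          R.forms_mult(2)[OF _ _ g(1)]] by simp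
    then show ?thesis using eq n by auto
  qed
qed simp

lemma integral_over_imp_fraction:
  assumes [simp]: "a \<in> carrier R" "b \<in> carrier R" "x \<in> carrier S" and x: "h b \<otimes>\<^bsub>S\<^esub> x = h a"
    and inj: "inj_on h (carrier R)" and int: "integral_over S (h ` carrier R) x"
  shows "R.integral_fraction a b"
proof -
  obtain p where p: "set p \<subseteq> h ` carrier R" "p \<noteq> []" "hd p = \<one>\<^bsub>S\<^esub>" "S.eval p x = \<zero>\<^bsub>S\<^esub>"
    using int by (auto simp: integral_over_def)
  then obtain q where q: "p = \<one>\<^bsub>S\<^esub> # q" by (cases p) auto
  have "set q \<subseteq> carrier S" using p q by auto
  then have e [simp]: "S.eval q x \<in> carrier S" by (rule S.eval_in_carrier) simp
  show ?thesis
  proof (cases "q = []")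
    case True
    \<comment> \<open>The monic polynomial \<open>1\<close> has a root only in the zero ring.\<close>
    then have "\<one>\<^bsub>S\<^esub> = \<zero>\<^bsub>S\<^esub>" using p q by simp
    then have "carrier S = {\<zero>\<^bsub>S\<^esub>}" using S.one_zeroD by simp
    then have "h a = h \<zero>" using hom_closed[OF assms(1)] by simp
    then have "a = \<zero>" using inj by (simp add: inj_on_def)
    then show ?thesis
      unfolding R.integral_fraction_def by (intro exI[of _ 0] bexI[of _ \<zero>]) auto
  next
    case False
    then obtain n where n: "length q = Suc n" by (cases q) auto
    obtain g where g: "g \<in> R.forms a b n" "h b [^]\<^bsub>S\<^esub> n \<otimes>\<^bsub>S\<^esub> S.eval q x = h g"
      using eval_fraction[OF assms(1-3) x False] p q n by auto
    have [simp]: "g \<in> carrier R" by (rule R.forms_mem[OF _ _ g(1)]) simp_all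
    have "x [^]\<^bsub>S\<^esub> Suc n \<oplus>\<^bsub>S\<^esub> S.eval q x = \<zero>\<^bsub>S\<^esub>"
      using p(4) by (simp add: q n)
    then have "\<zero>\<^bsub>S\<^esub> = h b [^]\<^bsub>S\<^esub> Suc n \<otimes>\<^bsub>S\<^esub> (x [^]\<^bsub>S\<^esub> Suc n \<oplus>\<^bsub>S\<^esub> S.eval q x)" by simp
    also have "\<dots> = (h b [^]\<^bsub>S\<^esub> Suc n \<otimes>\<^bsub>S\<^esub> x [^]\<^bsub>S\<^esub> Suc n) \<oplus>\<^bsub>S\<^esub> h b \<otimes>\<^bsub>S\<^esub> (h b [^]\<^bsub>S\<^esub> n \<otimes>\<^bsub>S\<^esub> S.eval q x)"
      by (simp add: S.r_distr S.m_ac)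
    also have "h b [^]\<^bsub>S\<^esub> Suc n \<otimes>\<^bsub>S\<^esub> x [^]\<^bsub>S\<^esub> Suc n = h a [^]\<^bsub>S\<^esub> Suc n"
      using S.nat_pow_distrib[of "h b" x "Suc n"] x by simp
    finally have "h (a [^] Suc n \<oplus> b \<otimes> g) = h \<zero>" using g(2) by simp
    then have eq: "a [^] Suc n \<oplus> b \<otimes> g = \<zero>" using inj by (simp add: inj_on_def)
    have "a [^] Suc n = b \<otimes> (\<ominus> g)"
      using R.minus_equality[OF eq] by (simp add: R.r_minus R.minus_equality)
    then show ?thesis
      using R.ideal_uminus[OF R.forms_ideal g(1)] unfolding R.integral_fraction_def by auto
  qed
qed

end

section \<open>Localization and total rings of fractions\<close>

text \<open>
  The properties that characterize the map from \<open>R\<close> to its localization at \<open>S\<close>. Arguments about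
  localizations rest on these and not on equivalence classes of pairs, and thus apply alike to total
  rings of fractions and to localizations at primes.
\<close>

locale localization_map = ring_hom_cring R L h for R (structure) and L (structure) and h +
  fixes S
  assumes dens: "S \<subseteq> carrier R" "\<one> \<in> S" "\<And>s t. s \<in> S \<Longrightarrow> t \<in> S \<Longrightarrow> s \<otimes> t \<in> S"
    and den_unit: "\<And>s. s \<in> S \<Longrightarrow> h s \<in> Units L"
    and numerator: "\<And>x. x \<in> carrier L \<Longrightarrow> \<exists>a\<in>carrier R. \<exists>s\<in>S. h s \<otimes>\<^bsub>L\<^esub> x = h a"
    and kernel: "\<And>a. a \<in> carrier R \<Longrightarrow> h a = \<zero>\<^bsub>L\<^esub> \<Longrightarrow> \<exists>s\<in>S. s \<otimes> a = \<zero>"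
begin

lemma den_carrier: "s \<in> S \<Longrightarrow> s \<in> carrier R"
  using dens by blast

lemma hom_eqD:
  assumes [simp]: "a \<in> carrier R" "b \<in> carrier R" and eq: "h a = h b"
  shows "\<exists>s\<in>S. s \<otimes> a = s \<otimes> b"
proof -
  have "a \<ominus> b \<in> carrier R" "h (a \<ominus> b) = \<zero>\<^bsub>L\<^esub>" using eq by (simp_all add: S.r_neg R.minus_eq)
  then obtain s where s: "s \<in> S" "s \<otimes> (a \<ominus> b) = \<zero>" using kernel[of "a \<ominus> b"] by blast
  have [simp]: "s \<in> carrier R" using den_carrier s by simp
  have "s \<otimes> a \<ominus> s \<otimes> b = s \<otimes> (a \<ominus> b)"
    using \<open>s \<in> carrier R\<close> \<open>a \<in> carrier R\<close> \<open>b \<in> carrier R\<close>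
    by algebra
  then have "s \<otimes> a \<ominus> s \<otimes> b = \<zero>" using s(2) by (rule trans)
  then have "s \<otimes> a = s \<otimes> b" by (rule R.ring_eqI) simp_all
  then show ?thesis using s by blast
qed

lemma den_cancel:
  assumes s: "s \<in> S" and xy: "x \<in> carrier L" "y \<in> carrier L" and eq: "h s \<otimes>\<^bsub>L\<^esub> x = h s \<otimes>\<^bsub>L\<^esub> y"
  shows "x = y"
  using S.Units_l_cancel[OF den_unit[OF s] xy] eq by simp

lemma den_cancel_ideal:
  assumes I: "ideal I L" and s: "s \<in> S" and x: "x \<in> carrier L" "h s \<otimes>\<^bsub>L\<^esub> x \<in> I"
  shows "x \<in> I"
proof -
  have u: "h s \<in> Units L" by (rule den_unit[OF s])
  have "inv\<^bsub>L\<^esub> h s \<otimes>\<^bsub>L\<^esub> (h s \<otimes>\<^bsub>L\<^esub> x) = x"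
    using u x den_carrier[OF s] by (simp add: S.m_assoc[symmetric])
  then show ?thesis using S.ideal_lmult[OF I S.Units_inv_closed[OF u] x(2)] by simp
qed

lemma preimage_prime:
  assumes "primeideal q L"
  shows "primeideal {a \<in> carrier R. h a \<in> q} R"
  by (rule ring.primeideal_vimage[OF R.is_cring assms])

lemma preimage_ideal:
  assumes "ideal I L"
  shows "ideal {a \<in> carrier R. h a \<in> I} R"
  using assms by (rule ring.ideal_vimage)

lemma preimage_prime_disjoint:
  assumes "primeideal q L" and "s \<in> S"
  shows "h s \<notin> q"
proof
  assume "h s \<in> q"
  then have "\<one>\<^bsub>L\<^esub> \<in> q"
    using den_cancel_ideal[OF S.prime_ideal[OF assms(1)] assms(2), of "\<one>\<^bsub>L\<^esub>"] den_carrier[OF assms(2)]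
    by simp
  then show False using S.prime_one[OF assms(1)] by simp
qed

text \<open>
  An ideal of \<open>L\<close> is generated by the image of its preimage in \<open>R\<close>.
\<close>

lemma noetherian:
  assumes "noetherian_ring R"
  shows "noetherian_ring L"
proof (rule S.noetherian_ringI)
  fix I assume I: "ideal I L"
  note pre = preimage_ideal[OF I]
  obtain F where F: "F \<subseteq> carrier R" "finite F" "{a \<in> carrier R. h a \<in> I} = genideal R F"
    using noetherian_ring.finetely_gen[OF assms pre] by blast
  define J where "J = genideal L (h ` F)"
  have hF: "h ` F \<subseteq> carrier L" using F(1) by auto
  have J: "ideal J L" unfolding J_def by (rule S.genideal_ideal[OF hF])
  have FI: "F \<subseteq> {a \<in> carrier R. h a \<in> I}" using R.genideal_self[OF F(1)] F(3) by simp
  have "J \<subseteq> I" unfolding J_def by (rule S.genideal_minimal[OF I]) (use FI in auto)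
  moreover have "I \<subseteq> J"
  proof
    fix x assume x: "x \<in> I"
    have xc: "x \<in> carrier L" by (rule S.ideal_mem[OF I x])
    obtain a s where as: "a \<in> carrier R" "s \<in> S" "h s \<otimes>\<^bsub>L\<^esub> x = h a" using numerator[OF xc] by blast
    have "h a \<in> I" using S.ideal_lmult[OF I _ x, of "h s"] as den_carrier by simp
    then have "a \<in> genideal R F" using F(3) as by blast
    moreover have "genideal R F \<subseteq> {a \<in> carrier R. h a \<in> J}"
      using S.genideal_self[OF hF] F(1)
      by (intro R.genideal_minimal preimage_ideal[OF J]) (auto simp: J_def)
    ultimately have "h a \<in> J" by blast
    then show "x \<in> J" using den_cancel_ideal[OF J as(2) xc] as(3) by simp
  qed
  ultimately show "\<exists>A\<subseteq>carrier L. finite A \<and> I = genideal L A"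
    using F(2) hF by (auto simp: J_def)
qed

lemma reduced:
  assumes "reduced_ring R"
  shows "reduced_ring L"
  unfolding reduced_ring_def
proof (intro conjI ballI allI impI S.is_cring)
  fix x and n :: nat assume x: "x \<in> carrier L" "x [^]\<^bsub>L\<^esub> n = \<zero>\<^bsub>L\<^esub>"
  obtain a s where as: "a \<in> carrier R" "s \<in> S" "h s \<otimes>\<^bsub>L\<^esub> x = h a" using numerator[OF x(1)] by blast
  have [simp]: "s \<in> carrier R" by (rule den_carrier[OF as(2)])
  have "h (a [^] n) = h s [^]\<^bsub>L\<^esub> n \<otimes>\<^bsub>L\<^esub> x [^]\<^bsub>L\<^esub> n"
    using as x S.nat_pow_distrib[of "h s" x n] by simp
  also have "\<dots> = \<zero>\<^bsub>L\<^esub>" using x by simp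
  finally obtain u where u: "u \<in> S" "u \<otimes> a [^] n = \<zero>" using kernel as by blast
  have uc: "u \<in> carrier R" by (rule den_carrier[OF u(1)])
  have "(u \<otimes> a) [^] Suc n = (u [^] n \<otimes> a) \<otimes> (u \<otimes> a [^] n)"
    using uc as by (subst R.nat_pow_distrib) (auto simp: R.m_ac)
  also have "\<dots> = \<zero>" using u uc as by simp
  finally have "u \<otimes> a = \<zero>" using assms uc as unfolding reduced_ring_def by blast
  then have "h u \<otimes>\<^bsub>L\<^esub> h a = h \<zero>" using hom_mult[OF uc as(1)] by simp
  then have "h u \<otimes>\<^bsub>L\<^esub> h a = h u \<otimes>\<^bsub>L\<^esub> \<zero>\<^bsub>L\<^esub>" using uc by simp
  then have "h a = \<zero>\<^bsub>L\<^esub>" using den_cancel[OF u(1)] as by simp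
  then show "x = \<zero>\<^bsub>L\<^esub>" using den_cancel[OF as(2) x(1)] as by simp
qed

end

context cring
begin

lemma fraction_localization_map:
  assumes S: "S \<subseteq> carrier R" "\<one> \<in> S" "\<And>s t. s \<in> S \<Longrightarrow> t \<in> S \<Longrightarrow> s \<otimes> t \<in> S"
  shows "localization_map R (localization R S) (\<lambda>a. fraction R S a \<one>) S"
proof -
  have Sc: "s \<in> carrier R" if "s \<in> S" for s using S that by blast
  let ?r = "fraction_rel R S"
  have relI: "((a, s), (b, t)) \<in> ?r"
    if "a \<in> carrier R" "b \<in> carrier R" "s \<in> S" "t \<in> S" "u \<in> S" "u \<otimes> (t \<otimes> a) = u \<otimes> (s \<otimes> b)" for a b s t u
    using that by (auto simp: fraction_rel_def)
  have equiv: "equiv (carrier R \<times> S) ?r"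
  proof (rule equivI)
    show "?r \<subseteq> (carrier R \<times> S) \<times> (carrier R \<times> S)" by (auto simp: fraction_rel_def)
    show "refl_on (carrier R \<times> S) ?r" using S by (auto simp: refl_on_def fraction_rel_def)
    show "sym ?r"
    proof (rule symI)
      fix x y assume "(x, y) \<in> ?r"
      then obtain a s b t u where "x = (a, s)" "y = (b, t)" "a \<in> carrier R" "b \<in> carrier R"
        "s \<in> S" "t \<in> S" "u \<in> S" "u \<otimes> (t \<otimes> a) = u \<otimes> (s \<otimes> b)"
        by (auto simp: fraction_rel_def)
      then show "(y, x) \<in> ?r" using relI[of b a t s u] by simp
    qed
    show "trans ?r"
    proof (rule transI)
      fix x y z assume "(x, y) \<in> ?r" "(y, z) \<in> ?r"
      then obtain a s b t c r u v where
        eqs: "x = (a, s)" "y = (b, t)" "z = (c, r)" and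
        *: "a \<in> carrier R" "b \<in> carrier R" "c \<in> carrier R" "s \<in> S" "t \<in> S" "r \<in> S" "u \<in> S" "v \<in> S"
        "u \<otimes> (t \<otimes> a) = u \<otimes> (s \<otimes> b)" "v \<otimes> (r \<otimes> b) = v \<otimes> (t \<otimes> c)"
        by (auto simp: fraction_rel_def)
      note carr [simp] = *(1-3) Sc[OF *(4)] Sc[OF *(5)] Sc[OF *(6)] Sc[OF *(7)] Sc[OF *(8)]
      have "(u \<otimes> v \<otimes> t) \<otimes> (r \<otimes> a) = (v \<otimes> r) \<otimes> (u \<otimes> (t \<otimes> a))" using carr by algebra
      also have "\<dots> = (u \<otimes> s) \<otimes> (v \<otimes> (r \<otimes> b))" unfolding *(9) using carr by algebra
      also have "\<dots> = (u \<otimes> v \<otimes> t) \<otimes> (s \<otimes> c)" unfolding *(10) using carr by algebra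
      finally show "(x, z) \<in> ?r"
        unfolding eqs using * S(3) by (intro relI) auto
    qed
  qed
  let ?f = "fraction R S"
  have eq_iff: "?f a s = ?f b t \<longleftrightarrow> (\<exists>u\<in>S. u \<otimes> (t \<otimes> a) = u \<otimes> (s \<otimes> b))"
    if "a \<in> carrier R" "b \<in> carrier R" "s \<in> S" "t \<in> S" for a b s t
    using eq_equiv_class_iff[OF equiv, of "(a, s)" "(b, t)"] that
    by (auto simp: fraction_def fraction_rel_def)
  have eqI: "?f a s = ?f b t"
    if "a \<in> carrier R" "b \<in> carrier R" "s \<in> S" "t \<in> S" "t \<otimes> a = s \<otimes> b" for a b s t
    using eq_iff[OF that(1-4)] that(5) S(2) by auto
  have mem: "x \<in> ?f a s \<longleftrightarrow> fst x \<in> carrier R \<and> snd x \<in> S \<and> ?f (fst x) (snd x) = ?f a s"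
    if "a \<in> carrier R" "s \<in> S" for a s x
  proof -
    obtain b t where x: "x = (b, t)" by (cases x) auto
    have "x \<in> ?f a s \<longleftrightarrow> ((a, s), (b, t)) \<in> ?r" by (simp add: fraction_def x)
    also have "\<dots> \<longleftrightarrow> b \<in> carrier R \<and> t \<in> S \<and> (\<exists>u\<in>S. u \<otimes> (t \<otimes> a) = u \<otimes> (s \<otimes> b))"
      using that by (simp add: fraction_rel_def)
    also have "\<dots> \<longleftrightarrow> b \<in> carrier R \<and> t \<in> S \<and> ?f b t = ?f a s"
      using eq_iff[of a b s t] that by metis
    finally show ?thesis by (simp add: x)
  qed
  let ?L = "localization R S"
  have carrier: "carrier ?L = {?f a s | a s. a \<in> carrier R \<and> s \<in> S}"
    by (auto simp: localization_def quotient_def fraction_def)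
  \<comment> \<open>Products and sums of classes are unions over representatives that all give the same class.\<close>
  have const: "(\<Union>x\<in>?f a s. \<Union>y\<in>?f b t. G x y) = K"
    if "a \<in> carrier R" "s \<in> S" "b \<in> carrier R" "t \<in> S"
      and "\<And>x y. x \<in> ?f a s \<Longrightarrow> y \<in> ?f b t \<Longrightarrow> G x y = K" for a s b t and G :: "_ \<Rightarrow> _ \<Rightarrow> ('a \<times> 'a) set" and K
  proof -
    have "(a, s) \<in> ?f a s" "(b, t) \<in> ?f b t" using mem that by auto
    then show ?thesis using that(5) by blast
  qed
  have mult: "?f a s \<otimes>\<^bsub>?L\<^esub> ?f b t = ?f (a \<otimes> b) (s \<otimes> t)"
    if ab: "a \<in> carrier R" "s \<in> S" "b \<in> carrier R" "t \<in> S" for a s b t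
  proof -
    have "?f (fst x \<otimes> fst y) (snd x \<otimes> snd y) = ?f (a \<otimes> b) (s \<otimes> t)"
      if xy: "x \<in> ?f a s" "y \<in> ?f b t" for x y
    proof -
      obtain a' s' b' t' where eqs: "x = (a', s')" "y = (b', t')" by (cases x, cases y) auto
      have *: "a' \<in> carrier R" "s' \<in> S" "b' \<in> carrier R" "t' \<in> S"
        "?f a' s' = ?f a s" "?f b' t' = ?f b t" using xy ab mem eqs by auto
      obtain u v where uv: "u \<in> S" "v \<in> S" "u \<otimes> (s \<otimes> a') = u \<otimes> (s' \<otimes> a)"
        "v \<otimes> (t \<otimes> b') = v \<otimes> (t' \<otimes> b)"
        using *(5,6) eq_iff[OF *(1) ab(1) *(2) ab(2)] eq_iff[OF *(3) ab(3) *(4) ab(4)] by auto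
      note carr [simp] = *(1,3) ab(1,3) Sc[OF *(2)] Sc[OF *(4)] Sc[OF ab(2)] Sc[OF ab(4)] Sc[OF uv(1)] Sc[OF uv(2)]
      have "(u \<otimes> v) \<otimes> ((s \<otimes> t) \<otimes> (a' \<otimes> b')) = (u \<otimes> (s \<otimes> a')) \<otimes> (v \<otimes> (t \<otimes> b'))"
        using carr by algebra
      also have "\<dots> = (u \<otimes> v) \<otimes> ((s' \<otimes> t') \<otimes> (a \<otimes> b))"
        unfolding uv(3,4) using carr by algebra
      finally show ?thesis
        unfolding eqs using S(3) * ab uv by (subst eq_iff) auto
    qed
    then have "(\<Union>x\<in>?f a s. \<Union>y\<in>?f b t. ?f (fst x \<otimes> fst y) (snd x \<otimes> snd y)) = ?f (a \<otimes> b) (s \<otimes> t)"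
      by (rule const[OF ab])
    then show ?thesis by (simp only: localization_def monoid.simps)
  qed
  have add: "?f a s \<oplus>\<^bsub>?L\<^esub> ?f b t = ?f (t \<otimes> a \<oplus> s \<otimes> b) (s \<otimes> t)"
    if ab: "a \<in> carrier R" "s \<in> S" "b \<in> carrier R" "t \<in> S" for a s b t
  proof -
    have "?f (snd y \<otimes> fst x \<oplus> snd x \<otimes> fst y) (snd x \<otimes> snd y) = ?f (t \<otimes> a \<oplus> s \<otimes> b) (s \<otimes> t)"
      if xy: "x \<in> ?f a s" "y \<in> ?f b t" for x y
    proof -
      obtain a' s' b' t' where eqs: "x = (a', s')" "y = (b', t')" by (cases x, cases y) auto
      have *: "a' \<in> carrier R" "s' \<in> S" "b' \<in> carrier R" "t' \<in> S"
        "?f a' s' = ?f a s" "?f b' t' = ?f b t" using xy ab mem eqs by auto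
      obtain u v where uv: "u \<in> S" "v \<in> S" "u \<otimes> (s \<otimes> a') = u \<otimes> (s' \<otimes> a)"
        "v \<otimes> (t \<otimes> b') = v \<otimes> (t' \<otimes> b)"
        using *(5,6) eq_iff[OF *(1) ab(1) *(2) ab(2)] eq_iff[OF *(3) ab(3) *(4) ab(4)] by auto
      note carr [simp] = *(1,3) ab(1,3) Sc[OF *(2)] Sc[OF *(4)] Sc[OF ab(2)] Sc[OF ab(4)] Sc[OF uv(1)] Sc[OF uv(2)]
      have "(u \<otimes> v) \<otimes> ((s \<otimes> t) \<otimes> (t' \<otimes> a' \<oplus> s' \<otimes> b'))
          = (v \<otimes> t \<otimes> t') \<otimes> (u \<otimes> (s \<otimes> a')) \<oplus> (u \<otimes> s \<otimes> s') \<otimes> (v \<otimes> (t \<otimes> b'))"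
        using carr by algebra
      also have "\<dots> = (u \<otimes> v) \<otimes> ((s' \<otimes> t') \<otimes> (t \<otimes> a \<oplus> s \<otimes> b))"
        unfolding uv(3,4) using carr by algebra
      finally show ?thesis
        unfolding eqs using S(3) * ab uv by (subst eq_iff) auto
    qed
    then have "(\<Union>x\<in>?f a s. \<Union>y\<in>?f b t. ?f (snd y \<otimes> fst x \<oplus> snd x \<otimes> fst y) (snd x \<otimes> snd y))
        = ?f (t \<otimes> a \<oplus> s \<otimes> b) (s \<otimes> t)"
      by (rule const[OF ab])
    then show ?thesis by (simp only: localization_def ring.simps)
  qed
  have one: "\<one>\<^bsub>?L\<^esub> = ?f \<one> \<one>" and zero: "\<zero>\<^bsub>?L\<^esub> = ?f \<zero> \<one>"
    by (simp_all add: localization_def)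
  have fc: "?f a s \<in> carrier ?L" if "a \<in> carrier R" "s \<in> S" for a s
    using that carrier by blast
  have fE: "\<exists>a s. a \<in> carrier R \<and> s \<in> S \<and> x = ?f a s" if "x \<in> carrier ?L" for x
    using that carrier by blast
  have cring: "cring ?L"
  proof (rule cringI)
    show "abelian_group ?L"
    proof (rule abelian_groupI)
      fix x y assume "x \<in> carrier ?L" "y \<in> carrier ?L"
      then obtain a s b t where *: "a \<in> carrier R" "s \<in> S" "b \<in> carrier R" "t \<in> S" "x = ?f a s" "y = ?f b t"
        using fE by metis
      then show "x \<oplus>\<^bsub>?L\<^esub> y \<in> carrier ?L" using S(3) by (auto simp: add intro!: fc dest: Sc)
      note [simp] = *(1,3) Sc[OF *(2)] Sc[OF *(4)]
      show "x \<oplus>\<^bsub>?L\<^esub> y = y \<oplus>\<^bsub>?L\<^esub> x" using * by (simp add: add a_comm m_comm)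
    next
      fix x y z assume "x \<in> carrier ?L" "y \<in> carrier ?L" "z \<in> carrier ?L"
      then obtain a s b t c r where *: "a \<in> carrier R" "s \<in> S" "b \<in> carrier R" "t \<in> S" "c \<in> carrier R" "r \<in> S"
        "x = ?f a s" "y = ?f b t" "z = ?f c r" using fE by metis
      note carr [simp] = *(1,3,5) Sc[OF *(2)] Sc[OF *(4)] Sc[OF *(6)]
      have num: "r \<otimes> (t \<otimes> a \<oplus> s \<otimes> b) \<oplus> s \<otimes> t \<otimes> c = t \<otimes> r \<otimes> a \<oplus> s \<otimes> (r \<otimes> b \<oplus> t \<otimes> c)"
       
        using carr by algebra
      show "(x \<oplus>\<^bsub>?L\<^esub> y) \<oplus>\<^bsub>?L\<^esub> z = x \<oplus>\<^bsub>?L\<^esub> (y \<oplus>\<^bsub>?L\<^esub> z)"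
        using * S(3) num by (simp add: add m_assoc)
    next
      fix x assume "x \<in> carrier ?L"
      then obtain a s where *: "a \<in> carrier R" "s \<in> S" "x = ?f a s" using fE by metis
      note [simp] = *(1) Sc[OF *(2)]
      show "\<zero>\<^bsub>?L\<^esub> \<oplus>\<^bsub>?L\<^esub> x = x" using * S by (simp add: add zero)
      have "?f (\<ominus> a) s \<oplus>\<^bsub>?L\<^esub> x = ?f (s \<otimes> (\<ominus> a) \<oplus> s \<otimes> a) (s \<otimes> s)"
        using * by (simp add: add)
      also have "\<dots> = \<zero>\<^bsub>?L\<^esub>"
        unfolding zero using * S by (intro eqI) (simp_all flip: r_distr add: l_neg)
      finally show "\<exists>y\<in>carrier ?L. y \<oplus>\<^bsub>?L\<^esub> x = \<zero>\<^bsub>?L\<^esub>" using fc[of "\<ominus> a" s] * by auto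
    next
      show "\<zero>\<^bsub>?L\<^esub> \<in> carrier ?L" using fc S by (simp add: zero)
    qed
    show "comm_monoid ?L"
    proof (rule comm_monoidI)
      fix x y assume "x \<in> carrier ?L" "y \<in> carrier ?L"
      then obtain a s b t where *: "a \<in> carrier R" "s \<in> S" "b \<in> carrier R" "t \<in> S" "x = ?f a s" "y = ?f b t"
        using fE by metis
      note [simp] = *(1,3) Sc[OF *(2)] Sc[OF *(4)]
      show "x \<otimes>\<^bsub>?L\<^esub> y \<in> carrier ?L" using * S(3) by (simp add: mult fc)
      show "x \<otimes>\<^bsub>?L\<^esub> y = y \<otimes>\<^bsub>?L\<^esub> x" using * by (simp add: mult m_comm)
    next
      fix x y z assume "x \<in> carrier ?L" "y \<in> carrier ?L" "z \<in> carrier ?L"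
      then obtain a s b t c r where *: "a \<in> carrier R" "s \<in> S" "b \<in> carrier R" "t \<in> S" "c \<in> carrier R" "r \<in> S"
        "x = ?f a s" "y = ?f b t" "z = ?f c r" using fE by metis
      note [simp] = *(1,3,5) Sc[OF *(2)] Sc[OF *(4)] Sc[OF *(6)]
      show "(x \<otimes>\<^bsub>?L\<^esub> y) \<otimes>\<^bsub>?L\<^esub> z = x \<otimes>\<^bsub>?L\<^esub> (y \<otimes>\<^bsub>?L\<^esub> z)"
        using * S(3) by (simp add: mult m_assoc)
    next
      fix x assume "x \<in> carrier ?L"
      then obtain a s where *: "a \<in> carrier R" "s \<in> S" "x = ?f a s" using fE by metis
      then show "\<one>\<^bsub>?L\<^esub> \<otimes>\<^bsub>?L\<^esub> x = x" using S Sc[OF *(2)] by (simp add: mult one)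
    next
      show "\<one>\<^bsub>?L\<^esub> \<in> carrier ?L" using fc S by (simp add: one)
    qed
    fix x y z assume "x \<in> carrier ?L" "y \<in> carrier ?L" "z \<in> carrier ?L"
    then obtain a s b t c r where *: "a \<in> carrier R" "s \<in> S" "b \<in> carrier R" "t \<in> S" "c \<in> carrier R" "r \<in> S"
      "x = ?f a s" "y = ?f b t" "z = ?f c r" using fE by metis
    note carr [simp] = *(1,3,5) Sc[OF *(2)] Sc[OF *(4)] Sc[OF *(6)]
    have "(x \<oplus>\<^bsub>?L\<^esub> y) \<otimes>\<^bsub>?L\<^esub> z = ?f ((t \<otimes> a \<oplus> s \<otimes> b) \<otimes> c) (s \<otimes> t \<otimes> r)"
      using * S(3) by (simp add: mult add)
    also have "\<dots> = ?f (t \<otimes> r \<otimes> (a \<otimes> c) \<oplus> s \<otimes> r \<otimes> (b \<otimes> c)) (s \<otimes> r \<otimes> (t \<otimes> r))"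
    proof (rule eqI)
      show "s \<otimes> r \<otimes> (t \<otimes> r) \<otimes> ((t \<otimes> a \<oplus> s \<otimes> b) \<otimes> c)
          = s \<otimes> t \<otimes> r \<otimes> (t \<otimes> r \<otimes> (a \<otimes> c) \<oplus> s \<otimes> r \<otimes> (b \<otimes> c))"
        using *(1,3,5) Sc[OF *(2)] Sc[OF *(4)] Sc[OF *(6)] by algebra
    qed (use * S(3) in simp_all)
    also have "\<dots> = x \<otimes>\<^bsub>?L\<^esub> z \<oplus>\<^bsub>?L\<^esub> y \<otimes>\<^bsub>?L\<^esub> z"
      using * S(3) by (simp add: mult add)
    finally show "(x \<oplus>\<^bsub>?L\<^esub> y) \<otimes>\<^bsub>?L\<^esub> z = x \<otimes>\<^bsub>?L\<^esub> z \<oplus>\<^bsub>?L\<^esub> y \<otimes>\<^bsub>?L\<^esub> z" .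
  qed
  interpret L: cring ?L by (rule cring)
  show ?thesis
  proof (unfold_locales)
    show "(\<lambda>a. ?f a \<one>) \<in> ring_hom R ?L"
      using S by (intro ring_hom_memI) (auto simp: fc mult add one)
    show "S \<subseteq> carrier R" "\<one> \<in> S" "\<And>s t. s \<in> S \<Longrightarrow> t \<in> S \<Longrightarrow> s \<otimes> t \<in> S" by (fact S)+
  next
    fix s assume s: "s \<in> S"
    note [simp] = Sc[OF s]
    have "?f s \<one> \<otimes>\<^bsub>?L\<^esub> ?f \<one> s = \<one>\<^bsub>?L\<^esub>"
      using s S by (simp add: mult one eqI)
    then show "?f s \<one> \<in> Units ?L"
      using L.m_comm[OF fc[of s \<one>] fc[of \<one> s]] fc[of s \<one>] fc[of \<one> s] s S(2)
      unfolding Units_def by auto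
  next
    fix x assume "x \<in> carrier ?L"
    then obtain a s where *: "a \<in> carrier R" "s \<in> S" "x = ?f a s" using fE by metis
    note [simp] = *(1) Sc[OF *(2)]
    have "?f s \<one> \<otimes>\<^bsub>?L\<^esub> x = ?f a \<one>"
      using * S by (simp add: mult eqI)
    then show "\<exists>a\<in>carrier R. \<exists>s\<in>S. ?f s \<one> \<otimes>\<^bsub>?L\<^esub> x = ?f a \<one>" using * by blast
  next
    fix a assume a: "a \<in> carrier R" "?f a \<one> = \<zero>\<^bsub>?L\<^esub>"
    then obtain u where "u \<in> S" "u \<otimes> (\<one> \<otimes> a) = u \<otimes> (\<one> \<otimes> \<zero>)"
      using eq_iff[of a \<zero> \<one> \<one>] S(2) by (auto simp: zero)
    then show "\<exists>s\<in>S. s \<otimes> a = \<zero>" using a Sc by auto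
  qed
qed

lemma prime_localization_map:
  assumes "primeideal P R"
  shows "localization_map R (localization R (carrier R - P)) (\<lambda>a. fraction R (carrier R - P) a \<one>) (carrier R - P)"
  by (rule fraction_localization_map) (simp_all only: prime_compl[OF assms] Diff_subset, simp add: prime_one[OF assms])

lemma nonzerodivisorD:
  assumes "s \<in> nonzerodivisors R"
  shows "s \<in> carrier R" and "\<And>b. b \<in> carrier R \<Longrightarrow> s \<otimes> b = \<zero> \<Longrightarrow> b = \<zero>"
  using assms unfolding nonzerodivisors_def by blast+

lemma nonzerodivisors_mult:
  assumes "s \<in> nonzerodivisors R" and "t \<in> nonzerodivisors R"
  shows "s \<otimes> t \<in> nonzerodivisors R"
proof -
  have *: "s \<in> carrier R" "t \<in> carrier R"
    "\<And>b. b \<in> carrier R \<Longrightarrow> s \<otimes> b = \<zero> \<Longrightarrow> b = \<zero>" "\<And>b. b \<in> carrier R \<Longrightarrow> t \<otimes> b = \<zero> \<Longrightarrow> b = \<zero>"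
    using assms unfolding nonzerodivisors_def by blast+
  have "b = \<zero>" if b: "b \<in> carrier R" "s \<otimes> t \<otimes> b = \<zero>" for b
    using *(3)[of "t \<otimes> b"] *(4)[OF b(1)] b *(1,2) by (simp add: m_assoc)
  then show ?thesis using *(1,2) by (simp add: nonzerodivisors_def)
qed

lemma nonzerodivisor_cancel:
  assumes b: "b \<in> nonzerodivisors R" and [simp]: "x \<in> carrier R" "y \<in> carrier R"
    and eq: "b \<otimes> x = b \<otimes> y"
  shows "x = y"
proof -
  have [simp]: "b \<in> carrier R" using nonzerodivisorD(1)[OF b] .
  have "b \<otimes> (x \<ominus> y) = b \<otimes> x \<ominus> b \<otimes> y"
    using \<open>b \<in> carrier R\<close> \<open>x \<in> carrier R\<close> \<open>y \<in> carrier R\<close>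
    by algebra
  also have "\<dots> = \<zero>" using eq by (simp add: r_neg minus_eq)
  finally have "x \<ominus> y = \<zero>" using nonzerodivisorD(2)[OF b, of "x \<ominus> y"] by simp
  then show ?thesis by (rule ring_eqI) simp_all
qed

lemma total_fractions_map:
  shows "localization_map R (total_fractions R) (to_fractions R) (nonzerodivisors R)"
    and "inj_on (to_fractions R) (carrier R)"
proof -
  have eq: "to_fractions R = (\<lambda>a. fraction R (nonzerodivisors R) a \<one>)"
    by (rule ext) (simp add: to_fractions_def)
  show *: "localization_map R (total_fractions R) (to_fractions R) (nonzerodivisors R)"
    unfolding eq total_fractions_def
  proof (rule fraction_localization_map)
    show "nonzerodivisors R \<subseteq> carrier R" "\<one> \<in> nonzerodivisors R"
      by (auto simp add: nonzerodivisors_def)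
  qed (rule nonzerodivisors_mult)
  interpret Q: localization_map R "total_fractions R" "to_fractions R" "nonzerodivisors R" by (rule *)
  show "inj_on (to_fractions R) (carrier R)"
  proof (rule inj_onI)
    fix a b assume ab: "a \<in> carrier R" "b \<in> carrier R" "to_fractions R a = to_fractions R b"
    then obtain s where s: "s \<in> nonzerodivisors R" "s \<otimes> a = s \<otimes> b" using Q.hom_eqD by blast
    show "a = b" by (rule nonzerodivisor_cancel[OF s(1) ab(1,2) s(2)])
  qed
qed

end

section \<open>Radical ideals and the Grauert-Remmert argument\<close>

context cring
begin

lemma nonzerodivisors_pow:
  assumes "b \<in> nonzerodivisors R"
  shows "b [^] (n::nat) \<in> nonzerodivisors R"
proof (induction n)
  case 0
  show ?case by (auto simp add: nonzerodivisors_def)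
next
  case (Suc n)
  then show ?case using nonzerodivisors_mult[OF Suc assms] by simp
qed

text \<open>
  With \<open>d = (a/b) j\<close>, the product of \<open>j\<^sup>n\<close> and the monomial \<open>a\<^sup>i b\<^sup>n\<^sup>-\<^sup>i\<close> is \<open>b\<^sup>n d\<^sup>i j\<^sup>n\<^sup>-\<^sup>i\<close>.
\<close>

lemma forms_clear_denominators:
  assumes [simp]: "a \<in> carrier R" "b \<in> carrier R" "d \<in> carrier R" "j \<in> carrier R"
    and eq: "a \<otimes> j = b \<otimes> d" and "h \<in> forms a b n"
  shows "\<exists>r\<in>carrier R. j [^] n \<otimes> h = b [^] n \<otimes> r"
  using assms(6)
proof (induction n arbitrary: h)
  case 0
  then show ?case by (intro bexI[of _ h]) auto
next
  case (Suc n)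
  then obtain h1 h2 where h: "h1 \<in> forms a b n" "h2 \<in> forms a b n" "h = a \<otimes> h1 \<oplus> b \<otimes> h2"
    by (auto elim!: forms_SucE)
  obtain r1 r2 where r: "r1 \<in> carrier R" "j [^] n \<otimes> h1 = b [^] n \<otimes> r1"
    "r2 \<in> carrier R" "j [^] n \<otimes> h2 = b [^] n \<otimes> r2"
    using Suc.IH[OF h(1)] Suc.IH[OF h(2)] by blast
  define e where "e = j [^] n"
  define c where "c = b [^] n"
  note [simp] = r(1,3) forms_mem[OF assms(1,2) h(1)] forms_mem[OF assms(1,2) h(2)]
  have [simp]: "e \<in> carrier R" "c \<in> carrier R" by (simp_all add: e_def c_def)
  have r': "e \<otimes> h1 = c \<otimes> r1" "e \<otimes> h2 = c \<otimes> r2" using r by (simp_all add: e_def c_def)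
  have "(e \<otimes> j) \<otimes> h = (a \<otimes> j) \<otimes> (e \<otimes> h1) \<oplus> (b \<otimes> j) \<otimes> (e \<otimes> h2)"
    unfolding h(3)
      using \<open>e \<in> carrier R\<close> \<open>j \<in> carrier R\<close> \<open>a \<in> carrier R\<close> \<open>h1 \<in> carrier R\<close> \<open>b \<in> carrier R\<close>
        \<open>h2 \<in> carrier R\<close>
      by algebra
  also have "\<dots> = (c \<otimes> b) \<otimes> (d \<otimes> r1 \<oplus> j \<otimes> r2)"
    unfolding eq r'
      using \<open>c \<in> carrier R\<close> \<open>b \<in> carrier R\<close> \<open>d \<in> carrier R\<close> \<open>r1 \<in> carrier R\<close> \<open>j \<in> carrier R\<close>
        \<open>r2 \<in> carrier R\<close> \<open>e \<in> carrier R\<close> \<open>a \<in> carrier R\<close> \<open>h1 \<in> carrier R\<close> \<open>h2 \<in> carrier R\<close>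
      by algebra
  finally show ?case unfolding e_def c_def by (intro bexI[of _ "d \<otimes> r1 \<oplus> j \<otimes> r2"]) auto
qed

text \<open>
  The factor \<open>z\<close> makes the induction work without the binomial theorem:
  \<open>(x + y)\<^sup>k\<^sup>+\<^sup>1 z = (x + y)\<^sup>k (x z) + (x + y)\<^sup>k (y z)\<close>, and one power fewer of \<open>x\<close> is needed to move \<open>x z\<close>
  into \<open>I\<close>, one power fewer of \<open>y\<close> for \<open>y z\<close>.
\<close>

lemma radical_add:
  assumes I: "ideal I R" and [simp]: "x \<in> carrier R" "y \<in> carrier R"
    and "z \<in> carrier R" and "x [^] n \<otimes> z \<in> I" and "y [^] m \<otimes> z \<in> I"
  shows "(x \<oplus> y) [^] (n + m :: nat) \<otimes> z \<in> I"
  using assms(4-6)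
proof (induction "n + m" arbitrary: n m z)
  case 0
  then show ?case by simp
next
  case (Suc k)
  note [simp] = Suc.prems(1)
  show ?case
  proof (cases "n = 0 \<or> m = 0")
    case True
    then have "z \<in> I" using Suc.prems by auto
    then show ?thesis using ideal_lmult[OF I] by simp
  next
    case False
    then obtain n' m' where nm: "n = Suc n'" "m = Suc m'" by (metis not0_implies_Suc)
    define w where "w = (x \<oplus> y) [^] k"
    have [simp]: "w \<in> carrier R" by (simp add: w_def)
    have "y [^] m \<otimes> (x \<otimes> z) = x \<otimes> (y [^] m \<otimes> z)" "x [^] n \<otimes> (y \<otimes> z) = y \<otimes> (x [^] n \<otimes> z)"
      by (simp_all add: m_ac)
    then have "y [^] m \<otimes> (x \<otimes> z) \<in> I" "x [^] n \<otimes> (y \<otimes> z) \<in> I"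
      using ideal_lmult[OF I _ Suc.prems(3), of x] ideal_lmult[OF I _ Suc.prems(2), of y] by auto
    moreover have "x [^] n' \<otimes> (x \<otimes> z) \<in> I" "y [^] m' \<otimes> (y \<otimes> z) \<in> I"
      using Suc.prems by (simp_all add: nm m_assoc)
    moreover have "k = n' + m" "k = n + m'" using Suc.hyps nm by auto
    ultimately have "w \<otimes> (x \<otimes> z) \<in> I" "w \<otimes> (y \<otimes> z) \<in> I"
      using Suc.hyps(1)[of n' m "x \<otimes> z"] Suc.hyps(1)[of n m' "y \<otimes> z"] by (simp_all add: w_def)
    then have "w \<otimes> (x \<otimes> z) \<oplus> w \<otimes> (y \<otimes> z) \<in> I" by (rule ideal_add[OF I])
    also have "w \<otimes> (x \<otimes> z) \<oplus> w \<otimes> (y \<otimes> z) = (w \<otimes> (x \<oplus> y)) \<otimes> z"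
      using \<open>w \<in> carrier R\<close> \<open>x \<in> carrier R\<close> \<open>z \<in> carrier R\<close> \<open>y \<in> carrier R\<close>
      by algebra
    finally show ?thesis by (simp add: w_def Suc.hyps(2)[symmetric])
  qed
qed

lemma radical_ideal_ideal:
  assumes I: "ideal I R"
  shows "ideal (radical_ideal R I) R"
proof (rule cring_idealI)
  show "radical_ideal R I \<subseteq> carrier R" by (auto simp: radical_ideal_def)
  show "\<zero> \<in> radical_ideal R I"
    using ideal_zero[OF I] unfolding radical_ideal_def by (intro CollectI conjI exI[of _ 1]) auto
next
  fix x y assume "x \<in> radical_ideal R I" "y \<in> radical_ideal R I"
  then obtain n m :: nat where *: "x \<in> carrier R" "y \<in> carrier R" "x [^] n \<in> I" "y [^] m \<in> I"
    by (auto simp: radical_ideal_def)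
  then have "(x \<oplus> y) [^] (n + m) \<otimes> \<one> \<in> I" by (intro radical_add[OF I]) auto
  then show "x \<oplus> y \<in> radical_ideal R I" using * by (auto simp: radical_ideal_def)
next
  fix r x assume r: "r \<in> carrier R" and "x \<in> radical_ideal R I"
  then obtain n :: nat where *: "x \<in> carrier R" "x [^] n \<in> I" by (auto simp: radical_ideal_def)
  have "(r \<otimes> x) [^] n \<in> I"
    using r * ideal_lmult[OF I _ *(2), of "r [^] n"] by (simp add: nat_pow_distrib)
  then show "r \<otimes> x \<in> radical_ideal R I" using r * by (auto simp: radical_ideal_def)
qed

lemma radical_ideal_superset: "ideal I R \<Longrightarrow> I \<subseteq> radical_ideal R I"
  unfolding radical_ideal_def using ideal_mem by (force intro: exI[of _ 1])

lemma radical_ideal_radical: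
  assumes x: "x \<in> carrier R" and "x [^] (n::nat) \<in> radical_ideal R I"
  shows "x \<in> radical_ideal R I"
  using assms nat_pow_pow[OF x] by (auto simp: radical_ideal_def)

lemma radical_ideal_subset_prime:
  assumes "primeideal q R" and "I \<subseteq> q"
  shows "radical_ideal R I \<subseteq> q"
  using prime_pow[OF assms(1)] assms(2) by (auto simp: radical_ideal_def)

end

context noetherian_cring
begin

text \<open>
  Otherwise \<open>exists_prime_colon\<close> yields an integral fraction \<open>x/b\<close> outside \<open>R\<close> for which
  \<open>q = {r. r x/b \<in> R}\<close> is prime. By \<open>loc\<close>, \<open>q\<close> contains \<open>J\<close>. For \<open>j \<in> J\<close>, let \<open>d = (x/b) j \<in> R\<close>. Multiplying
  the relation for \<open>x/b\<close> by \<open>j\<^sup>n\<^sup>+\<^sup>1\<close> shows that \<open>d\<^sup>n\<^sup>+\<^sup>1\<close> is a multiple of \<open>j\<close>, so \<open>d \<in> J\<close> as \<open>J\<close> is radical.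
  Hence \<open>x/b\<close> maps \<open>J\<close> into itself, and \<open>endo\<close> gives the contradiction \<open>x/b \<in> R\<close>.
\<close>

lemma grauert_remmert:
  assumes J: "ideal J R" and rad: "\<And>x n. x \<in> carrier R \<Longrightarrow> x [^] (n::nat) \<in> J \<Longrightarrow> x \<in> J"
    and b: "b \<in> nonzerodivisors R"
    and endo: "\<And>a. a \<in> carrier R \<Longrightarrow> (\<And>j. j \<in> J \<Longrightarrow> \<exists>j'\<in>J. a \<otimes> j = b \<otimes> j') \<Longrightarrow>
      \<exists>r\<in>carrier R. a = b \<otimes> r"
    and loc: "\<And>a q. a \<in> carrier R \<Longrightarrow> integral_fraction a b \<Longrightarrow> primeideal q R \<Longrightarrow> \<not> J \<subseteq> q \<Longrightarrow>
      \<exists>y\<in>carrier R - q. \<exists>r\<in>carrier R. y \<otimes> a = b \<otimes> r"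
    and a: "a \<in> carrier R" "integral_fraction a b"
  shows "\<exists>r\<in>carrier R. a = b \<otimes> r"
proof (rule ccontr)
  assume not: "\<not> ?thesis"
  have bc [simp]: "b \<in> carrier R" by (rule nonzerodivisorD(1)[OF b])
  define I where "I = {b \<otimes> r | r. r \<in> carrier R}"
  have "adjoin {\<zero>} b = I"
    unfolding I_def adjoin_def by (rule Collect_cong) (metis bc l_zero m_closed singleton_iff)
  then have I: "ideal I R" using adjoin_ideal[OF zeroideal bc] by simp
  define Y where "Y = {a \<in> carrier R. integral_fraction a b \<and> a \<notin> I}"
  have "\<exists>x\<in>Y. primeideal (colon I x) R"
  proof (rule exists_prime_colon[OF I])
    show "Y \<subseteq> carrier R" "Y \<inter> I = {}" by (auto simp: Y_def)
    show "Y \<noteq> {}" using not a by (auto simp: Y_def I_def)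
    fix r x assume "r \<in> carrier R" "x \<in> Y" "r \<otimes> x \<notin> I"
    then show "r \<otimes> x \<in> Y" using integral_fraction_scale_left[of x b r] by (auto simp: Y_def)
  qed
  then obtain x where x: "x \<in> Y" and q: "primeideal (colon I x) R" by blast
  have xc [simp]: "x \<in> carrier R" and int: "integral_fraction x b" and xI: "x \<notin> I"
    using x by (auto simp: Y_def)
  have JQ: "J \<subseteq> colon I x"
    using loc[OF xc int q] by (auto simp: colon_def I_def)
  obtain n g where g: "g \<in> forms x b n" "x [^] Suc n = b \<otimes> g"
    using int by (auto simp: integral_fraction_def)
  have gc [simp]: "g \<in> carrier R" by (rule forms_mem[OF xc bc g(1)])
  have "\<exists>j'\<in>J. x \<otimes> j = b \<otimes> j'" if j: "j \<in> J" for j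
  proof -
    have jc [simp]: "j \<in> carrier R" by (rule ideal_mem[OF J j])
    have "j \<otimes> x \<in> I" using JQ j by (auto simp: colon_def)
    then obtain d where d [simp]: "d \<in> carrier R" and eq: "x \<otimes> j = b \<otimes> d"
      by (auto simp: I_def m_comm)
    obtain r where r [simp]: "r \<in> carrier R" and clear: "j [^] n \<otimes> g = b [^] n \<otimes> r"
      using forms_clear_denominators[OF xc bc d jc eq g(1)] by blast
    have "b [^] Suc n \<otimes> d [^] Suc n = (x \<otimes> j) [^] Suc n"
      unfolding eq by (rule nat_pow_distrib[symmetric]) simp_all
    also have "\<dots> = x [^] Suc n \<otimes> j [^] Suc n" by (rule nat_pow_distrib) simp_all
    also have "\<dots> = (b \<otimes> g) \<otimes> (j [^] n \<otimes> j)" unfolding g(2) by simp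
    also have "\<dots> = b \<otimes> j \<otimes> (j [^] n \<otimes> g)" by (simp add: m_ac)
    also have "\<dots> = b [^] Suc n \<otimes> (r \<otimes> j)" unfolding clear by (simp add: m_ac)
    finally have cancel: "b [^] Suc n \<otimes> d [^] Suc n = b [^] Suc n \<otimes> (r \<otimes> j)" .
    have "d [^] Suc n = r \<otimes> j"
      by (rule nonzerodivisor_cancel[OF nonzerodivisors_pow[OF b] _ _ cancel]) simp_all
    then have "d [^] Suc n \<in> J" using ideal_lmult[OF J r j] by simp
    then have "d \<in> J" by (rule rad[OF d])
    then show ?thesis using eq by blast
  qed
  then have "x \<in> I" using endo[OF xc] by (auto simp: I_def)
  then show False using xI by simp
qed

end

section \<open>Noetherian intermediate rings\<close>

context ring_hom_cring
begin

definition submod :: "'c set \<Rightarrow> bool"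
  where "submod N \<longleftrightarrow> N \<subseteq> carrier S \<and> \<zero>\<^bsub>S\<^esub> \<in> N \<and> (\<forall>x\<in>N. \<forall>y\<in>N. x \<oplus>\<^bsub>S\<^esub> y \<in> N) \<and>
    (\<forall>r\<in>carrier R. \<forall>x\<in>N. h r \<otimes>\<^bsub>S\<^esub> x \<in> N)"

lemma submodD:
  assumes "submod N"
  shows "\<And>x. x \<in> N \<Longrightarrow> x \<in> carrier S" and "\<zero>\<^bsub>S\<^esub> \<in> N"
    and "\<And>x y. x \<in> N \<Longrightarrow> y \<in> N \<Longrightarrow> x \<oplus>\<^bsub>S\<^esub> y \<in> N"
    and "\<And>r x. r \<in> carrier R \<Longrightarrow> x \<in> N \<Longrightarrow> h r \<otimes>\<^bsub>S\<^esub> x \<in> N"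
  using assms by (auto simp: submod_def)

lemma submod_diff:
  assumes N: "submod N" and x: "x \<in> N" and y: "y \<in> N"
  shows "x \<ominus>\<^bsub>S\<^esub> y \<in> N"
proof -
  have [simp]: "x \<in> carrier S" "y \<in> carrier S" using submodD(1)[OF N] x y by auto
  have "h (\<ominus> \<one>) \<otimes>\<^bsub>S\<^esub> y = \<ominus>\<^bsub>S\<^esub> y" by (simp add: S.l_minus)
  then have "\<ominus>\<^bsub>S\<^esub> y \<in> N" using submodD(4)[OF N _ y, of "\<ominus> \<one>"] by simp
  then show ?thesis using submodD(3)[OF N x] by (simp add: S.minus_eq)
qed

lemma Span_Cons_iff:
  "x \<in> S.Span (h ` carrier R) (u # us) \<longleftrightarrow>
    (\<exists>c\<in>carrier R. \<exists>v\<in>S.Span (h ` carrier R) us. x = h c \<otimes>\<^bsub>S\<^esub> u \<oplus>\<^bsub>S\<^esub> v)"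
  by (auto simp: S.line_extension_mem_iff)

lemma Span_submod:
  assumes "set us \<subseteq> carrier S"
  shows "submod (S.Span (h ` carrier R) us)"
  using assms
proof (induction us)
  case Nil
  show ?case by (auto simp: submod_def)
next
  case (Cons u us)
  then have [simp]: "u \<in> carrier S" and IH: "submod (S.Span (h ` carrier R) us)" by auto
  let ?T = "S.Span (h ` carrier R) us"
  note carr = submodD(1)[OF IH]
  show ?case
    unfolding submod_def
  proof (intro conjI ballI subsetI)
    fix x assume "x \<in> S.Span (h ` carrier R) (u # us)"
    then show "x \<in> carrier S" unfolding Span_Cons_iff using carr by auto
  next
    show "\<zero>\<^bsub>S\<^esub> \<in> S.Span (h ` carrier R) (u # us)"
      unfolding Span_Cons_iff using submodD(2)[OF IH]
      by (intro bexI[of _ \<zero>] bexI[of _ "\<zero>\<^bsub>S\<^esub>"]) auto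
  next
    fix x y assume "x \<in> S.Span (h ` carrier R) (u # us)" "y \<in> S.Span (h ` carrier R) (u # us)"
    then obtain c v c' v' where *: "c \<in> carrier R" "v \<in> ?T" "x = h c \<otimes>\<^bsub>S\<^esub> u \<oplus>\<^bsub>S\<^esub> v"
      "c' \<in> carrier R" "v' \<in> ?T" "y = h c' \<otimes>\<^bsub>S\<^esub> u \<oplus>\<^bsub>S\<^esub> v'"
      unfolding Span_Cons_iff by blast
    have "x \<oplus>\<^bsub>S\<^esub> y = h (c \<oplus> c') \<otimes>\<^bsub>S\<^esub> u \<oplus>\<^bsub>S\<^esub> (v \<oplus>\<^bsub>S\<^esub> v')"
      using * carr[OF *(2)] carr[OF *(5)] by (simp add: S.l_distr S.a_ac)
    then show "x \<oplus>\<^bsub>S\<^esub> y \<in> S.Span (h ` carrier R) (u # us)"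
      unfolding Span_Cons_iff using * submodD(3)[OF IH *(2,5)] by blast
  next
    fix r x assume r: "r \<in> carrier R" and "x \<in> S.Span (h ` carrier R) (u # us)"
    then obtain c v where *: "c \<in> carrier R" "v \<in> ?T" "x = h c \<otimes>\<^bsub>S\<^esub> u \<oplus>\<^bsub>S\<^esub> v"
      unfolding Span_Cons_iff by blast
    have "h r \<otimes>\<^bsub>S\<^esub> x = h (r \<otimes> c) \<otimes>\<^bsub>S\<^esub> u \<oplus>\<^bsub>S\<^esub> h r \<otimes>\<^bsub>S\<^esub> v"
      using * r carr[OF *(2)] by (simp add: S.r_distr S.m_assoc)
    then show "h r \<otimes>\<^bsub>S\<^esub> x \<in> S.Span (h ` carrier R) (u # us)"
      unfolding Span_Cons_iff using * r submodD(4)[OF IH r *(2)] by blast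
  qed
qed

text \<open>
  Induction on the number of generators: for generators \<open>u # us\<close>, the coefficients of \<open>u\<close> in elements of
  \<open>N\<close> form a finitely generated ideal of \<open>R\<close>, and the elements of \<open>N\<close> in the span of \<open>us\<close> are covered
  by the induction hypothesis. That \<open>F\<close> generates \<open>N\<close> is expressed by the submodules containing \<open>F\<close>; an ideal
  of a subring is such a submodule.
\<close>

lemma submod_finitely_generated:
  assumes noeth: "noetherian_ring R" and "set us \<subseteq> carrier S"
    and "submod N" and "N \<subseteq> S.Span (h ` carrier R) us"
  shows "\<exists>F. finite F \<and> F \<subseteq> N \<and> (\<forall>N'. submod N' \<and> F \<subseteq> N' \<longrightarrow> N \<subseteq> N')"
  using assms(2-)
proof (induction us arbitrary: N)
  case Nil
  then show ?case by (intro exI[of _ "{}"]) (auto simp: submod_def)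
next
  case (Cons u us)
  let ?T = "S.Span (h ` carrier R) us"
  have u [simp]: "u \<in> carrier S" and us: "set us \<subseteq> carrier S" using Cons.prems by auto
  have T: "submod ?T" by (rule Span_submod[OF us])
  note N = Cons.prems(2)
  have coeffs: "ideal {c \<in> carrier R. \<exists>v\<in>?T. h c \<otimes>\<^bsub>S\<^esub> u \<oplus>\<^bsub>S\<^esub> v \<in> M} R" if M: "submod M" for M
  proof (rule R.cring_idealI)
    show "\<zero> \<in> {c \<in> carrier R. \<exists>v\<in>?T. h c \<otimes>\<^bsub>S\<^esub> u \<oplus>\<^bsub>S\<^esub> v \<in> M}"
      using submodD(2)[OF T] submodD(2)[OF M] by force
  next
    fix c c' assume "c \<in> {c \<in> carrier R. \<exists>v\<in>?T. h c \<otimes>\<^bsub>S\<^esub> u \<oplus>\<^bsub>S\<^esub> v \<in> M}"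
      "c' \<in> {c \<in> carrier R. \<exists>v\<in>?T. h c \<otimes>\<^bsub>S\<^esub> u \<oplus>\<^bsub>S\<^esub> v \<in> M}"
    then obtain v v' where *: "c \<in> carrier R" "v \<in> ?T" "h c \<otimes>\<^bsub>S\<^esub> u \<oplus>\<^bsub>S\<^esub> v \<in> M"
      "c' \<in> carrier R" "v' \<in> ?T" "h c' \<otimes>\<^bsub>S\<^esub> u \<oplus>\<^bsub>S\<^esub> v' \<in> M" by blast
    have "(h c \<otimes>\<^bsub>S\<^esub> u \<oplus>\<^bsub>S\<^esub> v) \<oplus>\<^bsub>S\<^esub> (h c' \<otimes>\<^bsub>S\<^esub> u \<oplus>\<^bsub>S\<^esub> v') = h (c \<oplus> c') \<otimes>\<^bsub>S\<^esub> u \<oplus>\<^bsub>S\<^esub> (v \<oplus>\<^bsub>S\<^esub> v')"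
      using * submodD(1)[OF T *(2)] submodD(1)[OF T *(5)] by (simp add: S.l_distr S.a_ac)
    then have "h (c \<oplus> c') \<otimes>\<^bsub>S\<^esub> u \<oplus>\<^bsub>S\<^esub> (v \<oplus>\<^bsub>S\<^esub> v') \<in> M" using submodD(3)[OF M *(3,6)] by simp
    then show "c \<oplus> c' \<in> {c \<in> carrier R. \<exists>v\<in>?T. h c \<otimes>\<^bsub>S\<^esub> u \<oplus>\<^bsub>S\<^esub> v \<in> M}"
      using * submodD(3)[OF T *(2,5)] by blast
  next
    fix r c assume r: "r \<in> carrier R" and "c \<in> {c \<in> carrier R. \<exists>v\<in>?T. h c \<otimes>\<^bsub>S\<^esub> u \<oplus>\<^bsub>S\<^esub> v \<in> M}"
    then obtain v where *: "c \<in> carrier R" "v \<in> ?T" "h c \<otimes>\<^bsub>S\<^esub> u \<oplus>\<^bsub>S\<^esub> v \<in> M" by blast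
    have "h r \<otimes>\<^bsub>S\<^esub> (h c \<otimes>\<^bsub>S\<^esub> u \<oplus>\<^bsub>S\<^esub> v) = h (r \<otimes> c) \<otimes>\<^bsub>S\<^esub> u \<oplus>\<^bsub>S\<^esub> h r \<otimes>\<^bsub>S\<^esub> v"
      using * r submodD(1)[OF T *(2)] by (simp add: S.r_distr S.m_assoc)
    then have "h (r \<otimes> c) \<otimes>\<^bsub>S\<^esub> u \<oplus>\<^bsub>S\<^esub> h r \<otimes>\<^bsub>S\<^esub> v \<in> M" using submodD(4)[OF M r *(3)] by simp
    then show "r \<otimes> c \<in> {c \<in> carrier R. \<exists>v\<in>?T. h c \<otimes>\<^bsub>S\<^esub> u \<oplus>\<^bsub>S\<^esub> v \<in> M}"
      using * r submodD(4)[OF T r *(2)] by blast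
  qed auto
  define C where "C = {c \<in> carrier R. \<exists>v\<in>?T. h c \<otimes>\<^bsub>S\<^esub> u \<oplus>\<^bsub>S\<^esub> v \<in> N}"
  obtain G where G: "G \<subseteq> carrier R" "finite G" "C = genideal R G"
    using noetherian_ring.finetely_gen[OF noeth coeffs[OF N]] unfolding C_def by blast
  have "G \<subseteq> C" using R.genideal_self[OF G(1)] G(3) by simp
  then have "\<forall>c\<in>G. \<exists>v. v \<in> ?T \<and> h c \<otimes>\<^bsub>S\<^esub> u \<oplus>\<^bsub>S\<^esub> v \<in> N" unfolding C_def by blast
  then obtain w where w: "\<And>c. c \<in> G \<Longrightarrow> w c \<in> ?T \<and> h c \<otimes>\<^bsub>S\<^esub> u \<oplus>\<^bsub>S\<^esub> w c \<in> N" by metis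
  have NT: "submod (N \<inter> ?T)" using N T by (auto simp: submod_def)
  have "\<exists>F. finite F \<and> F \<subseteq> N \<inter> ?T \<and> (\<forall>N'. submod N' \<and> F \<subseteq> N' \<longrightarrow> N \<inter> ?T \<subseteq> N')"
    by (rule Cons.IH[OF us NT Int_lower2])
  then obtain F' where gen: "finite F' \<and> F' \<subseteq> N \<inter> ?T \<and> (\<forall>N'. submod N' \<and> F' \<subseteq> N' \<longrightarrow> N \<inter> ?T \<subseteq> N')" ..
  then have F': "finite F'" "F' \<subseteq> N \<inter> ?T" by (rule conjunct1, rule conjunct1[OF conjunct2])
  have F'_gen: "N \<inter> ?T \<subseteq> N'" if "submod N'" "F' \<subseteq> N'" for N' using gen that by (elim conjE) simp
  define F where "F = (\<lambda>c. h c \<otimes>\<^bsub>S\<^esub> u \<oplus>\<^bsub>S\<^esub> w c) ` G \<union> F'"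
  have "N \<subseteq> N'" if N': "submod N'" "F \<subseteq> N'" for N'
  proof
    fix n assume n: "n \<in> N"
    obtain c v where cv: "c \<in> carrier R" "v \<in> ?T" "n = h c \<otimes>\<^bsub>S\<^esub> u \<oplus>\<^bsub>S\<^esub> v"
      using n Cons.prems(3) unfolding Span_Cons_iff[symmetric] by (metis Span_Cons_iff subsetD)
    have "submod (N \<inter> N')" using N N'(1) by (auto simp: submod_def)
    note NN' = coeffs[OF this]
    have "h c \<otimes>\<^bsub>S\<^esub> u \<oplus>\<^bsub>S\<^esub> w c \<in> N \<inter> N'" if "c \<in> G" for c
      using w[OF that] N'(2) that unfolding F_def by blast
    then have "G \<subseteq> {c \<in> carrier R. \<exists>v\<in>?T. h c \<otimes>\<^bsub>S\<^esub> u \<oplus>\<^bsub>S\<^esub> v \<in> N \<inter> N'}"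
      using G(1) w by blast
    then have "C \<subseteq> {c \<in> carrier R. \<exists>v\<in>?T. h c \<otimes>\<^bsub>S\<^esub> u \<oplus>\<^bsub>S\<^esub> v \<in> N \<inter> N'}"
      unfolding G(3) by (rule R.genideal_minimal[OF NN'])
    moreover have "c \<in> C" using cv n unfolding C_def by blast
    ultimately obtain v' where v': "v' \<in> ?T" "h c \<otimes>\<^bsub>S\<^esub> u \<oplus>\<^bsub>S\<^esub> v' \<in> N" "h c \<otimes>\<^bsub>S\<^esub> u \<oplus>\<^bsub>S\<^esub> v' \<in> N'" by blast
    define e where "e = h c \<otimes>\<^bsub>S\<^esub> u"
    have [simp]: "v \<in> carrier S" "v' \<in> carrier S" "e \<in> carrier S"
      using cv v' submodD(1)[OF T] by (auto simp: e_def)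
    have diff: "(e \<oplus>\<^bsub>S\<^esub> v) \<ominus>\<^bsub>S\<^esub> (e \<oplus>\<^bsub>S\<^esub> v') = v \<ominus>\<^bsub>S\<^esub> v'"
      using \<open>e \<in> carrier S\<close> \<open>v \<in> carrier S\<close> \<open>v' \<in> carrier S\<close>
      by algebra
    have "v \<ominus>\<^bsub>S\<^esub> v' \<in> N" using submod_diff[OF N n v'(2)] cv(3) diff by (simp add: e_def)
    moreover have "v \<ominus>\<^bsub>S\<^esub> v' \<in> ?T" by (rule submod_diff[OF T cv(2) v'(1)])
    ultimately have "v \<ominus>\<^bsub>S\<^esub> v' \<in> N'" using F'_gen[OF N'(1)] N'(2) by (auto simp: F_def)
    then have "(v \<ominus>\<^bsub>S\<^esub> v') \<oplus>\<^bsub>S\<^esub> (e \<oplus>\<^bsub>S\<^esub> v') \<in> N'"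
      using submodD(3)[OF N'(1)] v'(3) by (simp add: e_def)
    also have "(v \<ominus>\<^bsub>S\<^esub> v') \<oplus>\<^bsub>S\<^esub> (e \<oplus>\<^bsub>S\<^esub> v') = e \<oplus>\<^bsub>S\<^esub> v"
      using \<open>v \<in> carrier S\<close> \<open>v' \<in> carrier S\<close> \<open>e \<in> carrier S\<close>
      by algebra
    finally show "n \<in> N'" using cv(3) by (simp add: e_def)
  qed
  moreover have "finite F" "F \<subseteq> N" using G(2) F' w by (auto simp: F_def)
  ultimately show ?case by blast
qed

lemma finite_subring_noetherian:
  assumes noeth: "noetherian_ring R" and us: "set us \<subseteq> carrier S"
    and B: "subring B S" "h ` carrier R \<subseteq> B" "B \<subseteq> S.Span (h ` carrier R) us"
  shows "noetherian_ring (S\<lparr>carrier := B\<rparr>)"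
proof -
  let ?B = "S\<lparr>carrier := B\<rparr>"
  interpret B: ring ?B by (rule S.subring_is_ring[OF B(1)])
  show ?thesis
  proof (rule B.noetherian_ringI)
    fix I assume "ideal I ?B"
    have sub: "submod M" if "ideal M ?B" for M
    proof -
      interpret M: ideal M ?B by fact
      show ?thesis
        unfolding submod_def
      proof (intro conjI ballI)
        show "M \<subseteq> carrier S" using M.a_subset subringE(1)[OF B(1)] by auto
        show "\<zero>\<^bsub>S\<^esub> \<in> M" using M.zero_closed by simp
        show "x \<oplus>\<^bsub>S\<^esub> y \<in> M" if "x \<in> M" "y \<in> M" for x y using M.a_closed[OF that] by simp
        show "h r \<otimes>\<^bsub>S\<^esub> x \<in> M" if "r \<in> carrier R" "x \<in> M" for r x
          using M.I_l_closed[OF that(2), of "h r"] B(2) that(1) by auto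
      qed
    qed
    interpret I: ideal I ?B by fact
    have "I \<subseteq> S.Span (h ` carrier R) us" using I.a_subset B(3) by auto
    from submod_finitely_generated[OF noeth us sub[OF \<open>ideal I ?B\<close>] this]
    obtain F where gen: "finite F \<and> F \<subseteq> I \<and> (\<forall>N'. submod N' \<and> F \<subseteq> N' \<longrightarrow> I \<subseteq> N')" ..
    then have F: "finite F" "F \<subseteq> I" by (rule conjunct1, rule conjunct1[OF conjunct2])
    have FB: "F \<subseteq> carrier ?B" using F(2) I.a_subset by blast
    have "I \<subseteq> genideal ?B F"
      using gen sub[OF B.genideal_ideal[OF FB]] B.genideal_self[OF FB] by (elim conjE) simp
    moreover have "genideal ?B F \<subseteq> I" by (rule B.genideal_minimal[OF \<open>ideal I ?B\<close> F(2)])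
    ultimately show "\<exists>A\<subseteq>carrier ?B. finite A \<and> I = genideal ?B A" using F(1) FB by blast
  qed
qed

end

section \<open>Extension of ideals and of their endomorphisms\<close>

context localization_map
begin

text \<open>
  The ideal of \<open>L\<close> generated by the image of \<open>J\<close>: its elements have the form \<open>h j / h s\<close>.
\<close>

definition extension :: "'a set \<Rightarrow> 'c set"
  where "extension J = {x \<in> carrier L. \<exists>s\<in>S. \<exists>j\<in>J. h s \<otimes>\<^bsub>L\<^esub> x = h j}"

lemma extensionE:
  assumes "x \<in> extension J"
  obtains s j where "x \<in> carrier L" and "s \<in> S" and "j \<in> J" and "h s \<otimes>\<^bsub>L\<^esub> x = h j"
  using assms unfolding extension_def by blast

lemma extension_hom:
  assumes "ideal J R" and "j \<in> J"
  shows "h j \<in> extension J"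
proof -
  have "j \<in> carrier R" by (rule R.ideal_mem[OF assms])
  then have "h j \<in> carrier L" "h \<one> \<otimes>\<^bsub>L\<^esub> h j = h j" by simp_all
  then show ?thesis unfolding extension_def using assms(2) dens(2) by blast
qed

lemma extension_ideal:
  assumes J: "ideal J R"
  shows "ideal (extension J) L"
proof (rule S.cring_idealI)
  show "extension J \<subseteq> carrier L" by (auto simp: extension_def)
  show "\<zero>\<^bsub>L\<^esub> \<in> extension J" using extension_hom[OF J R.ideal_zero[OF J]] by simp
next
  fix x y assume "x \<in> extension J" "y \<in> extension J"
  then obtain s j t k where *: "x \<in> carrier L" "s \<in> S" "j \<in> J" "h s \<otimes>\<^bsub>L\<^esub> x = h j"
    "y \<in> carrier L" "t \<in> S" "k \<in> J" "h t \<otimes>\<^bsub>L\<^esub> y = h k" by (metis extensionE)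
  note [simp] = *(1,5) den_carrier[OF *(2)] den_carrier[OF *(6)] R.ideal_mem[OF J *(3)] R.ideal_mem[OF J *(7)]
  have "h (s \<otimes> t) \<otimes>\<^bsub>L\<^esub> (x \<oplus>\<^bsub>L\<^esub> y) = h t \<otimes>\<^bsub>L\<^esub> (h s \<otimes>\<^bsub>L\<^esub> x) \<oplus>\<^bsub>L\<^esub> h s \<otimes>\<^bsub>L\<^esub> (h t \<otimes>\<^bsub>L\<^esub> y)"
    by (simp add: S.r_distr S.m_ac)
  also have "\<dots> = h (t \<otimes> j \<oplus> s \<otimes> k)" unfolding *(4,8) by simp
  finally have eq: "h (s \<otimes> t) \<otimes>\<^bsub>L\<^esub> (x \<oplus>\<^bsub>L\<^esub> y) = h (t \<otimes> j \<oplus> s \<otimes> k)" .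
  have "t \<otimes> j \<oplus> s \<otimes> k \<in> J"
    using R.ideal_add[OF J R.ideal_lmult[OF J _ *(3)] R.ideal_lmult[OF J _ *(7)]] by simp
  moreover have "x \<oplus>\<^bsub>L\<^esub> y \<in> carrier L" by simp
  ultimately show "x \<oplus>\<^bsub>L\<^esub> y \<in> extension J"
    unfolding extension_def using eq dens(3)[OF *(2,6)] by blast
next
  fix r x assume r: "r \<in> carrier L" and "x \<in> extension J"
  then obtain s j where *: "x \<in> carrier L" "s \<in> S" "j \<in> J" "h s \<otimes>\<^bsub>L\<^esub> x = h j"
    by (metis extensionE)
  obtain c u where c: "c \<in> carrier R" "u \<in> S" "h u \<otimes>\<^bsub>L\<^esub> r = h c" using numerator[OF r] by blast
  note [simp] = r *(1) c(1) den_carrier[OF *(2)] den_carrier[OF c(2)] R.ideal_mem[OF J *(3)]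
  have "h (u \<otimes> s) \<otimes>\<^bsub>L\<^esub> (r \<otimes>\<^bsub>L\<^esub> x) = (h u \<otimes>\<^bsub>L\<^esub> r) \<otimes>\<^bsub>L\<^esub> (h s \<otimes>\<^bsub>L\<^esub> x)"
    by (simp add: S.m_ac)
  also have "\<dots> = h (c \<otimes> j)" unfolding *(4) c(3) by simp
  finally have eq: "h (u \<otimes> s) \<otimes>\<^bsub>L\<^esub> (r \<otimes>\<^bsub>L\<^esub> x) = h (c \<otimes> j)" .
  moreover have "r \<otimes>\<^bsub>L\<^esub> x \<in> carrier L" by simp
  ultimately show "r \<otimes>\<^bsub>L\<^esub> x \<in> extension J"
    unfolding extension_def using dens(3)[OF c(2) *(2)] R.ideal_lmult[OF J c(1) *(3)] by blast
qed

lemma extension_radical: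
  assumes J: "ideal J R" and rad: "\<And>a n. a \<in> carrier R \<Longrightarrow> a [^] (n::nat) \<in> J \<Longrightarrow> a \<in> J"
    and x: "x \<in> carrier L" "x [^]\<^bsub>L\<^esub> (n::nat) \<in> extension J"
  shows "x \<in> extension J"
proof -
  obtain a t where a: "a \<in> carrier R" "t \<in> S" "h t \<otimes>\<^bsub>L\<^esub> x = h a" using numerator[OF x(1)] by blast
  obtain s j where j: "s \<in> S" "j \<in> J" "h s \<otimes>\<^bsub>L\<^esub> x [^]\<^bsub>L\<^esub> n = h j" using x(2) by (metis extensionE)
  note [simp] = x(1) a(1) den_carrier[OF a(2)] den_carrier[OF j(1)] R.ideal_mem[OF J j(2)]
  have "h (s \<otimes> a [^] n) = h s \<otimes>\<^bsub>L\<^esub> (h t \<otimes>\<^bsub>L\<^esub> x) [^]\<^bsub>L\<^esub> n" unfolding a(3) by simp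
  also have "\<dots> = h t [^]\<^bsub>L\<^esub> n \<otimes>\<^bsub>L\<^esub> (h s \<otimes>\<^bsub>L\<^esub> x [^]\<^bsub>L\<^esub> n)"
    by (subst S.nat_pow_distrib) (simp_all add: S.m_ac)
  also have "\<dots> = h (t [^] n \<otimes> j)" unfolding j(3) by simp
  finally have "h (s \<otimes> a [^] n) = h (t [^] n \<otimes> j)" .
  then obtain u where u: "u \<in> S" "u \<otimes> (s \<otimes> a [^] n) = u \<otimes> (t [^] n \<otimes> j)"
    using hom_eqD[of "s \<otimes> a [^] n" "t [^] n \<otimes> j"] by auto
  note [simp] = den_carrier[OF u(1)]
  define e where "e = u \<otimes> s"
  have e: "e \<in> S" "e \<in> carrier R" using dens(3) u j by (auto simp: e_def)
  have "e \<otimes> a [^] n = u \<otimes> (t [^] n \<otimes> j)" using u(2) by (simp add: e_def R.m_assoc)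
  also have "\<dots> \<in> J" using R.ideal_lmult[OF J _ R.ideal_lmult[OF J _ j(2)]] by simp
  finally have "(e [^] n \<otimes> a) \<otimes> (e \<otimes> a [^] n) \<in> J" using R.ideal_lmult[OF J] e by simp
  also have "(e [^] n \<otimes> a) \<otimes> (e \<otimes> a [^] n) = (e \<otimes> a) [^] Suc n"
    using e by (subst R.nat_pow_distrib) (simp_all add: R.m_ac)
  finally have pow: "(e \<otimes> a) [^] Suc n \<in> J" .
  have "e \<otimes> a \<in> J" by (rule rad[OF _ pow]) (simp add: e)
  moreover have "h (e \<otimes> t) \<otimes>\<^bsub>L\<^esub> x = h (e \<otimes> a)"
    using e a(3) by (simp add: S.m_assoc)
  ultimately show ?thesis
    unfolding extension_def using dens(3)[OF e(1) a(2)] x(1) by blast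
qed

lemma extension_subset_prime:
  assumes q: "primeideal q L" and J: "\<And>j. j \<in> J \<Longrightarrow> h j \<in> q"
  shows "extension J \<subseteq> q"
proof
  fix x assume "x \<in> extension J"
  then obtain s j where *: "x \<in> carrier L" "s \<in> S" "j \<in> J" "h s \<otimes>\<^bsub>L\<^esub> x = h j"
    by (metis extensionE)
  then show "x \<in> q" using den_cancel_ideal[OF S.prime_ideal[OF q] *(2,1)] J by simp
qed

text \<open>
  For finitely generated \<open>J\<close>, the endomorphisms of \<open>J L\<close> are localized endomorphisms of \<open>J\<close>. Multiplying
  \<open>\<alpha>\<close> and \<open>\<beta>\<close> by elements of \<open>S\<close>, one may take them to be images of \<open>a\<close> and \<open>b\<close> in \<open>R\<close>. Multiplication by \<open>a/b\<close>
  sends each \<open>j \<in> J\<close> to an element of \<open>J\<close> up to a denominator, and since \<open>R\<close> is Noetherian one \<open>s \<in> S\<close>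
  serves all \<open>j\<close>. The image of \<open>j\<close> in \<open>J\<close> is unique only up to \<open>S\<close>-torsion, which for the same reason is
  annihilated by a single \<open>t \<in> S\<close>. So \<open>j \<mapsto> t s (a/b) j\<close> is an endomorphism of \<open>J\<close>, that is,
  multiplication by some \<open>c \<in> R\<close>. Its value at the nonzerodivisor \<open>g\<close> gives \<open>t s a = b c\<close>.
\<close>

lemma endomorphisms_extend:
  assumes noeth: "noetherian_ring R" and J: "ideal J R"
    and surj: "\<And>f. f \<in> carrier (End_ring R J) \<Longrightarrow> \<exists>c\<in>carrier R. f = mult_map R J c"
    and g: "g \<in> J" "g \<in> nonzerodivisors R"
    and \<alpha> [simp]: "\<alpha> \<in> carrier L" and \<beta>: "\<beta> \<in> nonzerodivisors L"
    and maps: "\<And>x. x \<in> extension J \<Longrightarrow> \<exists>y\<in>extension J. \<alpha> \<otimes>\<^bsub>L\<^esub> x = \<beta> \<otimes>\<^bsub>L\<^esub> y"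
  shows "\<exists>r\<in>carrier L. \<alpha> = \<beta> \<otimes>\<^bsub>L\<^esub> r"
proof -
  interpret N: noetherian_cring R
    using noeth R.is_cring by (intro noetherian_cring.intro)
  have \<beta>c [simp]: "\<beta> \<in> carrier L" by (rule S.nonzerodivisorD(1)[OF \<beta>])
  obtain a s1 where a: "a \<in> carrier R" "s1 \<in> S" "h s1 \<otimes>\<^bsub>L\<^esub> \<alpha> = h a" using numerator[OF \<alpha>] by blast
  obtain b s2 where b: "b \<in> carrier R" "s2 \<in> S" "h s2 \<otimes>\<^bsub>L\<^esub> \<beta> = h b" using numerator[OF \<beta>c] by blast
  note Jc = R.ideal_mem[OF J]
  note [simp] = a(1) b(1) den_carrier[OF a(2)] den_carrier[OF b(2)] Jc[OF g(1)]
  have clear: "\<exists>s\<in>S. \<exists>j'\<in>J. (s \<otimes> a) \<otimes> j = b \<otimes> j'" if j: "j \<in> J" for j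
  proof -
    obtain y where y: "y \<in> extension J" "\<alpha> \<otimes>\<^bsub>L\<^esub> h j = \<beta> \<otimes>\<^bsub>L\<^esub> y"
      using maps[OF extension_hom[OF J j]] by blast
    obtain s3 k where k: "y \<in> carrier L" "s3 \<in> S" "k \<in> J" "h s3 \<otimes>\<^bsub>L\<^esub> y = h k"
      using y(1) by (rule extensionE)
    note [simp] = Jc[OF j] k(1) den_carrier[OF k(2)] Jc[OF k(3)]
    have "h ((s2 \<otimes> s3) \<otimes> (a \<otimes> j)) = h (s2 \<otimes> s3) \<otimes>\<^bsub>L\<^esub> ((h s1 \<otimes>\<^bsub>L\<^esub> \<alpha>) \<otimes>\<^bsub>L\<^esub> h j)"
      unfolding a(3) by simp
    also have "\<dots> = h s1 \<otimes>\<^bsub>L\<^esub> h s2 \<otimes>\<^bsub>L\<^esub> h s3 \<otimes>\<^bsub>L\<^esub> (\<alpha> \<otimes>\<^bsub>L\<^esub> h j)" by (simp add: S.m_ac)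
    also have "\<dots> = h s1 \<otimes>\<^bsub>L\<^esub> (h s2 \<otimes>\<^bsub>L\<^esub> \<beta>) \<otimes>\<^bsub>L\<^esub> (h s3 \<otimes>\<^bsub>L\<^esub> y)"
      unfolding y(2) by (simp add: S.m_ac)
    also have "\<dots> = h (s1 \<otimes> b \<otimes> k)" unfolding b(3) k(4) by simp
    finally have "h ((s2 \<otimes> s3) \<otimes> (a \<otimes> j)) = h (s1 \<otimes> b \<otimes> k)" .
    then obtain u where u: "u \<in> S" "u \<otimes> ((s2 \<otimes> s3) \<otimes> (a \<otimes> j)) = u \<otimes> (s1 \<otimes> b \<otimes> k)"
      using hom_eqD[of "(s2 \<otimes> s3) \<otimes> (a \<otimes> j)" "s1 \<otimes> b \<otimes> k"] by auto
    note [simp] = den_carrier[OF u(1)]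
    have "(u \<otimes> (s2 \<otimes> s3) \<otimes> a) \<otimes> j = u \<otimes> ((s2 \<otimes> s3) \<otimes> (a \<otimes> j))" by (simp add: R.m_assoc)
    also have "\<dots> = b \<otimes> (u \<otimes> s1 \<otimes> k)" unfolding u(2) by (simp add: R.m_ac)
    finally have "(u \<otimes> (s2 \<otimes> s3) \<otimes> a) \<otimes> j = b \<otimes> (u \<otimes> s1 \<otimes> k)" .
    moreover have "u \<otimes> (s2 \<otimes> s3) \<in> S" using dens(3) u b k by simp
    moreover have "u \<otimes> s1 \<otimes> k \<in> J" using R.ideal_lmult[OF J _ k(3)] by simp
    ultimately show ?thesis by blast
  qed
  define B where "B s = {j \<in> J. \<exists>j'\<in>J. (s \<otimes> a) \<otimes> j = b \<otimes> j'}" for s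
  have Bid: "ideal (B s) R" if s: "s \<in> S" for s
  proof (rule R.cring_idealI)
    note [simp] = den_carrier[OF s]
    show "B s \<subseteq> carrier R" using Jc by (auto simp: B_def)
    show "\<zero> \<in> B s" using R.ideal_zero[OF J] unfolding B_def by force
    fix x y assume "x \<in> B s" "y \<in> B s"
    then obtain x' y' where *: "x \<in> J" "x' \<in> J" "(s \<otimes> a) \<otimes> x = b \<otimes> x'"
      "y \<in> J" "y' \<in> J" "(s \<otimes> a) \<otimes> y = b \<otimes> y'" by (auto simp: B_def)
    note [simp] = Jc[OF *(1)] Jc[OF *(2)] Jc[OF *(4)] Jc[OF *(5)]
    have "(s \<otimes> a) \<otimes> (x \<oplus> y) = b \<otimes> (x' \<oplus> y')" using *(3,6) by (simp add: R.r_distr)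
    then show "x \<oplus> y \<in> B s" using * R.ideal_add[OF J] unfolding B_def by blast
  next
    note [simp] = den_carrier[OF s]
    fix r x assume r [simp]: "r \<in> carrier R" and "x \<in> B s"
    then obtain x' where *: "x \<in> J" "x' \<in> J" "(s \<otimes> a) \<otimes> x = b \<otimes> x'" by (auto simp: B_def)
    note [simp] = Jc[OF *(1)] Jc[OF *(2)]
    have "(s \<otimes> a) \<otimes> (r \<otimes> x) = r \<otimes> ((s \<otimes> a) \<otimes> x)" by (rule R.m_lcomm) simp_all
    also have "\<dots> = b \<otimes> (r \<otimes> x')" unfolding *(3) by (rule R.m_lcomm) simp_all
    finally show "r \<otimes> x \<in> B s" using * R.ideal_lmult[OF J r] unfolding B_def by blast
  qed
  have "B \<one> \<in> B ` S" "\<And>I. I \<in> B ` S \<Longrightarrow> ideal I R" using dens(2) Bid by auto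
  then obtain M where M: "M \<in> B ` S" "\<And>I. I \<in> B ` S \<Longrightarrow> M \<subseteq> I \<Longrightarrow> I = M"
    using N.exists_maximal_ideal by metis
  then obtain s where s: "s \<in> S" "M = B s" by blast
  note [simp] = den_carrier[OF s(1)]
  have common: "\<exists>j'\<in>J. (s \<otimes> a) \<otimes> j = b \<otimes> j'" if j: "j \<in> J" for j
  proof -
    obtain v k where v: "v \<in> S" "k \<in> J" "(v \<otimes> a) \<otimes> j = b \<otimes> k" using clear[OF j] by blast
    note [simp] = den_carrier[OF v(1)] Jc[OF v(2)] Jc[OF j]
    have "B s \<subseteq> B (s \<otimes> v)"
    proof
      fix x assume "x \<in> B s"
      then obtain x' where x': "x \<in> J" "x' \<in> J" "(s \<otimes> a) \<otimes> x = b \<otimes> x'" by (auto simp: B_def)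
      note [simp] = Jc[OF x'(1)] Jc[OF x'(2)]
      have "(s \<otimes> v \<otimes> a) \<otimes> x = v \<otimes> ((s \<otimes> a) \<otimes> x)" by (simp add: R.m_ac)
      also have "\<dots> = b \<otimes> (v \<otimes> x')" unfolding x'(3) by (rule R.m_lcomm) simp_all
      finally show "x \<in> B (s \<otimes> v)"
        using x' R.ideal_lmult[OF J _ x'(2), of v] unfolding B_def by auto
    qed
    then have "B (s \<otimes> v) = B s" using M(2)[of "B (s \<otimes> v)"] dens(3)[OF s(1) v(1)] s(2) by blast
    moreover have "(s \<otimes> v \<otimes> a) \<otimes> j = s \<otimes> ((v \<otimes> a) \<otimes> j)" by (simp add: R.m_ac)
    then have "(s \<otimes> v \<otimes> a) \<otimes> j = b \<otimes> (s \<otimes> k)"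
      unfolding v(3) by (simp add: R.m_lcomm)
    then have "j \<in> B (s \<otimes> v)"
      using j R.ideal_lmult[OF J _ v(2), of s] unfolding B_def by auto
    ultimately have "j \<in> B s" by simp
    then show ?thesis by (simp add: B_def)
  qed
  define T where "T u = {y \<in> carrier R. y \<otimes> u = \<zero>}" for u
  have "T u = R.colon {\<zero>} u" for u by (simp add: T_def R.colon_def)
  then have "\<And>I. I \<in> T ` S \<Longrightarrow> ideal I R" using R.colon_ideal[OF R.zeroideal] den_carrier by auto
  moreover have "T \<one> \<in> T ` S" using dens(2) by simp
  ultimately obtain M' where M': "M' \<in> T ` S" "\<And>I. I \<in> T ` S \<Longrightarrow> M' \<subseteq> I \<Longrightarrow> I = M'"
    using N.exists_maximal_ideal by metis
  then obtain t where t: "t \<in> S" "M' = T t" by blast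
  note [simp] = den_carrier[OF t(1)]
  have torsion: "t \<otimes> y = \<zero>" if y: "y \<in> carrier R" "h y = \<zero>\<^bsub>L\<^esub>" for y
  proof -
    obtain u where u: "u \<in> S" "u \<otimes> y = \<zero>" using kernel[OF y] by blast
    note [simp] = den_carrier[OF u(1)] y(1)
    have "T t \<subseteq> T (t \<otimes> u)" by (auto simp: T_def R.m_assoc[symmetric])
    then have "T (t \<otimes> u) = T t" using M'(2)[of "T (t \<otimes> u)"] dens(3)[OF t(1) u(1)] t(2) by blast
    moreover have "y \<otimes> (t \<otimes> u) = t \<otimes> (u \<otimes> y)" by (simp add: R.m_ac)
    then have "y \<in> T (t \<otimes> u)" using u(2) by (simp add: T_def)
    ultimately have "y \<in> T t" by simp
    then show ?thesis by (simp add: T_def R.m_comm)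
  qed
  have unique: "t \<otimes> x = t \<otimes> y" if xy: "x \<in> J" "y \<in> J" "b \<otimes> x = b \<otimes> y" for x y
  proof -
    note [simp] = Jc[OF xy(1)] Jc[OF xy(2)]
    have "h s2 \<otimes>\<^bsub>L\<^esub> (\<beta> \<otimes>\<^bsub>L\<^esub> h x) = (h s2 \<otimes>\<^bsub>L\<^esub> \<beta>) \<otimes>\<^bsub>L\<^esub> h x" by (simp add: S.m_assoc)
    also have "\<dots> = h (b \<otimes> x)" unfolding b(3) by simp
    also have "\<dots> = (h s2 \<otimes>\<^bsub>L\<^esub> \<beta>) \<otimes>\<^bsub>L\<^esub> h y" unfolding b(3) xy(3) by simp
    also have "\<dots> = h s2 \<otimes>\<^bsub>L\<^esub> (\<beta> \<otimes>\<^bsub>L\<^esub> h y)" by (simp add: S.m_assoc)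
    finally have "h s2 \<otimes>\<^bsub>L\<^esub> (\<beta> \<otimes>\<^bsub>L\<^esub> h x) = h s2 \<otimes>\<^bsub>L\<^esub> (\<beta> \<otimes>\<^bsub>L\<^esub> h y)" .
    from den_cancel[OF b(2) _ _ this] have "\<beta> \<otimes>\<^bsub>L\<^esub> h x = \<beta> \<otimes>\<^bsub>L\<^esub> h y" by simp
    from S.nonzerodivisor_cancel[OF \<beta> _ _ this] have "h x = h y" by simp
    then have "h (x \<ominus> y) = \<zero>\<^bsub>L\<^esub>" by (simp add: S.r_neg R.minus_eq)
    then have "t \<otimes> (x \<ominus> y) = \<zero>" using torsion[of "x \<ominus> y"] by simp
    moreover have "t \<otimes> x \<ominus> t \<otimes> y = t \<otimes> (x \<ominus> y)"
      using \<open>t \<in> carrier R\<close> \<open>x \<in> carrier R\<close> \<open>y \<in> carrier R\<close>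
      by algebra
    ultimately have "t \<otimes> x \<ominus> t \<otimes> y = \<zero>" by simp
    then show ?thesis by (rule R.ring_eqI) simp_all
  qed
  from common have "\<forall>j\<in>J. \<exists>j'. j' \<in> J \<and> (s \<otimes> a) \<otimes> j = b \<otimes> j'" by blast
  then obtain w where w: "\<And>j. j \<in> J \<Longrightarrow> w j \<in> J" "\<And>j. j \<in> J \<Longrightarrow> (s \<otimes> a) \<otimes> j = b \<otimes> w j" by metis
  define f where "f = (\<lambda>j\<in>J. t \<otimes> w j)"
  have "f \<in> carrier (End_ring R J)"
  proof -
    have "f \<in> J \<rightarrow>\<^sub>E J" using w(1) R.ideal_lmult[OF J] by (auto simp: f_def)
    moreover have "f (x \<oplus> y) = f x \<oplus> f y" if xy: "x \<in> J" "y \<in> J" for x y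
    proof -
      note [simp] = Jc[OF xy(1)] Jc[OF xy(2)] Jc[OF w(1)[OF xy(1)]] Jc[OF w(1)[OF xy(2)]]
      have xyJ: "x \<oplus> y \<in> J" by (rule R.ideal_add[OF J xy])
      have "b \<otimes> w (x \<oplus> y) = b \<otimes> (w x \<oplus> w y)"
        using w(2)[OF xyJ] w(2)[OF xy(1)] w(2)[OF xy(2)] by (simp add: R.r_distr)
      then have "t \<otimes> w (x \<oplus> y) = t \<otimes> (w x \<oplus> w y)"
        by (intro unique w(1)[OF xyJ] R.ideal_add[OF J w(1)[OF xy(1)] w(1)[OF xy(2)]])
      then show ?thesis using xy xyJ by (simp add: f_def R.r_distr)
    qed
    moreover have "f (r \<otimes> x) = r \<otimes> f x" if rx: "r \<in> carrier R" "x \<in> J" for r x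
    proof -
      note [simp] = rx(1) Jc[OF rx(2)] Jc[OF w(1)[OF rx(2)]]
      have rxJ: "r \<otimes> x \<in> J" by (rule R.ideal_lmult[OF J rx])
      have "b \<otimes> w (r \<otimes> x) = r \<otimes> ((s \<otimes> a) \<otimes> x)"
        using w(2)[OF rxJ] by (simp add: R.m_ac)
      also have "\<dots> = b \<otimes> (r \<otimes> w x)" unfolding w(2)[OF rx(2)] by (rule R.m_lcomm) simp_all
      finally have "t \<otimes> w (r \<otimes> x) = t \<otimes> (r \<otimes> w x)"
        by (intro unique w(1)[OF rxJ] R.ideal_lmult[OF J rx(1) w(1)[OF rx(2)]])
      then show ?thesis using rx rxJ by (simp add: f_def R.m_lcomm)
    qed
    ultimately show ?thesis by (simp add: End_ring_def)
  qed
  then obtain c where c [simp]: "c \<in> carrier R" and fc: "f = mult_map R J c" using surj by blast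
  have "f g = c \<otimes> g" unfolding fc mult_map_def using g by simp
  then have tg: "t \<otimes> w g = c \<otimes> g" using g by (simp add: f_def)
  note [simp] = Jc[OF w(1)[OF g(1)]]
  have "g \<otimes> (t \<otimes> s \<otimes> a) = t \<otimes> ((s \<otimes> a) \<otimes> g)" by (simp add: R.m_ac)
  also have "\<dots> = b \<otimes> (t \<otimes> w g)" unfolding w(2)[OF g(1)] by (rule R.m_lcomm) simp_all
  also have "\<dots> = g \<otimes> (b \<otimes> c)" unfolding tg by (simp add: R.m_ac)
  finally have "g \<otimes> (t \<otimes> s \<otimes> a) = g \<otimes> (b \<otimes> c)" .
  from R.nonzerodivisor_cancel[OF g(2) _ _ this] have "t \<otimes> s \<otimes> a = b \<otimes> c" by simp
  then have "h (t \<otimes> s \<otimes> a) = h (b \<otimes> c)" by (rule arg_cong)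
  then have eq: "h (t \<otimes> s) \<otimes>\<^bsub>L\<^esub> h a = h b \<otimes>\<^bsub>L\<^esub> h c" by simp
  define d where "d = t \<otimes> s \<otimes> s1"
  have d: "d \<in> S" "d \<in> carrier R" using dens(3) t s a den_carrier by (auto simp: d_def)
  have u: "h d \<in> Units L" by (rule den_unit[OF d(1)])
  define r where "r = inv\<^bsub>L\<^esub> h d \<otimes>\<^bsub>L\<^esub> (h s2 \<otimes>\<^bsub>L\<^esub> h c)"
  have ic: "inv\<^bsub>L\<^esub> h d \<in> carrier L" using u by simp
  have rc: "r \<in> carrier L" using ic by (simp add: r_def)
  have "h d \<otimes>\<^bsub>L\<^esub> \<alpha> = h (t \<otimes> s) \<otimes>\<^bsub>L\<^esub> (h s1 \<otimes>\<^bsub>L\<^esub> \<alpha>)" by (simp add: d_def S.m_assoc)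
  also have "\<dots> = (h s2 \<otimes>\<^bsub>L\<^esub> \<beta>) \<otimes>\<^bsub>L\<^esub> h c" unfolding a(3) b(3) by (rule eq)
  also have "\<dots> = \<beta> \<otimes>\<^bsub>L\<^esub> (h s2 \<otimes>\<^bsub>L\<^esub> h c)" by (simp add: S.m_ac)
  also have "h s2 \<otimes>\<^bsub>L\<^esub> h c = h d \<otimes>\<^bsub>L\<^esub> r"
    using u ic d(2) by (simp add: r_def S.m_assoc[symmetric])
  also have "\<beta> \<otimes>\<^bsub>L\<^esub> (h d \<otimes>\<^bsub>L\<^esub> r) = h d \<otimes>\<^bsub>L\<^esub> (\<beta> \<otimes>\<^bsub>L\<^esub> r)"
    using rc d(2) by (intro S.m_lcomm) simp_all
  finally have "h d \<otimes>\<^bsub>L\<^esub> \<alpha> = h d \<otimes>\<^bsub>L\<^esub> (\<beta> \<otimes>\<^bsub>L\<^esub> r)" .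
  from den_cancel[OF d(1) _ _ this] have "\<alpha> = \<beta> \<otimes>\<^bsub>L\<^esub> r" using rc by simp
  then show ?thesis using rc by blast
qed

end

section \<open>Integral fractions at a regular prime\<close>

context cring
begin

text \<open>
  Over the localization at \<open>p\<close> the relation becomes an equation of integral dependence, since \<open>s\<close> turns
  into a unit. That localization is a normal domain, so it contains \<open>a/b\<close>.
\<close>

lemma regular_prime_integral:
  assumes p: "primeideal p R" and reg: "regular_local_ring (localization R (carrier R - p))"
    and [simp]: "a \<in> carrier R" "b \<in> carrier R" and s: "s \<in> carrier R - p"
    and g: "g \<in> forms a b n" and rel: "s \<otimes> a [^] Suc n = b \<otimes> g"
    and b: "\<And>v. v \<in> carrier R - p \<Longrightarrow> v \<otimes> b \<noteq> \<zero>"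
  shows "\<exists>v\<in>carrier R - p. \<exists>c\<in>carrier R. v \<otimes> a = b \<otimes> c"
proof -
  let ?L = "localization R (carrier R - p)"
  define \<phi> where "\<phi> = (\<lambda>a. fraction R (carrier R - p) a \<one>)"
  interpret L: localization_map R ?L \<phi> "carrier R - p"
    unfolding \<phi>_def by (rule prime_localization_map[OF p])
  interpret N: noetherian_cring ?L
    using reg L.S.is_cring by (intro noetherian_cring.intro) (auto simp: regular_local_ring_def)
  have [simp]: "s \<in> carrier R" "g \<in> carrier R" using s forms_mem[OF _ _ g] by auto
  have gL: "\<phi> g \<in> L.S.forms (\<phi> a) (\<phi> b) n" by (rule L.forms_hom[OF _ _ g]) simp_all
  have u: "\<phi> s \<in> Units ?L" by (rule L.den_unit[OF s])
  have ic: "inv\<^bsub>?L\<^esub> \<phi> s \<in> carrier ?L" using u by simp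
  have id: "ideal (L.S.forms (\<phi> a) (\<phi> b) n) ?L" by (rule L.S.forms_ideal) simp_all
  have "\<phi> (s \<otimes> a [^] Suc n) = \<phi> (b \<otimes> g)" unfolding rel ..
  then have "\<phi> s \<otimes>\<^bsub>?L\<^esub> \<phi> a [^]\<^bsub>?L\<^esub> Suc n = \<phi> b \<otimes>\<^bsub>?L\<^esub> \<phi> g" by simp
  also have "\<dots> = \<phi> s \<otimes>\<^bsub>?L\<^esub> (\<phi> b \<otimes>\<^bsub>?L\<^esub> (inv\<^bsub>?L\<^esub> \<phi> s \<otimes>\<^bsub>?L\<^esub> \<phi> g))"
  proof -
    have "\<phi> s \<otimes>\<^bsub>?L\<^esub> (\<phi> b \<otimes>\<^bsub>?L\<^esub> (inv\<^bsub>?L\<^esub> \<phi> s \<otimes>\<^bsub>?L\<^esub> \<phi> g))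
        = \<phi> b \<otimes>\<^bsub>?L\<^esub> ((\<phi> s \<otimes>\<^bsub>?L\<^esub> inv\<^bsub>?L\<^esub> \<phi> s) \<otimes>\<^bsub>?L\<^esub> \<phi> g)"
      using ic by (simp add: L.S.m_ac)
    then show ?thesis using u by simp
  qed
  finally have "\<phi> s \<otimes>\<^bsub>?L\<^esub> \<phi> a [^]\<^bsub>?L\<^esub> Suc n
      = \<phi> s \<otimes>\<^bsub>?L\<^esub> (\<phi> b \<otimes>\<^bsub>?L\<^esub> (inv\<^bsub>?L\<^esub> \<phi> s \<otimes>\<^bsub>?L\<^esub> \<phi> g))" .
  from L.den_cancel[OF s _ _ this]
  have "\<phi> a [^]\<^bsub>?L\<^esub> Suc n = \<phi> b \<otimes>\<^bsub>?L\<^esub> (inv\<^bsub>?L\<^esub> \<phi> s \<otimes>\<^bsub>?L\<^esub> \<phi> g)"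
    using ic by simp
  then have int: "L.S.integral_fraction (\<phi> a) (\<phi> b)"
    unfolding L.S.integral_fraction_def using L.S.ideal_lmult[OF id ic gL] by blast
  have "\<phi> b \<noteq> \<zero>\<^bsub>?L\<^esub>" using L.kernel[of b] b by auto
  then obtain r where r: "r \<in> carrier ?L" "\<phi> a = \<phi> b \<otimes>\<^bsub>?L\<^esub> r"
    using L.S.normal_mod_zero_integral[OF N.regular_local_normal[OF reg] _ _ _ int] by auto
  obtain c v where c: "c \<in> carrier R" "v \<in> carrier R - p" "\<phi> v \<otimes>\<^bsub>?L\<^esub> r = \<phi> c"
    using L.numerator[OF r(1)] by blast
  have [simp]: "v \<in> carrier R" "c \<in> carrier R" using c by auto
  have "\<phi> (v \<otimes> a) = \<phi> b \<otimes>\<^bsub>?L\<^esub> (\<phi> v \<otimes>\<^bsub>?L\<^esub> r)" using r by (simp add: L.S.m_ac)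
  also have "\<dots> = \<phi> (b \<otimes> c)" unfolding c(3) by simp
  finally have "\<phi> (v \<otimes> a) = \<phi> (b \<otimes> c)" .
  then obtain w where w: "w \<in> carrier R - p" "w \<otimes> (v \<otimes> a) = w \<otimes> (b \<otimes> c)"
    using L.hom_eqD[of "v \<otimes> a" "b \<otimes> c"] by auto
  have [simp]: "w \<in> carrier R" using w by auto
  have "(w \<otimes> v) \<otimes> a = b \<otimes> (w \<otimes> c)"
    using w(2) by (simp add: m_assoc m_lcomm)
  moreover have "w \<otimes> c \<in> carrier R" by simp
  ultimately show ?thesis using prime_compl[OF p w(1) c(2)] by (intro bexI)
qed

end

context ring_hom_cring
begin

lemma forms_descend:
  assumes p: "primeideal p R"
    and num: "\<And>x. x \<in> carrier S \<Longrightarrow> \<exists>u\<in>carrier R - p. \<exists>c\<in>carrier R. h u \<otimes>\<^bsub>S\<^esub> x = h c"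
    and [simp]: "a \<in> carrier R" "b \<in> carrier R" and "g \<in> S.forms (h a) (h b) n"
  shows "\<exists>u\<in>carrier R - p. \<exists>g'\<in>R.forms a b n. h u \<otimes>\<^bsub>S\<^esub> g = h g'"
  using assms(5)
proof (induction n arbitrary: g)
  case 0
  then show ?case using num by simp
next
  case (Suc n)
  then obtain g1 g2 where g: "g1 \<in> S.forms (h a) (h b) n" "g2 \<in> S.forms (h a) (h b) n"
    "g = h a \<otimes>\<^bsub>S\<^esub> g1 \<oplus>\<^bsub>S\<^esub> h b \<otimes>\<^bsub>S\<^esub> g2" by (auto elim!: S.forms_SucE)
  obtain u1 k1 where 1: "u1 \<in> carrier R - p" "k1 \<in> R.forms a b n" "h u1 \<otimes>\<^bsub>S\<^esub> g1 = h k1"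
    using Suc.IH[OF g(1)] by blast
  obtain u2 k2 where 2: "u2 \<in> carrier R - p" "k2 \<in> R.forms a b n" "h u2 \<otimes>\<^bsub>S\<^esub> g2 = h k2"
    using Suc.IH[OF g(2)] by blast
  have [simp]: "u1 \<in> carrier R" "u2 \<in> carrier R" "k1 \<in> carrier R" "k2 \<in> carrier R"
    "g1 \<in> carrier S" "g2 \<in> carrier S"
    using 1 2 R.forms_mem[OF assms(3,4)] S.forms_mem[OF hom_closed[OF assms(3)] hom_closed[OF assms(4)]] g
    by auto
  have "h (u1 \<otimes> u2) \<otimes>\<^bsub>S\<^esub> g =
      h a \<otimes>\<^bsub>S\<^esub> (h u2 \<otimes>\<^bsub>S\<^esub> (h u1 \<otimes>\<^bsub>S\<^esub> g1)) \<oplus>\<^bsub>S\<^esub> h b \<otimes>\<^bsub>S\<^esub> (h u1 \<otimes>\<^bsub>S\<^esub> (h u2 \<otimes>\<^bsub>S\<^esub> g2))"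
    unfolding g(3) by (simp add: S.r_distr S.m_ac)
  also have "\<dots> = h (a \<otimes> (u2 \<otimes> k1) \<oplus> b \<otimes> (u1 \<otimes> k2))" unfolding 1(3) 2(3) by simp
  finally have eq: "h (u1 \<otimes> u2) \<otimes>\<^bsub>S\<^esub> g = h (a \<otimes> (u2 \<otimes> k1) \<oplus> b \<otimes> (u1 \<otimes> k2))" .
  have id: "ideal (R.forms a b n) R" by (rule R.forms_ideal) simp_all
  have "a \<otimes> (u2 \<otimes> k1) \<oplus> b \<otimes> (u1 \<otimes> k2) \<in> R.forms a b (Suc n)"
    by (rule R.forms_SucI[OF R.ideal_lmult[OF id _ 1(2)] R.ideal_lmult[OF id _ 2(2)]]) simp_all
  then show ?case using eq R.prime_compl[OF p 1(1) 2(1)] by blast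
qed

text \<open>
  By \<open>num\<close> and \<open>ker\<close>, \<open>R\<close> and \<open>S\<close> become equal after inverting the complement of \<open>p\<close>. Multiplying by
  elements outside \<open>p\<close>, one can move \<open>x\<close>, \<open>y\<close> and all coefficients of the relation into \<open>R\<close>, where
  \<open>regular_prime_integral\<close> applies.
\<close>

lemma integral_fraction_descend:
  assumes p: "primeideal p R" and reg: "regular_local_ring (localization R (carrier R - p))"
    and num: "\<And>x. x \<in> carrier S \<Longrightarrow> \<exists>u\<in>carrier R - p. \<exists>c\<in>carrier R. h u \<otimes>\<^bsub>S\<^esub> x = h c"
    and ker: "\<And>a. a \<in> carrier R \<Longrightarrow> h a = \<zero>\<^bsub>S\<^esub> \<Longrightarrow> \<exists>s\<in>carrier R - p. s \<otimes> a = \<zero>"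
    and x [simp]: "x \<in> carrier S" and y: "y \<in> nonzerodivisors S" and int: "S.integral_fraction x y"
  shows "\<exists>v\<in>carrier R - p. \<exists>r\<in>carrier S. h v \<otimes>\<^bsub>S\<^esub> x = y \<otimes>\<^bsub>S\<^esub> r"
proof -
  have yc [simp]: "y \<in> carrier S" by (rule S.nonzerodivisorD(1)[OF y])
  obtain u1 c1 where 1: "u1 \<in> carrier R - p" "c1 \<in> carrier R" "h u1 \<otimes>\<^bsub>S\<^esub> x = h c1" using num[OF x] by blast
  obtain u2 c2 where 2: "u2 \<in> carrier R - p" "c2 \<in> carrier R" "h u2 \<otimes>\<^bsub>S\<^esub> y = h c2" using num[OF yc] by blast
  define u where "u = u1 \<otimes> u2"
  define a where "a = u2 \<otimes> c1"
  define b where "b = u1 \<otimes> c2"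
  have [simp]: "u1 \<in> carrier R" "u2 \<in> carrier R" "c1 \<in> carrier R" "c2 \<in> carrier R" using 1 2 by auto
  have up: "u \<in> carrier R - p" unfolding u_def by (rule R.prime_compl[OF p 1(1) 2(1)])
  have [simp]: "u \<in> carrier R" "a \<in> carrier R" "b \<in> carrier R" by (simp_all add: u_def a_def b_def)
  have "h u2 \<otimes>\<^bsub>S\<^esub> (h u1 \<otimes>\<^bsub>S\<^esub> x) = h a" unfolding 1(3) a_def by simp
  then have ha: "h u \<otimes>\<^bsub>S\<^esub> x = h a" by (simp add: u_def S.m_ac)
  have "h u1 \<otimes>\<^bsub>S\<^esub> (h u2 \<otimes>\<^bsub>S\<^esub> y) = h b" unfolding 2(3) b_def by simp
  then have hb: "h u \<otimes>\<^bsub>S\<^esub> y = h b" by (simp add: u_def S.m_ac)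
  have "S.integral_fraction (h u \<otimes>\<^bsub>S\<^esub> x) (h u \<otimes>\<^bsub>S\<^esub> y)"
    by (rule S.integral_fraction_scale_both[OF x yc _ int]) simp
  then obtain n g where g: "g \<in> S.forms (h a) (h b) n" "h a [^]\<^bsub>S\<^esub> Suc n = h b \<otimes>\<^bsub>S\<^esub> g"
    unfolding ha hb S.integral_fraction_def by blast
  have "\<exists>w\<in>carrier R - p. \<exists>k\<in>R.forms a b n. h w \<otimes>\<^bsub>S\<^esub> g = h k"
    by (rule forms_descend[OF p num _ _ g(1)]) simp_all
  then obtain w k where w: "w \<in> carrier R - p" "k \<in> R.forms a b n" "h w \<otimes>\<^bsub>S\<^esub> g = h k"
    by blast
  have [simp]: "w \<in> carrier R" "k \<in> carrier R" "g \<in> carrier S"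
    using w R.forms_mem[OF _ _ w(2)] S.forms_mem[OF _ _ g(1)] by auto
  have "h (w \<otimes> a [^] Suc n) = h w \<otimes>\<^bsub>S\<^esub> (h a [^]\<^bsub>S\<^esub> Suc n)" by simp
  also have "\<dots> = h b \<otimes>\<^bsub>S\<^esub> (h w \<otimes>\<^bsub>S\<^esub> g)" unfolding g(2) by (simp add: S.m_lcomm)
  also have "\<dots> = h (b \<otimes> k)" unfolding w(3) by simp
  finally have "h (w \<otimes> a [^] Suc n \<ominus> b \<otimes> k) = \<zero>\<^bsub>S\<^esub>" by (simp add: S.r_neg R.minus_eq)
  then obtain s where s: "s \<in> carrier R - p" "s \<otimes> (w \<otimes> a [^] Suc n \<ominus> b \<otimes> k) = \<zero>"
    using ker[of "w \<otimes> a [^] Suc n \<ominus> b \<otimes> k"] by auto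
  define e where "e = a [^] Suc n"
  have [simp]: "s \<in> carrier R" "e \<in> carrier R" using s by (auto simp: e_def)
  have "(s \<otimes> w) \<otimes> e \<ominus> b \<otimes> (s \<otimes> k) = s \<otimes> (w \<otimes> e \<ominus> b \<otimes> k)"
    using \<open>s \<in> carrier R\<close> \<open>w \<in> carrier R\<close> \<open>e \<in> carrier R\<close> \<open>b \<in> carrier R\<close> \<open>k \<in> carrier R\<close>
    by algebra
  then have "(s \<otimes> w) \<otimes> e \<ominus> b \<otimes> (s \<otimes> k) = \<zero>" using s(2) unfolding e_def by (rule trans)
  then have rel: "(s \<otimes> w) \<otimes> a [^] Suc n = b \<otimes> (s \<otimes> k)"
    unfolding e_def[symmetric] by (rule R.ring_eqI) simp_all
  have sk: "s \<otimes> k \<in> R.forms a b n" by (rule R.ideal_lmult[OF R.forms_ideal _ w(2)]) simp_all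
  have nontorsion: "v \<otimes> b \<noteq> \<zero>" if v: "v \<in> carrier R - p" for v
  proof
    assume vb: "v \<otimes> b = \<zero>"
    have [simp]: "v \<in> carrier R" using v by simp
    have "y \<otimes>\<^bsub>S\<^esub> h (v \<otimes> u) = h v \<otimes>\<^bsub>S\<^esub> (h u \<otimes>\<^bsub>S\<^esub> y)" by (simp add: S.m_ac)
    also have "\<dots> = h (v \<otimes> b)" unfolding hb by simp
    also have "\<dots> = \<zero>\<^bsub>S\<^esub>" unfolding vb by simp
    finally have "h (v \<otimes> u) = \<zero>\<^bsub>S\<^esub>" using S.nonzerodivisorD(2)[OF y, of "h (v \<otimes> u)"] by simp
    then obtain s' where s': "s' \<in> carrier R - p" "s' \<otimes> (v \<otimes> u) = \<zero>"
      using ker[of "v \<otimes> u"] by auto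
    then have "\<zero> \<in> carrier R - p" using R.prime_compl[OF p s'(1) R.prime_compl[OF p v up]] by simp
    then show False using R.ideal_zero[OF R.prime_ideal[OF p]] by simp
  qed
  have "\<exists>v\<in>carrier R - p. \<exists>c\<in>carrier R. v \<otimes> a = b \<otimes> c"
    by (rule R.regular_prime_integral[OF p reg _ _ R.prime_compl[OF p s(1) w(1)] sk rel nontorsion]) simp_all
  then obtain v c where v: "v \<in> carrier R - p" "c \<in> carrier R" "v \<otimes> a = b \<otimes> c" by blast
  have [simp]: "v \<in> carrier R" "c \<in> carrier R" using v by auto
  have "h (v \<otimes> u) \<otimes>\<^bsub>S\<^esub> x = h v \<otimes>\<^bsub>S\<^esub> (h u \<otimes>\<^bsub>S\<^esub> x)" by (simp add: S.m_assoc)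
  also have "\<dots> = h (v \<otimes> a)" unfolding ha by simp
  also have "\<dots> = (h u \<otimes>\<^bsub>S\<^esub> y) \<otimes>\<^bsub>S\<^esub> h c" unfolding v(3) hb by simp
  also have "\<dots> = y \<otimes>\<^bsub>S\<^esub> (h u \<otimes>\<^bsub>S\<^esub> h c)" by (simp add: S.m_ac)
  finally have "h (v \<otimes> u) \<otimes>\<^bsub>S\<^esub> x = y \<otimes>\<^bsub>S\<^esub> (h u \<otimes>\<^bsub>S\<^esub> h c)" .
  moreover have "h u \<otimes>\<^bsub>S\<^esub> h c \<in> carrier S" by simp
  ultimately show ?thesis using R.prime_compl[OF p v(1) up] by (intro bexI)
qed

end

section \<open>Normality along a stratum\<close>

context cring
begin

lemma subset_normalization: "to_fractions R ` carrier R \<subseteq> normalization R"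
proof
  fix x assume "x \<in> to_fractions R ` carrier R"
  then obtain r where r: "r \<in> carrier R" "x = to_fractions R r" by blast
  interpret T: localization_map R "total_fractions R" "to_fractions R" "nonzerodivisors R"
    by (rule total_fractions_map(1))
  have x [simp]: "x \<in> carrier (total_fractions R)" using r by simp
  let ?p = "[\<one>\<^bsub>total_fractions R\<^esub>, \<ominus>\<^bsub>total_fractions R\<^esub> x]"
  have "to_fractions R \<one> = \<one>\<^bsub>total_fractions R\<^esub>" "to_fractions R (\<ominus> r) = \<ominus>\<^bsub>total_fractions R\<^esub> x"
    using r by simp_all
  then have "set ?p = to_fractions R ` {\<one>, \<ominus> r}" by (simp only: list.set image_insert image_empty)
  also have "\<dots> \<subseteq> to_fractions R ` carrier R" using r(1) by (intro image_mono) simp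
  finally have "set ?p \<subseteq> to_fractions R ` carrier R" .
  moreover have "T.S.eval ?p x = \<zero>\<^bsub>total_fractions R\<^esub>"
    by (simp add: T.S.r_neg)
  ultimately show "x \<in> normalization R"
    unfolding normalization_def integral_over_def by (intro CollectI conjI exI[of _ ?p] x) simp_all
qed

text \<open>
  Every element of the total ring of fractions is some \<open>a/b\<close> with \<open>b\<close> a nonzerodivisor, and its integrality
  over \<open>R\<close> amounts to a homogeneous relation between \<open>a\<close> and \<open>b\<close>.
\<close>

lemma integrally_closed_normal:
  assumes "reduced_ring R" and "noetherian_ring R"
    and closed: "\<And>a b. a \<in> carrier R \<Longrightarrow> b \<in> nonzerodivisors R \<Longrightarrow> integral_fraction a b \<Longrightarrow>
      \<exists>r\<in>carrier R. a = b \<otimes> r"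
  shows "normal_ring R"
proof -
  interpret T: localization_map R "total_fractions R" "to_fractions R" "nonzerodivisors R"
    by (rule total_fractions_map(1))
  have "normalization R \<subseteq> to_fractions R ` carrier R"
  proof
    fix x assume "x \<in> normalization R"
    then have x: "x \<in> carrier (total_fractions R)"
      and int: "integral_over (total_fractions R) (to_fractions R ` carrier R) x"
      by (auto simp: normalization_def)
    obtain a b where ab: "a \<in> carrier R" "b \<in> nonzerodivisors R"
      "to_fractions R b \<otimes>\<^bsub>total_fractions R\<^esub> x = to_fractions R a"
      using T.numerator[OF x] by blast
    have bc: "b \<in> carrier R" by (rule nonzerodivisorD(1)[OF ab(2)])
    have "integral_fraction a b"
      by (rule T.integral_over_imp_fraction[OF ab(1) bc x ab(3) total_fractions_map(2) int])
    then obtain r where r: "r \<in> carrier R" "a = b \<otimes> r" using closed[OF ab(1,2)] by blast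
    have "x = to_fractions R r"
      by (rule T.den_cancel[OF ab(2) x]) (use r bc ab in simp_all)
    then show "x \<in> to_fractions R ` carrier R" using r by blast
  qed
  then show ?thesis using assms(1,2) subset_normalization by (auto simp: normal_ring_def)
qed

end

theorem proposition3p3:
  fixes A :: "('a, 'm) ring_scheme"
    and B :: "('a \<times> 'a) set set"
    and A' :: "('a \<times> 'a) set ring"
    and J' :: "('a \<times> 'a) set set"
    and V :: "'a set set"
    and g :: 'a
  assumes "reduced_ring A" and "noetherian_ring A"
    and "module_finite (total_fractions A) (to_fractions A ` carrier A) (normalization A)"
    and "subring B (total_fractions A)"
    and "to_fractions A ` carrier A \<subseteq> B" and "B \<subseteq> normalization A"
    and "A' = (total_fractions A)\<lparr>carrier := B\<rparr>"
    and "V \<in> Strata A"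
    and "J' = radical_ideal A' (genideal A' (to_fractions A ` stratum_ideal A V))"
    and "g \<in> stratum_ideal A V" and "g \<in> nonzerodivisors A"
    and "mult_map A' J' \<in> ring_iso A' (End_ring A' J')"
  shows "\<forall>P\<in>V. normal_ring (localization A' (to_fractions A ` (carrier A - P)))"
proof
  fix P assume "P \<in> V"
  define Q where "Q = total_fractions A"
  define \<phi> where "\<phi> = to_fractions A"
  interpret A: cring A using assms(1) by (simp add: reduced_ring_def)
  interpret Q: localization_map A Q \<phi> "nonzerodivisors A"
    unfolding Q_def \<phi>_def by (rule A.total_fractions_map(1))
  have inj: "inj_on \<phi> (carrier A)" unfolding \<phi>_def by (rule A.total_fractions_map(2))

  obtain P0 where "V = stratum A (sing_ideal A P0)" using assms(8) by (auto simp: Strata_def)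
  then have VL: "sing_ideal A ` V = {sing_ideal A P}" and PS: "P \<in> Sing A"
    using \<open>P \<in> V\<close> by (auto simp: stratum_def)
  have LV: "stratum_ideal A V = sing_ideal A P" by (simp add: stratum_ideal_def VL)
  have P: "primeideal P A" using PS by (simp add: Sing_def)
  have LP: "sing_ideal A P \<subseteq> P" using PS by (auto simp: sing_ideal_def)
  have LA: "sing_ideal A P \<subseteq> carrier A" using LP A.ideal_subset[OF A.prime_ideal[OF P]] by blast

  have B: "subring B Q" "\<phi> ` carrier A \<subseteq> B" "B \<subseteq> carrier Q"
    using assms(4,5) subringE(1)[OF assms(4)] by (simp_all add: Q_def \<phi>_def)
  have A': "A' = Q\<lparr>carrier := B\<rparr>" using assms(7) by (simp add: Q_def)
  have ops: "carrier A' = B" "\<And>x y. x \<otimes>\<^bsub>A'\<^esub> y = x \<otimes>\<^bsub>Q\<^esub> y" "\<And>x y. x \<oplus>\<^bsub>A'\<^esub> y = x \<oplus>\<^bsub>Q\<^esub> y"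
    "\<one>\<^bsub>A'\<^esub> = \<one>\<^bsub>Q\<^esub>" "\<zero>\<^bsub>A'\<^esub> = \<zero>\<^bsub>Q\<^esub>" "\<And>x n. x [^]\<^bsub>A'\<^esub> (n::nat) = x [^]\<^bsub>Q\<^esub> n"
    by (simp_all add: A' flip: Q.S.nat_pow_consistent)
  interpret A': cring A'
    unfolding A' using Q.S.subcring_iff[OF B(3)] Q.S.subcringI'[OF B(1)] by simp
  have noeth: "noetherian_ring A'"
  proof -
    obtain us where us: "set us \<subseteq> normalization A"
      "normalization A = Q.S.Span (\<phi> ` carrier A) us"
      using assms(3) unfolding module_finite_def Q_def \<phi>_def by blast
    have "set us \<subseteq> carrier Q" using us(1) by (auto simp: normalization_def Q_def)
    then show ?thesis
      unfolding A' using us(2) assms(6) by (intro Q.finite_subring_noetherian[OF assms(2) _ B(1,2)]) auto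
  qed
  have red: "reduced_ring A'"
    using Q.reduced[OF assms(1)] A'.is_cring B(3) unfolding reduced_ring_def ops by blast
  interpret \<Phi>: ring_hom_cring A A' \<phi>
  proof
    show "\<phi> \<in> ring_hom A A'"
      using B(2) by (intro ring_hom_memI) (auto simp: ops)
  qed

  define S where "S = \<phi> ` (carrier A - P)"
  define D where "D = localization A' S"
  define \<psi> where "\<psi> = (\<lambda>a. fraction A' S a \<one>\<^bsub>A'\<^esub>)"
  interpret D: localization_map A' D \<psi> S
    unfolding D_def \<psi>_def
  proof (rule A'.fraction_localization_map)
    show "S \<subseteq> carrier A'" unfolding S_def using \<Phi>.hom_closed by blast
    have "\<phi> \<one>\<^bsub>A\<^esub> \<in> S" unfolding S_def using A.prime_one[OF P] by blast
    then show "\<one>\<^bsub>A'\<^esub> \<in> S" by (simp add: ops)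
    fix s t assume "s \<in> S" "t \<in> S"
    then obtain s' t' where *: "s' \<in> carrier A - P" "t' \<in> carrier A - P" "s = \<phi> s'" "t = \<phi> t'"
      by (auto simp: S_def)
    then have "s \<otimes>\<^bsub>A'\<^esub> t = \<phi> (s' \<otimes>\<^bsub>A\<^esub> t')" by (simp add: ops)
    then show "s \<otimes>\<^bsub>A'\<^esub> t \<in> S" unfolding S_def using A.prime_compl[OF P *(1,2)] by blast
  qed
  interpret N: noetherian_cring D
    using D.noetherian[OF noeth] D.S.is_cring by (intro noetherian_cring.intro)
  define \<theta> where "\<theta> = (\<lambda>a. \<psi> (\<phi> a))"
  interpret \<Theta>: ring_hom_cring A D \<theta>
  proof
    show "\<theta> \<in> ring_hom A D"
      using ring_hom_trans[OF \<Phi>.homh D.homh] by (simp add: \<theta>_def comp_def)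
  qed

  define E where "E = genideal A' (\<phi> ` sing_ideal A P)"
  have gen: "\<phi> ` sing_ideal A P \<subseteq> carrier A'" using LA by auto
  have E: "ideal E A'" unfolding E_def by (rule A'.genideal_ideal[OF gen])
  have J': "J' = radical_ideal A' E" using assms(9) by (simp add: E_def LV \<phi>_def)
  have J: "ideal J' A'" unfolding J' by (rule A'.radical_ideal_ideal[OF E])
  have surj: "\<exists>c\<in>carrier A'. f = mult_map A' J' c" if "f \<in> carrier (End_ring A' J')" for f
    using assms(12) that by (auto simp: ring_iso_def bij_betw_def)
  have gJ: "\<phi> g \<in> J'"
    using assms(10) A'.genideal_self[OF gen] A'.radical_ideal_superset[OF E]
    unfolding J' E_def LV by blast
  have gn: "\<phi> g \<in> nonzerodivisors A'"
    unfolding nonzerodivisors_def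
  proof (intro CollectI conjI ballI impI)
    have gc: "g \<in> carrier A" by (rule A.nonzerodivisorD(1)[OF assms(11)])
    then show "\<phi> g \<in> carrier A'" by simp
    fix b assume b: "b \<in> carrier A'" "\<phi> g \<otimes>\<^bsub>A'\<^esub> b = \<zero>\<^bsub>A'\<^esub>"
    then have "b \<in> carrier Q" using B(3) by (auto simp: ops)
    then have "b = \<zero>\<^bsub>Q\<^esub>"
      using b(2) Q.den_cancel[OF assms(11), of b "\<zero>\<^bsub>Q\<^esub>"] gc by (simp add: ops)
    then show "b = \<zero>\<^bsub>A'\<^esub>" by (simp add: ops)
  qed

  \<comment> \<open>The singular primes below \<open>P\<close> all contain \<open>sing_ideal A P\<close>, which generates \<open>J'\<close> up to radical;
    so a prime of \<open>D\<close> that does not contain the extension of \<open>J'\<close> lies over a regular prime of \<open>A\<close>.\<close>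
  have loc: "\<exists>y\<in>carrier D - q. \<exists>r\<in>carrier D. y \<otimes>\<^bsub>D\<^esub> \<alpha> = \<beta> \<otimes>\<^bsub>D\<^esub> r"
    if \<beta>: "\<beta> \<in> nonzerodivisors D" and \<alpha>: "\<alpha> \<in> carrier D" "D.S.integral_fraction \<alpha> \<beta>"
      and q: "primeideal q D" and Jq: "\<not> D.extension J' \<subseteq> q" for \<alpha> \<beta> q
  proof -
    define p where "p = {a \<in> carrier A. \<theta> a \<in> q}"
    have p: "primeideal p A"
      unfolding p_def by (rule \<Theta>.ring.primeideal_vimage[OF A.is_cring q])
    have pP: "p \<subseteq> P"
      using D.preimage_prime_disjoint[OF q] by (auto simp: p_def S_def \<theta>_def)
    have "p \<notin> Sing A"
    proof
      assume "p \<in> Sing A"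
      then have "sing_ideal A P \<subseteq> p" using pP by (auto simp: sing_ideal_def)
      then have "\<phi> ` sing_ideal A P \<subseteq> {a \<in> carrier A'. \<psi> a \<in> q}"
        using gen by (auto simp: p_def \<theta>_def)
      then have "E \<subseteq> {a \<in> carrier A'. \<psi> a \<in> q}"
        unfolding E_def by (rule A'.genideal_minimal[OF D.preimage_ideal[OF D.S.prime_ideal[OF q]]])
      then have "J' \<subseteq> {a \<in> carrier A'. \<psi> a \<in> q}"
        unfolding J' by (rule A'.radical_ideal_subset_prime[OF D.preimage_prime[OF q]])
      then have "D.extension J' \<subseteq> q" using D.extension_subset_prime[OF q] by blast
      then show False using Jq by simp
    qed
    then have reg: "regular_local_ring (localization A (carrier A - p))" using p by (simp add: Sing_def)
    have one: "\<one>\<^bsub>A\<^esub> \<in> carrier A - p" using A.prime_one[OF p] by simp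
    \<comment> \<open>\<open>A\<^sub>p\<close> is normal, so the elements of \<open>A'\<close>, being integral over \<open>A\<close>, have denominators outside \<open>p\<close>.\<close>
    have num: "\<exists>u\<in>carrier A - p. \<exists>c\<in>carrier A. \<theta> u \<otimes>\<^bsub>D\<^esub> x = \<theta> c" if x: "x \<in> carrier D" for x
    proof -
      obtain a' s' where a': "a' \<in> carrier A'" "s' \<in> S" "\<psi> s' \<otimes>\<^bsub>D\<^esub> x = \<psi> a'"
        using D.numerator[OF x] by blast
      obtain s where s: "s \<in> carrier A - P" "s' = \<phi> s" using a'(2) by (auto simp: S_def)
      have "a' \<in> normalization A" using a'(1) assms(6) by (auto simp: ops)
      then have a'Q: "a' \<in> carrier Q" and int: "integral_over Q (\<phi> ` carrier A) a'"
        by (auto simp: normalization_def Q_def \<phi>_def)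
      obtain a b where ab: "a \<in> carrier A" "b \<in> nonzerodivisors A" "\<phi> b \<otimes>\<^bsub>Q\<^esub> a' = \<phi> a"
        using Q.numerator[OF a'Q] by blast
      have bc [simp]: "b \<in> carrier A" by (rule A.nonzerodivisorD(1)[OF ab(2)])
      have "A.integral_fraction a b"
        by (rule Q.integral_over_imp_fraction[OF ab(1) bc a'Q ab(3) inj int])
      then obtain n h where h: "h \<in> A.forms a b n" "a [^]\<^bsub>A\<^esub> Suc n = b \<otimes>\<^bsub>A\<^esub> h"
        by (auto simp: A.integral_fraction_def)
      have "\<one>\<^bsub>A\<^esub> \<otimes>\<^bsub>A\<^esub> a [^]\<^bsub>A\<^esub> Suc n = b \<otimes>\<^bsub>A\<^esub> h"
        unfolding h(2)[symmetric] using ab(1) by (intro A.l_one) simp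
      moreover have "v \<otimes>\<^bsub>A\<^esub> b \<noteq> \<zero>\<^bsub>A\<^esub>" if v: "v \<in> carrier A - p" for v
      proof
        assume "v \<otimes>\<^bsub>A\<^esub> b = \<zero>\<^bsub>A\<^esub>"
        then have "v = \<zero>\<^bsub>A\<^esub>" using A.nonzerodivisorD(2)[OF ab(2), of v] v by (simp add: A.m_comm)
        then show False using v A.ideal_zero[OF A.prime_ideal[OF p]] by simp
      qed
      ultimately obtain v c where v: "v \<in> carrier A - p" "c \<in> carrier A" "v \<otimes>\<^bsub>A\<^esub> a = b \<otimes>\<^bsub>A\<^esub> c"
        using A.regular_prime_integral[OF p reg ab(1) bc one h(1)] by blast
      have [simp]: "v \<in> carrier A" "s \<in> carrier A" using v s by auto
      have "\<phi> b \<otimes>\<^bsub>Q\<^esub> (\<phi> v \<otimes>\<^bsub>Q\<^esub> a') = \<phi> v \<otimes>\<^bsub>Q\<^esub> (\<phi> b \<otimes>\<^bsub>Q\<^esub> a')"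
        using a'Q by (intro Q.S.m_lcomm) simp_all
      also have "\<dots> = \<phi> (v \<otimes>\<^bsub>A\<^esub> a)" unfolding ab(3) using ab(1) by simp
      also have "\<dots> = \<phi> b \<otimes>\<^bsub>Q\<^esub> \<phi> c" unfolding v(3) using v(2) by simp
      finally have cancel: "\<phi> b \<otimes>\<^bsub>Q\<^esub> (\<phi> v \<otimes>\<^bsub>Q\<^esub> a') = \<phi> b \<otimes>\<^bsub>Q\<^esub> \<phi> c" .
      have "\<phi> v \<otimes>\<^bsub>Q\<^esub> a' = \<phi> c"
        by (rule Q.den_cancel[OF ab(2) _ _ cancel]) (use a'Q v(2) in simp_all)
      then have va: "\<phi> v \<otimes>\<^bsub>A'\<^esub> a' = \<phi> c" by (simp add: ops)
      have "\<theta> (v \<otimes>\<^bsub>A\<^esub> s) \<otimes>\<^bsub>D\<^esub> x = \<theta> v \<otimes>\<^bsub>D\<^esub> (\<theta> s \<otimes>\<^bsub>D\<^esub> x)"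
        using x by (simp add: D.S.m_assoc)
      also have "\<dots> = \<psi> (\<phi> v) \<otimes>\<^bsub>D\<^esub> (\<psi> s' \<otimes>\<^bsub>D\<^esub> x)" by (simp add: \<theta>_def s(2))
      also have "\<dots> = \<psi> (\<phi> v \<otimes>\<^bsub>A'\<^esub> a')" unfolding a'(3) using a'(1) by simp
      also have "\<dots> = \<theta> c" unfolding va \<theta>_def ..
      finally have eq: "\<theta> (v \<otimes>\<^bsub>A\<^esub> s) \<otimes>\<^bsub>D\<^esub> x = \<theta> c" .
      have "s \<in> carrier A - p" using s(1) pP by blast
      then show ?thesis using eq v(2) A.prime_compl[OF p v(1)] by blast
    qed
    have ker: "\<exists>s\<in>carrier A - p. s \<otimes>\<^bsub>A\<^esub> a = \<zero>\<^bsub>A\<^esub>" if a: "a \<in> carrier A" "\<theta> a = \<zero>\<^bsub>D\<^esub>" for a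
    proof -
      obtain s' where s': "s' \<in> S" "s' \<otimes>\<^bsub>A'\<^esub> \<phi> a = \<zero>\<^bsub>A'\<^esub>"
        using D.kernel[of "\<phi> a"] a by (auto simp: \<theta>_def)
      then obtain s where s: "s \<in> carrier A - P" "s' = \<phi> s" by (auto simp: S_def)
      have "\<phi> (s \<otimes>\<^bsub>A\<^esub> a) = \<phi> \<zero>\<^bsub>A\<^esub>" using s' s a by (simp add: ops)
      from inj_onD[OF inj this] have "s \<otimes>\<^bsub>A\<^esub> a = \<zero>\<^bsub>A\<^esub>" using s(1) a(1) by simp
      then show ?thesis using s(1) pP by blast
    qed
    have "\<exists>v\<in>carrier A - p. \<exists>r\<in>carrier D. \<theta> v \<otimes>\<^bsub>D\<^esub> \<alpha> = \<beta> \<otimes>\<^bsub>D\<^esub> r"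
      by (rule \<Theta>.integral_fraction_descend[OF p reg num ker \<alpha>(1) \<beta> \<alpha>(2)])
    then obtain v r where v: "v \<in> carrier A - p" "r \<in> carrier D" "\<theta> v \<otimes>\<^bsub>D\<^esub> \<alpha> = \<beta> \<otimes>\<^bsub>D\<^esub> r" by blast
    then have "\<theta> v \<in> carrier D - q" by (auto simp: p_def)
    then show ?thesis using v by blast
  qed

  have "normal_ring D"
  proof (rule D.S.integrally_closed_normal[OF D.reduced[OF red] D.noetherian[OF noeth]])
    fix \<alpha> \<beta> assume \<alpha>: "\<alpha> \<in> carrier D" and \<beta>: "\<beta> \<in> nonzerodivisors D"
      and int: "D.S.integral_fraction \<alpha> \<beta>"
    show "\<exists>r\<in>carrier D. \<alpha> = \<beta> \<otimes>\<^bsub>D\<^esub> r"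
    proof (rule N.grauert_remmert[OF D.extension_ideal[OF J] _ \<beta> _ _ \<alpha> int])
      show "x \<in> D.extension J'" if "x \<in> carrier D" "x [^]\<^bsub>D\<^esub> n \<in> D.extension J'" for x and n :: nat
        by (rule D.extension_radical[OF J _ that]) (simp add: J' A'.radical_ideal_radical)
      show "\<exists>r\<in>carrier D. a = \<beta> \<otimes>\<^bsub>D\<^esub> r"
        if "a \<in> carrier D" "\<And>j. j \<in> D.extension J' \<Longrightarrow> \<exists>j'\<in>D.extension J'. a \<otimes>\<^bsub>D\<^esub> j = \<beta> \<otimes>\<^bsub>D\<^esub> j'" for a
        by (rule D.endomorphisms_extend[OF noeth J surj gJ gn that(1) \<beta> that(2)])
      show "\<exists>y\<in>carrier D - q. \<exists>r\<in>carrier D. y \<otimes>\<^bsub>D\<^esub> a = \<beta> \<otimes>\<^bsub>D\<^esub> r"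
        if "a \<in> carrier D" "D.S.integral_fraction a \<beta>" "primeideal q D" "\<not> D.extension J' \<subseteq> q" for a q
        by (rule loc[OF \<beta> that])
    qed
  qed
  then show "normal_ring (localization A' (to_fractions A ` (carrier A - P)))"
    by (simp add: D_def S_def \<phi>_def)
qed

end
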